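(* Let $A$ be a positive self-adjoint operator in $L^2(\mathbb{R}^N)$ whose heat semigroup $\mathcal{T}_t=e^{-At}$ is symmetric and submarkovian, and let $\mathcal{Q}$, with domain $\mathfrak{D}$, be the associated Dirichlet form. Assume there exist constants $1\le r<2$, $d>0$ and $C_1>0$ such that every function $f\in\mathfrak{D}\cap L^1(\mathbb{R}^N)\cap L^2(\mathbb{R}^N)$ with $\|f\|_r=1$ satisfies $$\mathcal{Q}(f,f)\ge C_1\|f\|_2^2\,\min\{1,\|f\|_2^{2/d}\}.$$ Then, for any $1\le q<p<\infty$ and every $v\in L^1(\mathbb{R}^N)\cap L^p(\mathbb{R}^N)$, there exist a constant $C_2>0$ and a time $t_0>0$ such that $$\|\mathcal{T}_t(v)\|_p\le C_2\,t^{-\varrho(q,p)}\|v\|_q\qquad\text{for all } t>t_0,\qquad\text{where}\quad \varrho(q,p)=\frac{dr}{2-r}\left(\frac1q-\frac1p\right).$$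
   Context: $\|\cdot\|_p$ denotes the norm of $L^p(\mathbb{R}^N)$. For a positive self-adjoint operator $A$ in $L^2(\mathbb{R}^N)$, the associated form is $\mathcal{Q}(f,f)=\langle Af,f\rangle$, extended by closure to its domain $\mathfrak{D}=\mathrm{Dom}(A^{1/2})$ (so $\mathcal{Q}(f,g)=\langle A^{1/2}f,A^{1/2}g\rangle$). "Dirichlet form" means that the strongly continuous symmetric semigroup $\mathcal{T}_t=e^{-At}$ is submarkovian: $0\le f\le 1$ a.e. implies $0\le \mathcal{T}_tf\le 1$ a.e.; consequently $\mathcal{T}_t$ extends from $L^1\cap L^\infty$ to a contraction on every $L^p(\mathbb{R}^N)$, $1\le p\le\infty$, and $\mathcal{T}_t(v)$ is understood in this sense. *)

theory Defs
  imports "HOL-Analysis.Analysis"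
begin

text \<open>
  Elements of \<open>L\<^sup>p\<close> are represented by functions, so equalities between them are equalities
  almost everywhere. All functions are real valued.
\<close>

definition Lp_space :: "real \<Rightarrow> ('a::euclidean_space \<Rightarrow> real) set" where
  "Lp_space p = {f \<in> borel_measurable lebesgue. integrable lebesgue (\<lambda>x. \<bar>f x\<bar> powr p)}"

definition Linf_space :: "('a::euclidean_space \<Rightarrow> real) set" where
  "Linf_space = {f \<in> borel_measurable lebesgue. \<exists>M. AE x in lebesgue. \<bar>f x\<bar> \<le> M}"

definition Lp_norm :: "real \<Rightarrow> ('a::euclidean_space \<Rightarrow> real) \<Rightarrow> real" where
  "Lp_norm p f = (LINT x|lebesgue. \<bar>f x\<bar> powr p) powr (1 / p)"

definition L2_inner :: "('a::euclidean_space \<Rightarrow> real) \<Rightarrow> ('a \<Rightarrow> real) \<Rightarrow> real" where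
  "L2_inner f g = (LINT x|lebesgue. f x * g x)"

text \<open>An unbounded operator in \<open>L\<^sup>2\<close> is given by its domain \<open>D\<close> and a map \<open>A\<close>, whose values
  outside \<open>D\<close> are irrelevant.\<close>

definition densely_defined_linear_operator ::
    "('a::euclidean_space \<Rightarrow> real) set \<Rightarrow> (('a \<Rightarrow> real) \<Rightarrow> 'a \<Rightarrow> real) \<Rightarrow> bool" where
  "densely_defined_linear_operator D A \<longleftrightarrow>
     D \<subseteq> Lp_space 2 \<and> A ` D \<subseteq> Lp_space 2 \<and>
     (\<forall>f\<in>D. \<forall>g\<in>Lp_space 2. (AE x in lebesgue. f x = g x) \<longrightarrow>
        g \<in> D \<and> (AE x in lebesgue. A f x = A g x)) \<and>
     (\<forall>f\<in>D. \<forall>g\<in>D. \<forall>a b. (\<lambda>x. a * f x + b * g x) \<in> D \<and>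
        (AE x in lebesgue. A (\<lambda>y. a * f y + b * g y) x = a * A f x + b * A g x)) \<and>
     (\<forall>f\<in>Lp_space 2. \<forall>\<epsilon>>0. \<exists>g\<in>D. Lp_norm 2 (\<lambda>x. f x - g x) < \<epsilon>)"

text \<open>The last conjunct says that \<open>A\<close> coincides with its adjoint, including the domains:
  the right-hand side of the equivalence means that \<open>g\<close> lies in the domain of the adjoint,
  which maps it to \<open>h\<close>.\<close>

definition self_adjoint ::
    "('a::euclidean_space \<Rightarrow> real) set \<Rightarrow> (('a \<Rightarrow> real) \<Rightarrow> 'a \<Rightarrow> real) \<Rightarrow> bool" where
  "self_adjoint D A \<longleftrightarrow> densely_defined_linear_operator D A \<and>
     (\<forall>g\<in>Lp_space 2. \<forall>h\<in>Lp_space 2.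
        (g \<in> D \<and> (AE x in lebesgue. A g x = h x)) \<longleftrightarrow>
        (\<forall>f\<in>D. L2_inner (A f) g = L2_inner f h))"

definition positive_operator ::
    "('a::euclidean_space \<Rightarrow> real) set \<Rightarrow> (('a \<Rightarrow> real) \<Rightarrow> 'a \<Rightarrow> real) \<Rightarrow> bool" where
  "positive_operator D A \<longleftrightarrow> (\<forall>f\<in>D. 0 \<le> L2_inner (A f) f)"

definition C0_semigroup ::
    "(real \<Rightarrow> ('a::euclidean_space \<Rightarrow> real) \<Rightarrow> 'a \<Rightarrow> real) \<Rightarrow> bool" where
  "C0_semigroup T \<longleftrightarrow>
     (\<forall>t\<ge>0. \<forall>f\<in>Lp_space 2. T t f \<in> Lp_space 2) \<and>
     (\<forall>t\<ge>0. \<forall>f\<in>Lp_space 2. \<forall>g\<in>Lp_space 2. \<forall>a b.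
        AE x in lebesgue. T t (\<lambda>y. a * f y + b * g y) x = a * T t f x + b * T t g x) \<and>
     (\<forall>t\<ge>0. \<exists>M. \<forall>f\<in>Lp_space 2. Lp_norm 2 (T t f) \<le> M * Lp_norm 2 f) \<and>
     (\<forall>f\<in>Lp_space 2. AE x in lebesgue. T 0 f x = f x) \<and>
     (\<forall>s\<ge>0. \<forall>t\<ge>0. \<forall>f\<in>Lp_space 2. AE x in lebesgue. T (s + t) f x = T s (T t f) x) \<and>
     (\<forall>f\<in>Lp_space 2. ((\<lambda>t. Lp_norm 2 (\<lambda>x. T t f x - f x)) \<longlongrightarrow> 0) (at_right 0))"

text \<open>\<open>T t\<close> is the operator \<open>e\<^bsup>-At\<^esup>\<close>: the family \<open>T\<close> is the strongly continuous semigroup whose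
  infinitesimal generator is \<open>-A\<close>, with equality of the domains.\<close>

definition heat_semigroup ::
    "('a::euclidean_space \<Rightarrow> real) set \<Rightarrow> (('a \<Rightarrow> real) \<Rightarrow> 'a \<Rightarrow> real) \<Rightarrow>
     (real \<Rightarrow> ('a \<Rightarrow> real) \<Rightarrow> 'a \<Rightarrow> real) \<Rightarrow> bool" where
  "heat_semigroup D A T \<longleftrightarrow> C0_semigroup T \<and>
     (\<forall>f\<in>Lp_space 2. \<forall>g\<in>Lp_space 2.
        (f \<in> D \<and> (AE x in lebesgue. A f x = g x)) \<longleftrightarrow>
        ((\<lambda>h. Lp_norm 2 (\<lambda>x. (T h f x - f x) / h - (- g x))) \<longlongrightarrow> 0) (at_right 0))"

definition symmetric_semigroup ::
    "(real \<Rightarrow> ('a::euclidean_space \<Rightarrow> real) \<Rightarrow> 'a \<Rightarrow> real) \<Rightarrow> bool" where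
  "symmetric_semigroup T \<longleftrightarrow>
     (\<forall>t\<ge>0. \<forall>f\<in>Lp_space 2. \<forall>g\<in>Lp_space 2. L2_inner (T t f) g = L2_inner f (T t g))"

definition submarkovian ::
    "(real \<Rightarrow> ('a::euclidean_space \<Rightarrow> real) \<Rightarrow> 'a \<Rightarrow> real) \<Rightarrow> bool" where
  "submarkovian T \<longleftrightarrow>
     (\<forall>t\<ge>0. \<forall>f\<in>Lp_space 2. (AE x in lebesgue. 0 \<le> f x \<and> f x \<le> 1) \<longrightarrow>
        (AE x in lebesgue. 0 \<le> T t f x \<and> T t f x \<le> 1))"

text \<open>The associated form is the closure of \<open>(f, g) \<mapsto> \<langle>A f, g\<rangle>\<close> on \<open>D\<close>: its domain consists
  of the \<open>L\<^sup>2\<close>-limits of sequences in \<open>D\<close> that are Cauchy with respect to the form. For a positive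
  self-adjoint \<open>A\<close> this domain is that of the square root of \<open>A\<close>.\<close>

definition form_approx ::
    "('a::euclidean_space \<Rightarrow> real) set \<Rightarrow> (('a \<Rightarrow> real) \<Rightarrow> 'a \<Rightarrow> real) \<Rightarrow>
     (nat \<Rightarrow> 'a \<Rightarrow> real) \<Rightarrow> ('a \<Rightarrow> real) \<Rightarrow> bool" where
  "form_approx D A F f \<longleftrightarrow>
     (\<forall>n. F n \<in> D) \<and>
     (\<lambda>n. Lp_norm 2 (\<lambda>x. F n x - f x)) \<longlonglongrightarrow> 0 \<and>
     (\<forall>\<epsilon>>0. \<exists>K. \<forall>m\<ge>K. \<forall>n\<ge>K.
        L2_inner (A (\<lambda>x. F m x - F n x)) (\<lambda>x. F m x - F n x) < \<epsilon>)"

definition form_domain ::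
    "('a::euclidean_space \<Rightarrow> real) set \<Rightarrow> (('a \<Rightarrow> real) \<Rightarrow> 'a \<Rightarrow> real) \<Rightarrow> ('a \<Rightarrow> real) set" where
  "form_domain D A = {f \<in> Lp_space 2. \<exists>F. form_approx D A F f}"

definition form ::
    "('a::euclidean_space \<Rightarrow> real) set \<Rightarrow> (('a \<Rightarrow> real) \<Rightarrow> 'a \<Rightarrow> real) \<Rightarrow>
     ('a \<Rightarrow> real) \<Rightarrow> ('a \<Rightarrow> real) \<Rightarrow> real" where
  "form D A f g = (THE c. \<forall>F G. form_approx D A F f \<longrightarrow> form_approx D A G g \<longrightarrow>
     (\<lambda>n. L2_inner (A (F n)) (G n)) \<longlonglongrightarrow> c)"

text \<open>Extension by continuity, from \<open>L\<^sup>1 \<inter> L\<^sup>\<infinity>\<close> to \<open>L\<^sup>p\<close> for finite \<open>p\<close>, of a single operator \<open>S\<close>.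
  If \<open>S\<close> is linear and contractive for the \<open>L\<^sup>p\<close> norm, the chosen \<open>u\<close> exists and is unique up to
  equality almost everywhere.\<close>

definition Lp_extension ::
    "real \<Rightarrow> (('a::euclidean_space \<Rightarrow> real) \<Rightarrow> 'a \<Rightarrow> real) \<Rightarrow> ('a \<Rightarrow> real) \<Rightarrow> 'a \<Rightarrow> real" where
  "Lp_extension p S v = (SOME u. u \<in> Lp_space p \<and>
     (\<exists>F. (\<forall>n. F n \<in> Lp_space 1 \<inter> Linf_space) \<and>
        (\<lambda>n. Lp_norm p (\<lambda>x. F n x - v x)) \<longlonglongrightarrow> 0 \<and>
        (\<lambda>n. Lp_norm p (\<lambda>x. S (F n) x - u x)) \<longlonglongrightarrow> 0))"

definition rho :: "real \<Rightarrow> real \<Rightarrow> real \<Rightarrow> real \<Rightarrow> real" where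
  "rho d r q p = d * r / (2 - r) * (1 / q - 1 / p)"

end

theory Submission
  imports Defs
begin

text \<open>
  Since the constants may depend on \<open>v\<close>, and the decay rate is largest for \<open>q = 1\<close>, it suffices to
  bound the \<open>L\<^sup>p\<close> norm of \<open>u\<^sub>t = T t v\<close> by a multiple of \<open>t powr - \<rho>(1, p)\<close> in terms of the \<open>L\<^sup>1\<close> and
  \<open>L\<^sup>p\<close> norms of a bounded \<open>v \<ge> 0\<close>. Choose a convex \<open>\<Phi>\<close> with derivative \<open>F\<close> and a function \<open>\<psi>\<close>
  whose squared derivative is comparable to \<open>F'\<close>. The energy \<open>y(t) = \<integral> \<Phi>(u\<^sub>t)\<close> satisfies
  \<open>- y' = Q(u\<^sub>t, F(u\<^sub>t)) \<ge> c Q(\<psi>(u\<^sub>t), \<psi>(u\<^sub>t))\<close> by the Stroock-Varopoulos inequality, and the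
  hypothesis, after interpolation of the \<open>L\<^sup>r\<close> norm between \<open>L\<^sup>1\<close> and \<open>L\<^sup>2\<close>, bounds the right-hand
  side below by a power of \<open>y\<close>. For \<open>p \<ge> 2\<close> one takes \<open>\<Phi>(x) = x\<^sup>p / p\<close> and \<open>\<psi>(x) = x powr (p / 2)\<close>. For
  \<open>p < 2\<close> this \<open>\<psi>(u\<^sub>t)\<close> need not be integrable, and both functions are shifted by one, so that \<open>\<Phi>\<close>
  is quadratic near \<open>0\<close>.

  The spectral theorem is avoided: the quotients \<open>\<langle>f - T h f, f\<rangle> / h\<close> increase as \<open>h\<close> decreases to
  \<open>0\<close>, because \<open>t \<mapsto> \<langle>T t f, f\<rangle>\<close> is convex, and if they are bounded then \<open>f\<close> lies in the form domain
  and the form at \<open>f\<close> is their supremum.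
\<close>

section \<open>Real inequalities\<close>

text \<open>The obstacle is the minimum with \<open>1\<close>: for large norms the hypothesis yields
  only a linear differential inequality. The energy \<open>y\<close> is therefore bounded by its
  initial bound \<open>Y\<close> first, and \<open>y <= Y\<close> turns the minimum into a power of
  \<open>y\<close>; this is how the L^p norm of \<open>v\<close> enters the constants. The exponent
  arises as follows. Put \<open>w = \<psi>(u)\<close>, \<open>b = ||w||_2^2\<close>,
  \<open>a = ||w||_1\<close> and \<open>\<beta> = (2 - r) / (r d)\<close>. Normalizing
  \<open>w\<close> in L^r and interpolating bounds \<open>Q(w, w)\<close> below by a multiple of
  \<open>b min(1, (b / a^2)^\<beta>)\<close>. If \<open>b / a^2 >= k y^\<gamma>\<close>, then
  \<open>- y' >= c y^(1 + \<gamma> \<beta>)\<close>, so \<open>y\<close> decays like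
  \<open>t^(- 1 / (\<gamma> \<beta>))\<close>. For \<open>p >= 2\<close> the bound on the mass gives
  \<open>\<gamma> = 1 / (p - 1)\<close>, hence the exponent
  \<open>(p - 1) / \<beta> = p \<rho>(1, p)\<close>. The energy is never differentiated: one-sided
  increments with an error quadratic in the time step take the place of \<open>y'\<close>. The
  resulting bounds depend on \<open>v\<close> only through a bound \<open>m\<close> for its L^1 and
  L^p integrals, so they hold uniformly for the truncations of an unbounded
  \<open>v\<close>.\<close>

lemma midpoint_convex_imp_convex_on:
  fixes g :: "real \<Rightarrow> real"
  assumes cont: "continuous_on {0..} g"
    and mid: "\<And>x k. 0 \<le> x \<Longrightarrow> 0 \<le> k \<Longrightarrow> 2 * g (x + k) \<le> g x + g (x + 2 * k)"
  shows "convex_on {0..} g"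
proof (rule convex_on_linorderI)
  fix t a b :: real
  assume t: "0 < t" "t < 1" and ab: "a \<in> {0..}" "b \<in> {0..}" "a < b"
  define w where "w = (g b - g a) / (b - a)"
  have w: "w * (b - a) = g b - g a" using ab by (simp add: w_def)
  \<comment> \<open>Subtracting the chord preserves the midpoint inequality and makes the function
    vanish at both ends; it remains to see that its maximum is not positive.\<close>
  define d where "d x = g x - (g a + (x - a) * w)" for x
  have d0: "d a = 0" "d b = 0" using ab w by (auto simp: d_def algebra_simps)
  have dcont: "continuous_on {a..b} d"
    unfolding d_def by (intro continuous_intros continuous_on_subset[OF cont]) (use ab in auto)
  have dmid: "2 * d (x + k) \<le> d x + d (x + 2 * k)" if "0 \<le> x" "0 \<le> k" for x k
  proof -
    have "d x + d (x + 2 * k) - 2 * d (x + k) = g x + g (x + 2 * k) - 2 * g (x + k)"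
      unfolding d_def by (simp add: algebra_simps)
    then show ?thesis using mid[OF that] by linarith
  qed
  obtain m where m: "m \<in> {a..b}" "\<And>x. x \<in> {a..b} \<Longrightarrow> d x \<le> d m"
    using continuous_attains_sup[OF compact_Icc _ dcont] ab by fastforce
  define S where "S = {x \<in> {a..b}. d x = d m}"
  have "compact S"
  proof -
    have "S = {a..b} \<inter> d -` {d m}" by (auto simp: S_def)
    moreover have "closed ({a..b} \<inter> d -` {d m})"
      by (intro continuous_closed_preimage dcont) auto
    moreover have "bounded S" by (rule bounded_subset[of "{a..b}"]) (auto simp: S_def)
    ultimately show ?thesis by (simp add: compact_eq_bounded_closed)
  qed
  moreover have "S \<noteq> {}" using m by (auto simp: S_def)
  \<comment> \<open>The leftmost maximum point: a positive maximum would be attained inside, and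
    then the value at \<open>c - k\<close> is strictly smaller, which contradicts the midpoint
    inequality at \<open>c\<close>.\<close>
  ultimately obtain c where c: "c \<in> S" "\<And>x. x \<in> S \<Longrightarrow> c \<le> x"
    using compact_attains_inf[of S] by (auto simp: Ball_def Bex_def)
  have "d m \<le> 0"
  proof (rule ccontr)
    assume *: "\<not> d m \<le> 0"
    then have cab: "a < c" "c < b" using c(1) d0 by (auto simp: S_def less_le)
    define k where "k = min (c - a) (b - c)"
    have k: "k > 0" "a \<le> c - k" "c + k \<le> b" using cab by (auto simp: k_def)
    have "d (c - k) \<noteq> d m" using c(2)[of "c - k"] k cab by (auto simp: S_def)
    then have "d (c - k) < d m" using m(2)[of "c - k"] k cab by force
    moreover have "d (c + k) \<le> d m" using m(2)[of "c + k"] k cab by force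
    moreover have "2 * d c \<le> d (c - k) + d (c + k)"
      using dmid[of "c - k" k] k ab by (simp add: algebra_simps)
    ultimately show False using c(1) by (simp add: S_def)
  qed
  define x where "x = (1 - t) * a + t * b"
  have x: "x - a = t * (b - a)" by (simp add: x_def algebra_simps)
  have "t * (b - a) \<le> b - a" using mult_right_mono[of t 1 "b - a"] t ab by simp
  moreover have "0 \<le> t * (b - a)" using t ab by simp
  ultimately have "a \<le> x" "x \<le> b" using x by linarith+
  then have "d x \<le> 0" using m(2)[of x] \<open>d m \<le> 0\<close> by force
  then have "g x \<le> g a + t * (w * (b - a))"
    by (simp add: d_def x mult_ac)
  then have "g x \<le> g a + t * (g b - g a)"
    by (simp add: w)
  then show "g ((1 - t) *\<^sub>R a + t *\<^sub>R b) \<le> (1 - t) * g a + t * g b"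
    by (simp add: x_def algebra_simps)
qed simp

text \<open>Both slopes are compared with that of the chord from \<open>x\<close> to
  \<open>y + k\<close>; the two intervals may overlap.\<close>

lemma convex_on_slope_mono:
  fixes g :: "real \<Rightarrow> real"
  assumes g: "convex_on {0..} g" and "0 \<le> x" "x \<le> y" "0 < h" "0 < k" "x + h \<le> y + k"
  shows "(g (x + h) - g x) / h \<le> (g (y + k) - g y) / k"
proof -
  have 1: "(g b - g a) / (b - a) \<le> (g c - g a) / (c - a)" if "0 \<le> a" "a < b" "b \<le> c" for a b c
  proof (cases "b = c")
    case False
    have "(g a - g b) / (a - b) \<le> (g a - g c) / (a - c)"
      using convex_on_slope_le(1)[OF g, of a c b] that False by auto
    then show ?thesis by (metis minus_diff_eq minus_divide_divide)
  qed simp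
  have 2: "(g c - g a) / (c - a) \<le> (g c - g b) / (c - b)" if "0 \<le> a" "a \<le> b" "b < c" for a b c
  proof (cases "a = b")
    case False
    have "(g a - g c) / (a - c) \<le> (g b - g c) / (b - c)"
      using convex_on_slope_le(2)[OF g, of a c b] that False by auto
    then show ?thesis by (metis minus_diff_eq minus_divide_divide)
  qed simp
  have "(g (x + h) - g x) / (x + h - x) \<le> (g (y + k) - g x) / (y + k - x)"
    by (rule 1) (use assms in auto)
  also have "\<dots> \<le> (g (y + k) - g y) / (y + k - y)"
    by (rule 2) (use assms in auto)
  finally show ?thesis by simp
qed

text \<open>A mean value inequality for a function that need not be differentiable:
  \<open>quot\<close> says that its upper right Dini derivative is at least
  \<open>c\<close>.\<close>

lemma increment_ge_of_right_difference_quotients: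
  fixes z :: "real \<Rightarrow> real"
  assumes cont: "continuous_on {a..b} z" and "a \<le> b"
    and quot: "\<And>t \<eta> \<delta>. a \<le> t \<Longrightarrow> t < b \<Longrightarrow> \<eta> < c \<Longrightarrow> 0 < \<delta> \<Longrightarrow> \<exists>h. 0 < h \<and> h < \<delta> \<and> z (t + h) - z t \<ge> \<eta> * h"
  shows "z b - z a \<ge> c * (b - a)"
proof -
  have *: "z b - z a \<ge> \<eta> * (b - a)" if \<eta>: "\<eta> < c" for \<eta>
  proof -
    define S where "S = {t \<in> {a..b}. z t - z a \<ge> \<eta> * (t - a)}"
    have "S = {a..b} \<inter> (\<lambda>t. z t - z a - \<eta> * (t - a)) -` {0..}" by (auto simp: S_def)
    moreover have "closed \<dots>"
      by (intro continuous_closed_preimage continuous_intros cont; simp)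
    ultimately have "closed S" by metis
    moreover have "a \<in> S" using \<open>a \<le> b\<close> by (simp add: S_def)
    moreover have bdd: "bdd_above S" by (rule bdd_aboveI[of _ b]) (auto simp: S_def)
    ultimately have SS: "Sup S \<in> S" using closed_contains_Sup by blast
    \<comment> \<open>If the supremum were smaller, the quotient condition at that point would
      produce a later element of \<open>S\<close>.\<close>
    have "Sup S = b"
    proof (rule ccontr)
      assume "Sup S \<noteq> b"
      with SS have lt: "Sup S < b" "a \<le> Sup S" by (auto simp: S_def)
      then obtain h where h: "0 < h" "h < b - Sup S" "z (Sup S + h) - z (Sup S) \<ge> \<eta> * h"
        using quot[of "Sup S" \<eta> "b - Sup S"] \<eta> by auto
      then have "Sup S + h \<in> S" using SS lt by (auto simp: S_def algebra_simps)
      then show False using cSup_upper[OF _ bdd] h(1) by force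
    qed
    then show ?thesis using SS by (simp add: S_def)
  qed
  show ?thesis
  proof (rule field_le_epsilon)
    fix e :: real assume "e > 0"
    have "(c - e / (b - a + 1)) * (b - a) \<le> z b - z a"
      by (rule *) (use \<open>e > 0\<close> \<open>a \<le> b\<close> in auto)
    moreover have "e / (b - a + 1) * (b - a) \<le> e"
      using \<open>e > 0\<close> \<open>a \<le> b\<close> by (simp add: field_simps)
    ultimately show "c * (b - a) \<le> z b - z a + e"
      by (simp add: algebra_simps)
  qed
qed

text \<open>Concavity at \<open>1\<close>, read off from the weighted inequality of Young with
  second factor \<open>1\<close>.\<close>

lemma powr_le_tangent:
  fixes x e :: real
  assumes "0 \<le> x" "0 \<le> e" "e \<le> 1"
  shows "x powr e \<le> 1 + e * (x - 1)"
proof (cases "x = 0")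
  case False
  then show ?thesis
    using Youngs_inequality_0[of e "1 - e" x 1] assms by (simp add: algebra_simps)
qed (use assms in auto)

lemma powr_ge_tangent:
  fixes x e :: real
  assumes x: "0 \<le> x" and e: "1 \<le> e"
  shows "1 + e * (x - 1) \<le> x powr e"
proof (cases "1 + e * (x - 1) \<le> 0")
  case False
  \<comment> \<open>The convex case is the concave one for the inverse power, applied at
    \<open>x powr e\<close>.\<close>
  have "(x powr e) powr (1 / e) \<le> 1 + 1 / e * (x powr e - 1)"
    by (rule powr_le_tangent) (use e in auto)
  then have "x \<le> 1 + 1 / e * (x powr e - 1)" using x e by (simp add: powr_powr)
  then show ?thesis using e by (simp add: field_simps)
qed (use powr_ge_zero[of x e] in linarith)

lemma powr_tangent_line:
  fixes a b p :: real
  assumes "0 \<le> a" "0 \<le> b" "1 < p"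
  shows "a powr p + p * a powr (p - 1) * (b - a) \<le> b powr p"
proof (cases "a = 0")
  case False
  with assms have a: "a > 0" by simp
  have "a powr p * (1 + p * (b / a - 1)) \<le> a powr p * (b / a) powr p"
    by (intro mult_left_mono powr_ge_tangent) (use assms a in auto)
  also have "\<dots> = b powr p" using assms a by (simp add: powr_divide)
  also have "a powr p * (1 + p * (b / a - 1)) = a powr p + p * (a powr p / a) * (b - a)"
    using a by (simp add: field_simps)
  also have "a powr p / a = a powr (p - 1)" using a by (simp add: powr_diff)
  finally show ?thesis by simp
qed (use assms in auto)

text \<open>With \<open>y\<close> the energy at one time and \<open>x\<close> the energy at a later
  one, this converts a decrement of the energy into an increment of its negative power.\<close>

lemma powr_neg_tangent_line:
  fixes x y e :: real
  assumes "0 < x" "x \<le> y" "0 < e"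
  shows "y powr - e + e * y powr (- e - 1) * (y - x) \<le> x powr - e"
proof -
  have y: "y > 0" using assms by simp
  have "1 + (- e) * (x / y - 1) \<le> (x / y) powr (- e)"
  proof -
    have "- e * ln (x / y) \<ge> - e * (x / y - 1)"
      using ln_le_minus_one[of "x / y"] assms y by (intro mult_left_mono_neg) auto
    moreover have "exp (- e * ln (x / y)) \<ge> 1 + (- e * ln (x / y))" by (rule exp_ge_add_one_self)
    ultimately have "1 - e * (x / y - 1) \<le> exp (- e * ln (x / y))" by linarith
    then show ?thesis using assms y by (simp add: powr_def)
  qed
  then have "y powr - e * (1 + (- e) * (x / y - 1)) \<le> y powr - e * (x / y) powr (- e)"
    by (intro mult_left_mono) auto
  also have "\<dots> = x powr - e" using assms y by (simp add: powr_divide)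
  also have "y powr - e * (1 + (- e) * (x / y - 1)) = y powr - e + e * (y powr - e / y) * (y - x)"
    using y by (simp add: field_simps)
  also have "y powr - e / y = y powr (- e - 1)" using y by (simp add: powr_diff)
  finally show ?thesis .
qed

text \<open>By homogeneity only \<open>x = B / A\<close> in \<open>[0, 1]\<close> matters. One of
  the two bounds is the tangent at \<open>1\<close>, the other compares \<open>x powr e\<close> with
  \<open>x\<close>; which is which depends on whether \<open>e <= 1\<close>.\<close>

lemma powr_diff_le:
  fixes A B e :: real
  assumes "0 \<le> B" "B \<le> A" "0 < e"
  shows "A powr e - B powr e \<le> max 1 e * A powr (e - 1) * (A - B)"
    and "min 1 e * A powr (e - 1) * (A - B) \<le> A powr e - B powr e"
proof -
  have "A powr e - B powr e \<le> max 1 e * A powr (e - 1) * (A - B) \<and>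
    min 1 e * A powr (e - 1) * (A - B) \<le> A powr e - B powr e"
  proof (cases "A = 0")
    case False
    with assms have A: "A > 0" by simp
    define x where "x = B / A"
    have x: "0 \<le> x" "x \<le> 1" using assms A by (auto simp: x_def)
    have "1 - x powr e \<le> max 1 e * (1 - x) \<and> min 1 e * (1 - x) \<le> 1 - x powr e"
    proof (cases "e \<le> 1")
      case True
      then show ?thesis using powr_le_tangent[of x e] powr_mono'[of e 1 x] x assms
        by (simp add: algebra_simps)
    next
      case False
      then show ?thesis using powr_ge_tangent[of x e] powr_mono'[of 1 e x] x assms
        by (simp add: algebra_simps max_def)
    qed
    then have "A powr e * (1 - x powr e) \<le> A powr e * (max 1 e * (1 - x))"
      "A powr e * (min 1 e * (1 - x)) \<le> A powr e * (1 - x powr e)"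
      by (auto intro!: mult_left_mono)
    moreover have "A powr e * (1 - x powr e) = A powr e - B powr e"
      using A assms by (simp add: x_def powr_divide algebra_simps)
    moreover have "A powr e * (k * (1 - x)) = k * A powr (e - 1) * (A - B)" for k
      using A by (simp add: x_def powr_diff field_simps)
    ultimately show ?thesis by simp
  qed (use assms in auto)
  then show "A powr e - B powr e \<le> max 1 e * A powr (e - 1) * (A - B)"
    and "min 1 e * A powr (e - 1) * (A - B) \<le> A powr e - B powr e" by auto
qed

text \<open>Below the level \<open>l\<close> one factor \<open>x powr (r - 1)\<close> is replaced by
  its value at \<open>l\<close>, above it the factor \<open>x powr (r - P)\<close>. The level stays
  free, to be balanced later.\<close>

lemma powr_interpolation:
  fixes x l r P :: real
  assumes "0 \<le> x" "0 < l" "1 \<le> r" "r \<le> P"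
  shows "x powr r \<le> l powr (r - 1) * x + l powr (r - P) * x powr P"
proof (cases "x = 0")
  case False
  with assms have x: "x > 0" by simp
  show ?thesis
  proof (cases "x \<le> l")
    case True
    have "x powr r = x powr (r - 1) * x" using x by (simp add: powr_diff)
    also have "\<dots> \<le> l powr (r - 1) * x" by (intro mult_right_mono powr_mono2) (use assms True in auto)
    finally show ?thesis using powr_ge_zero[of l "r - P"] powr_ge_zero[of x P]
      by (smt (verit) mult_nonneg_nonneg)
  next
    case False
    have "x powr r = x powr (r - P) * x powr P" using x by (simp flip: powr_add)
    also have "\<dots> \<le> l powr (r - P) * x powr P"
      by (intro mult_right_mono powr_mono2') (use assms False in auto)
    finally show ?thesis using powr_ge_zero[of l "r - 1"] x
      by (smt (verit) mult_nonneg_nonneg)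
  qed
qed (use assms in auto)

section \<open>The space of square integrable functions\<close>

text \<open>The discriminant argument behind Cauchy-Schwarz, isolated because it serves both the
  inner product and the approximating forms.\<close>

lemma square_le_mult_if_quadratic_nonneg:
  fixes a b c :: real
  assumes "\<And>t. 0 \<le> a + 2 * t * b + t\<^sup>2 * c"
  shows "b\<^sup>2 \<le> a * c"
proof -
  have c: "c \<ge> 0"
  proof (rule ccontr)
    assume "\<not> c \<ge> 0"
    \<comment> \<open>Adding the assumption at \<open>t\<close> and at \<open>- t\<close> removes
      the linear term; \<open>t\<close> is so large that \<open>t^2 * (- c)\<close> exceeds
      \<open>a\<close>.\<close>
    define t where "t = (\<bar>a\<bar> + 1) / (- c) + 1"
    have t: "t \<ge> 1" "t * (- c) = \<bar>a\<bar> + 1 - c" using \<open>\<not> c \<ge> 0\<close>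
      by (auto simp: t_def field_simps)
    have "0 \<le> a + t\<^sup>2 * c" using assms[of t] assms[of "- t"] by simp
    moreover have "1 * (t * (- c)) \<le> t * (t * (- c))"
      using t \<open>\<not> c \<ge> 0\<close> by (intro mult_right_mono) auto
    ultimately show False using t(2) \<open>\<not> c \<ge> 0\<close> by (simp add: power2_eq_square)
  qed
  show ?thesis
  proof (cases "c = 0")
    case True
    have "b = 0"
    proof (rule ccontr)
      assume "b \<noteq> 0"
      then show False using assms[of "- (a + 1) / (2 * b)"] True by (simp add: field_simps)
    qed
    with True show ?thesis by simp
  next
    case False
    with c have c: "c > 0" by simp
    \<comment> \<open>The quadratic is evaluated at its minimum point.\<close>
    have "0 \<le> a + 2 * (- b / c) * b + (- b / c)\<^sup>2 * c" by (rule assms)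
    also have "\<dots> = a - b\<^sup>2 / c" using c by (simp add: field_simps power2_eq_square)
    finally show ?thesis using c by (simp add: field_simps)
  qed
qed

lemma abs_powr_2 [simp]: "\<bar>x\<bar> powr 2 = x\<^sup>2" for x :: real
  by (cases "x = 0") (auto simp: powr_numeral)

lemma Lp_space_2_iff:
  "f \<in> Lp_space 2 \<longleftrightarrow> f \<in> borel_measurable lebesgue \<and> integrable lebesgue (\<lambda>x. (f x)\<^sup>2)"
  by (simp add: Lp_space_def)

lemma Lp_norm_nonneg [simp]: "Lp_norm p f \<ge> 0"
  by (simp add: Lp_norm_def)

lemma L2_inner_nonneg [simp]: "0 \<le> L2_inner f f"
  unfolding L2_inner_def by (rule integral_nonneg_AE) auto

lemma Lp_norm_2: "Lp_norm 2 f = sqrt (L2_inner f f)"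
  by (simp add: Lp_norm_def L2_inner_def powr_half_sqrt power2_eq_square integral_nonneg_AE)

lemma Lp_norm_2_squared: "(Lp_norm 2 f)\<^sup>2 = L2_inner f f"
  by (simp add: Lp_norm_2)

lemma L2_integrable_mult:
  assumes "f \<in> Lp_space 2" "g \<in> Lp_space 2"
  shows "integrable lebesgue (\<lambda>x. f x * g x)"
proof (rule Bochner_Integration.integrable_bound)
  show "integrable lebesgue (\<lambda>x. (f x)\<^sup>2 + (g x)\<^sup>2)"
    using assms by (auto simp: Lp_space_2_iff)
  show "(\<lambda>x. f x * g x) \<in> borel_measurable lebesgue"
    using assms by (auto simp: Lp_space_2_iff)
  have "\<bar>a * b\<bar> \<le> a\<^sup>2 + b\<^sup>2" for a b :: real
    using sum_squares_bound[of "\<bar>a\<bar>" "\<bar>b\<bar>"] zero_le_power2[of a] zero_le_power2[of b]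
      mult_nonneg_nonneg[of "\<bar>a\<bar>" "\<bar>b\<bar>"]
    unfolding abs_mult power2_abs by linarith
  then show "AE x in lebesgue. norm (f x * g x) \<le> norm ((f x)\<^sup>2 + (g x)\<^sup>2)"
    by simp
qed

lemma L2_lincomb:
  assumes "f \<in> Lp_space 2" "g \<in> Lp_space 2"
  shows "(\<lambda>x. a * f x + b * g x) \<in> Lp_space 2"
proof -
  have "(\<lambda>x. (a * f x + b * g x)\<^sup>2) = (\<lambda>x. a\<^sup>2 * (f x)\<^sup>2 + 2 * a * b * (f x * g x) + b\<^sup>2 * (g x)\<^sup>2)"
    by (auto simp: power2_eq_square algebra_simps)
  moreover have "integrable lebesgue \<dots>"
    using assms L2_integrable_mult[OF assms] by (auto simp: Lp_space_2_iff)
  ultimately show ?thesis using assms by (auto simp: Lp_space_2_iff)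
qed

lemma L2_add: "f \<in> Lp_space 2 \<Longrightarrow> g \<in> Lp_space 2 \<Longrightarrow> (\<lambda>x. f x + g x) \<in> Lp_space 2"
  using L2_lincomb[of f g 1 1] by simp

lemma L2_diff: "f \<in> Lp_space 2 \<Longrightarrow> g \<in> Lp_space 2 \<Longrightarrow> (\<lambda>x. f x - g x) \<in> Lp_space 2"
  using L2_lincomb[of f g 1 "-1"] by simp

lemma L2_scale: "f \<in> Lp_space 2 \<Longrightarrow> (\<lambda>x. a * f x) \<in> Lp_space 2"
  using L2_lincomb[of f f a 0] by simp

lemma L2_zero: "(\<lambda>x. 0) \<in> Lp_space 2"
  by (simp add: Lp_space_2_iff)

lemma L2_inner_commute: "L2_inner f g = L2_inner g f"
  by (simp add: L2_inner_def mult.commute)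

lemma L2_inner_lincomb:
  assumes "f \<in> Lp_space 2" "g \<in> Lp_space 2" "h \<in> Lp_space 2"
  shows "L2_inner (\<lambda>x. a * f x + b * g x) h = a * L2_inner f h + b * L2_inner g h"
proof -
  have "L2_inner (\<lambda>x. a * f x + b * g x) h = (LINT x|lebesgue. a * (f x * h x) + b * (g x * h x))"
    unfolding L2_inner_def by (simp add: algebra_simps)
  then show ?thesis
    using L2_integrable_mult[OF assms(1,3)] L2_integrable_mult[OF assms(2,3)]
    by (simp add: L2_inner_def)
qed

lemma L2_inner_add:
  "f \<in> Lp_space 2 \<Longrightarrow> g \<in> Lp_space 2 \<Longrightarrow> h \<in> Lp_space 2 \<Longrightarrow>
    L2_inner (\<lambda>x. f x + g x) h = L2_inner f h + L2_inner g h"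
  using L2_inner_lincomb[of f g h 1 1] by simp

lemma L2_inner_diff:
  "f \<in> Lp_space 2 \<Longrightarrow> g \<in> Lp_space 2 \<Longrightarrow> h \<in> Lp_space 2 \<Longrightarrow>
    L2_inner (\<lambda>x. f x - g x) h = L2_inner f h - L2_inner g h"
  using L2_inner_lincomb[of f g h 1 "-1"] by simp

lemma L2_inner_scale: "L2_inner (\<lambda>x. a * f x) h = a * L2_inner f h"
  by (simp add: L2_inner_def mult.assoc)

lemma L2_inner_add_right:
  "f \<in> Lp_space 2 \<Longrightarrow> g \<in> Lp_space 2 \<Longrightarrow> h \<in> Lp_space 2 \<Longrightarrow>
    L2_inner h (\<lambda>x. f x + g x) = L2_inner h f + L2_inner h g"
  by (simp add: L2_inner_add L2_inner_commute[of h])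

lemma L2_inner_diff_right:
  "f \<in> Lp_space 2 \<Longrightarrow> g \<in> Lp_space 2 \<Longrightarrow> h \<in> Lp_space 2 \<Longrightarrow>
    L2_inner h (\<lambda>x. f x - g x) = L2_inner h f - L2_inner h g"
  by (simp add: L2_inner_diff L2_inner_commute[of h])

lemma L2_inner_scale_right: "L2_inner h (\<lambda>x. a * f x) = a * L2_inner h f"
  by (simp add: L2_inner_scale L2_inner_commute[of h])

lemma L2_inner_cong_AE:
  assumes "AE x in lebesgue. f x = f' x" "f \<in> Lp_space 2" "f' \<in> Lp_space 2" "g \<in> Lp_space 2"
  shows "L2_inner f g = L2_inner f' g"
  unfolding L2_inner_def
proof (rule integral_cong_AE)
  show "AE x in lebesgue. f x * g x = f' x * g x" using assms(1) by auto
qed (use assms in \<open>auto simp: Lp_space_2_iff\<close>)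

lemma L2_inner_cong_AE_right:
  assumes "AE x in lebesgue. f x = f' x" "f \<in> Lp_space 2" "f' \<in> Lp_space 2" "g \<in> Lp_space 2"
  shows "L2_inner g f = L2_inner g f'"
  using L2_inner_cong_AE[OF assms] by (simp add: L2_inner_commute)

lemma L2_Cauchy_Schwarz:
  assumes "f \<in> Lp_space 2" "g \<in> Lp_space 2"
  shows "\<bar>L2_inner f g\<bar> \<le> Lp_norm 2 f * Lp_norm 2 g"
proof -
  have "(L2_inner f g)\<^sup>2 \<le> L2_inner f f * L2_inner g g"
  proof (rule square_le_mult_if_quadratic_nonneg)
    fix t
    have "0 \<le> L2_inner (\<lambda>x. f x + t * g x) (\<lambda>x. f x + t * g x)" by simp
    also have "\<dots> = L2_inner f f + 2 * t * L2_inner f g + t\<^sup>2 * L2_inner g g"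
      using assms by (simp add: L2_inner_add L2_inner_add_right L2_inner_scale L2_inner_scale_right
          L2_add L2_scale power2_eq_square distrib_left L2_inner_commute[of g f] mult.assoc)
    finally show "0 \<le> L2_inner f f + 2 * t * L2_inner f g + t\<^sup>2 * L2_inner g g" .
  qed
  then show ?thesis
    by (simp add: Lp_norm_2 flip: real_sqrt_mult real_sqrt_abs)
qed

lemma L2_norm_triangle:
  assumes "f \<in> Lp_space 2" "g \<in> Lp_space 2"
  shows "Lp_norm 2 (\<lambda>x. f x + g x) \<le> Lp_norm 2 f + Lp_norm 2 g"
proof -
  have "L2_inner (\<lambda>x. f x + g x) (\<lambda>x. f x + g x) = L2_inner f f + 2 * L2_inner f g + L2_inner g g"
    using assms by (simp add: L2_inner_add L2_inner_add_right L2_add L2_inner_commute[of g f])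
  also have "\<dots> \<le> (Lp_norm 2 f + Lp_norm 2 g)\<^sup>2"
    using L2_Cauchy_Schwarz[OF assms] by (simp add: power2_sum Lp_norm_2_squared)
  finally show ?thesis unfolding Lp_norm_2[of "\<lambda>x. f x + g x"]
    by (intro real_le_lsqrt add_nonneg_nonneg Lp_norm_nonneg)
qed

lemma L2_norm_scale: "Lp_norm 2 (\<lambda>x. a * f x) = \<bar>a\<bar> * Lp_norm 2 f"
  by (simp add: Lp_norm_2 L2_inner_scale L2_inner_scale_right real_sqrt_mult)

lemma L2_norm_minus: "Lp_norm 2 (\<lambda>x. f x - g x) = Lp_norm 2 (\<lambda>x. g x - f x)"
  using L2_norm_scale[of "-1" "\<lambda>x. f x - g x"] by simp

lemma L2_norm_triangle_diff:
  assumes "f \<in> Lp_space 2" "g \<in> Lp_space 2" "h \<in> Lp_space 2"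
  shows "Lp_norm 2 (\<lambda>x. f x - h x) \<le> Lp_norm 2 (\<lambda>x. f x - g x) + Lp_norm 2 (\<lambda>x. g x - h x)"
  using L2_norm_triangle[of "\<lambda>x. f x - g x" "\<lambda>x. g x - h x"] assms by (simp add: L2_diff)

lemma L2_norm_cong_AE:
  assumes "AE x in lebesgue. f x = g x" "f \<in> Lp_space 2" "g \<in> Lp_space 2"
  shows "Lp_norm 2 f = Lp_norm 2 g"
proof -
  have "L2_inner f f = L2_inner g g"
    using L2_inner_cong_AE[OF assms assms(2)] L2_inner_cong_AE_right[OF assms assms(3)] by simp
  then show ?thesis by (simp add: Lp_norm_2)
qed

lemma L2_norm_eq_0:
  assumes "f \<in> Lp_space 2" "Lp_norm 2 f = 0"
  shows "AE x in lebesgue. f x = 0"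
proof -
  have "(LINT x|lebesgue. (f x)\<^sup>2) = 0"
    using assms(2) by (simp add: Lp_norm_2 L2_inner_def power2_eq_square)
  then have "AE x in lebesgue. (f x)\<^sup>2 = 0"
    using integral_nonneg_eq_0_iff_AE[of lebesgue "\<lambda>x. (f x)\<^sup>2"] assms(1) by (simp add: Lp_space_2_iff)
  then show ?thesis by simp
qed

text \<open>An arbitrary filter is allowed, since the lemma serves both sequences and limits along
  \<open>at_right 0\<close>.\<close>

lemma L2_inner_tendsto:
  assumes F: "((\<lambda>i. Lp_norm 2 (\<lambda>x. F i x - f x)) \<longlongrightarrow> 0) K" "\<forall>\<^sub>F i in K. F i \<in> Lp_space 2"
    and G: "((\<lambda>i. Lp_norm 2 (\<lambda>x. G i x - g x)) \<longlongrightarrow> 0) K" "\<forall>\<^sub>F i in K. G i \<in> Lp_space 2"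
    and fg: "f \<in> Lp_space 2" "g \<in> Lp_space 2"
  shows "((\<lambda>i. L2_inner (F i) (G i)) \<longlongrightarrow> L2_inner f g) K"
proof (rule Lim_transform2[OF tendsto_const], rule Lim_null_comparison)
  let ?a = "\<lambda>i. Lp_norm 2 (\<lambda>x. F i x - f x)" and ?b = "\<lambda>i. Lp_norm 2 (\<lambda>x. G i x - g x)"
  show "((\<lambda>i. ?a i * (?b i + Lp_norm 2 g) + Lp_norm 2 f * ?b i) \<longlongrightarrow> 0) K"
    by (rule tendsto_eq_intros F G refl | simp)+
  show "\<forall>\<^sub>F i in K. norm (L2_inner f g - L2_inner (F i) (G i)) \<le> ?a i * (?b i + Lp_norm 2 g) + Lp_norm 2 f * ?b i"
    using F(2) G(2)
  proof eventually_elim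
    case (elim i)
    have "L2_inner (F i) (G i) - L2_inner f g =
        L2_inner (\<lambda>x. F i x - f x) (G i) + L2_inner f (\<lambda>x. G i x - g x)"
      using elim fg by (simp add: L2_inner_diff L2_inner_diff_right)
    moreover have "\<bar>L2_inner (\<lambda>x. F i x - f x) (G i)\<bar> \<le> ?a i * Lp_norm 2 (G i)"
      "\<bar>L2_inner f (\<lambda>x. G i x - g x)\<bar> \<le> Lp_norm 2 f * ?b i"
      using elim fg by (auto intro!: L2_Cauchy_Schwarz L2_diff)
    moreover have "Lp_norm 2 (G i) \<le> ?b i + Lp_norm 2 g"
      using L2_norm_triangle[of "\<lambda>x. G i x - g x" g] elim fg by (simp add: L2_diff)
    then have "?a i * Lp_norm 2 (G i) \<le> ?a i * (?b i + Lp_norm 2 g)"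
      by (intro mult_left_mono) auto
    ultimately show ?case unfolding real_norm_def by linarith
  qed
qed

section \<open>Symmetric submarkovian semigroups\<close>

lemma L1_Linf_iff:
  "f \<in> Lp_space 1 \<inter> Linf_space \<longleftrightarrow> integrable lebesgue f \<and> (\<exists>M. AE x in lebesgue. \<bar>f x\<bar> \<le> M)"
proof -
  have "(\<lambda>x. \<bar>f x\<bar> powr 1) = (\<lambda>x. \<bar>f x\<bar>)" by auto
  then show ?thesis
    using integrable_abs_iff[of f lebesgue] borel_measurable_integrable[of lebesgue f]
    by (auto simp: Lp_space_def Linf_space_def)
qed

lemma L1_Linf_integrable: "f \<in> Lp_space 1 \<inter> Linf_space \<Longrightarrow> integrable lebesgue f"
  unfolding L1_Linf_iff by (rule conjunct1)

lemma L1_Linf_measurable: "f \<in> Lp_space 1 \<inter> Linf_space \<Longrightarrow> f \<in> borel_measurable lebesgue"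
  by (intro borel_measurable_integrable L1_Linf_integrable)

lemma L1_Linf_dominated:
  assumes f: "f \<in> Lp_space 1 \<inter> Linf_space" and g: "g \<in> borel_measurable lebesgue"
    and gf: "AE x in lebesgue. \<bar>g x\<bar> \<le> C * \<bar>f x\<bar>"
  shows "g \<in> Lp_space 1 \<inter> Linf_space"
  unfolding L1_Linf_iff
proof
  obtain M where M: "AE x in lebesgue. \<bar>f x\<bar> \<le> M" and int: "integrable lebesgue f"
    using f unfolding L1_Linf_iff by auto
  show "integrable lebesgue g"
    by (rule Bochner_Integration.integrable_bound[OF integrable_mult_right[of C, OF integrable_abs[OF int]]])
      (use gf g in auto)
  have "AE x in lebesgue. \<bar>g x\<bar> \<le> \<bar>C\<bar> * M"
    using gf M
  proof eventually_elim
    case (elim x)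
    have "C * \<bar>f x\<bar> \<le> \<bar>C\<bar> * M" using elim by (intro mult_mono) auto
    with elim show ?case by simp
  qed
  then show "\<exists>M. AE x in lebesgue. \<bar>g x\<bar> \<le> M" by blast
qed

lemma L1_Linf_abs:
  assumes "f \<in> Lp_space 1 \<inter> Linf_space"
  shows "(\<lambda>x. \<bar>f x\<bar>) \<in> Lp_space 1 \<inter> Linf_space"
  using assms unfolding L1_Linf_iff by auto

lemma L1_Linf_lincomb:
  assumes "f \<in> Lp_space 1 \<inter> Linf_space" "g \<in> Lp_space 1 \<inter> Linf_space"
  shows "(\<lambda>x. a * f x + b * g x) \<in> Lp_space 1 \<inter> Linf_space"
  unfolding L1_Linf_iff
proof
  obtain M N where M: "AE x in lebesgue. \<bar>f x\<bar> \<le> M" and N: "AE x in lebesgue. \<bar>g x\<bar> \<le> N"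
    and int: "integrable lebesgue f" "integrable lebesgue g"
    using assms unfolding L1_Linf_iff by auto
  show "integrable lebesgue (\<lambda>x. a * f x + b * g x)" using int by auto
  have "AE x in lebesgue. \<bar>a * f x + b * g x\<bar> \<le> \<bar>a\<bar> * M + \<bar>b\<bar> * N"
    using M N
  proof eventually_elim
    case (elim x)
    have "\<bar>a * f x\<bar> \<le> \<bar>a\<bar> * M" "\<bar>b * g x\<bar> \<le> \<bar>b\<bar> * N"
      unfolding abs_mult using elim by (auto intro!: mult_left_mono)
    then show ?case by linarith
  qed
  then show "\<exists>M. AE x in lebesgue. \<bar>a * f x + b * g x\<bar> \<le> M" by blast
qed

lemma L1_Linf_imp_Lp:
  assumes f: "f \<in> Lp_space 1 \<inter> Linf_space" and p: "1 \<le> p"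
  shows "f \<in> Lp_space p"
proof -
  obtain M where M: "AE x in lebesgue. \<bar>f x\<bar> \<le> M" and int: "integrable lebesgue f"
    using f unfolding L1_Linf_iff by auto
  have [measurable]: "f \<in> borel_measurable lebesgue" using int by auto
  have "integrable lebesgue (\<lambda>x. \<bar>f x\<bar> powr p)"
  proof (rule Bochner_Integration.integrable_bound)
    show "integrable lebesgue (\<lambda>x. M powr (p - 1) * \<bar>f x\<bar>)" using int by auto
    show "AE x in lebesgue. norm (\<bar>f x\<bar> powr p) \<le> norm (M powr (p - 1) * \<bar>f x\<bar>)"
      using M
    proof eventually_elim
      case (elim x)
      have "\<bar>f x\<bar> powr p = \<bar>f x\<bar> powr (p - 1) * \<bar>f x\<bar>"
        by (cases "f x = 0") (auto simp: powr_diff)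
      also have "\<dots> \<le> M powr (p - 1) * \<bar>f x\<bar>"
        by (intro mult_right_mono powr_mono2) (use elim p in auto)
      finally show ?case by simp
    qed
  qed measurable
  then show ?thesis by (simp add: Lp_space_def)
qed

lemma L1_Linf_powr:
  fixes f :: "'a::euclidean_space \<Rightarrow> real"
  assumes f: "f \<in> Lp_space 1 \<inter> Linf_space" and p: "1 \<le> p"
  shows "(\<lambda>x. \<bar>f x\<bar> powr p) \<in> Lp_space 1 \<inter> Linf_space"
  unfolding L1_Linf_iff
proof
  show "integrable lebesgue (\<lambda>x. \<bar>f x\<bar> powr p)"
    using L1_Linf_imp_Lp[OF f p] by (simp add: Lp_space_def)
  obtain M where M: "AE x in lebesgue. \<bar>f x\<bar> \<le> M" using f unfolding L1_Linf_iff by auto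
  have "AE x in lebesgue. \<bar>\<bar>f x\<bar> powr p\<bar> \<le> M powr p"
    using M by eventually_elim (use p in \<open>simp add: powr_mono2\<close>)
  then show "\<exists>M. AE x in lebesgue. \<bar>\<bar>f x\<bar> powr p\<bar> \<le> M" by blast
qed

lemma L1_Linf_imp_L2: "f \<in> Lp_space 1 \<inter> Linf_space \<Longrightarrow> f \<in> Lp_space 2"
  by (rule L1_Linf_imp_Lp) auto

lemma L1_Linf_indicator:
  assumes "A \<in> sets lebesgue" "emeasure lebesgue A < \<infinity>"
  shows "indicat_real A \<in> Lp_space 1 \<inter> Linf_space"
  unfolding L1_Linf_iff using assms
  by (auto intro!: exI[of _ 1] simp: indicator_def)

lemma L2_norm_tendsto_0_dominated:
  fixes F :: "nat \<Rightarrow> 'a::euclidean_space \<Rightarrow> real"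
  assumes f: "f \<in> Lp_space 2" and w: "w \<in> Lp_space 2"
    and F: "\<And>n. F n \<in> borel_measurable lebesgue"
    and lim: "AE x in lebesgue. (\<lambda>n. F n x) \<longlonglongrightarrow> f x"
    and dom: "\<And>n. AE x in lebesgue. \<bar>F n x - f x\<bar> \<le> \<bar>w x\<bar>"
  shows "(\<lambda>n. Lp_norm 2 (\<lambda>x. F n x - f x)) \<longlonglongrightarrow> 0"
proof -
  have "(\<lambda>n. LINT x|lebesgue. (F n x - f x)\<^sup>2) \<longlonglongrightarrow> (LINT x|(lebesgue :: 'a measure). 0)"
  proof (rule integral_dominated_convergence)
    show "integrable lebesgue (\<lambda>x. (w x)\<^sup>2)" using w by (simp add: Lp_space_2_iff)
    show "AE x in lebesgue. (\<lambda>n. (F n x - f x)\<^sup>2) \<longlonglongrightarrow> 0"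
      using lim by eventually_elim (rule tendsto_eq_intros refl | simp)+
    show "AE x in lebesgue. norm ((F n x - f x)\<^sup>2) \<le> (w x)\<^sup>2" for n
      using dom[of n] by eventually_elim (simp add: abs_le_square_iff)
  qed (use F f in \<open>auto simp: Lp_space_2_iff\<close>)
  then have "(\<lambda>n. sqrt (LINT x|lebesgue. (F n x - f x)\<^sup>2)) \<longlonglongrightarrow> sqrt 0"
    by (intro tendsto_real_sqrt) simp
  then show ?thesis by (simp add: Lp_norm_2 L2_inner_def power2_eq_square)
qed

lemma L2_approx_L1_Linf:
  fixes f :: "'a::euclidean_space \<Rightarrow> real"
  assumes f: "f \<in> Lp_space 2"
  obtains F :: "nat \<Rightarrow> 'a \<Rightarrow> real" where "\<And>n. F n \<in> Lp_space 1 \<inter> Linf_space"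
    "(\<lambda>n. Lp_norm 2 (\<lambda>x. F n x - f x)) \<longlonglongrightarrow> 0" "\<And>n x. \<bar>F n x\<bar> \<le> \<bar>f x\<bar>"
proof -
  have [measurable]: "f \<in> borel_measurable lebesgue" using f by (simp add: Lp_space_2_iff)
  \<comment> \<open>Cutting off the large values gives boundedness; cutting off the small ones gives
    integrability, because \<open>|f| <= (n + 1) f^2\<close> on the remaining set.\<close>
  define F where "F n x = (if 1 / real (Suc n) \<le> \<bar>f x\<bar> \<and> \<bar>f x\<bar> \<le> real (Suc n) then f x else 0)" for n x
  have [measurable]: "F n \<in> borel_measurable lebesgue" for n
    unfolding F_def by measurable
  have "F n \<in> Lp_space 1 \<inter> Linf_space" for n
    unfolding L1_Linf_iff
  proof
    show "integrable lebesgue (F n)"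
    proof (rule Bochner_Integration.integrable_bound)
      show "integrable lebesgue (\<lambda>x. real (Suc n) * (f x)\<^sup>2)"
        using f by (simp add: Lp_space_2_iff)
      have "\<bar>F n x\<bar> \<le> real (Suc n) * (f x)\<^sup>2" for x
      proof (cases "1 / real (Suc n) \<le> \<bar>f x\<bar>")
        case True
        then have "1 \<le> real (Suc n) * \<bar>f x\<bar>" by (simp add: field_simps)
        then have "1 * \<bar>f x\<bar> \<le> real (Suc n) * \<bar>f x\<bar> * \<bar>f x\<bar>" by (intro mult_right_mono) auto
        then show ?thesis by (auto simp: F_def power2_eq_square)
      qed (simp add: F_def)
      then show "AE x in lebesgue. norm (F n x) \<le> norm (real (Suc n) * (f x)\<^sup>2)" by simp
    qed measurable
    show "\<exists>M. AE x in lebesgue. \<bar>F n x\<bar> \<le> M"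
      by (rule exI[of _ "real (Suc n)"]) (simp add: F_def)
  qed
  moreover have "(\<lambda>n. Lp_norm 2 (\<lambda>x. F n x - f x)) \<longlonglongrightarrow> 0"
  proof (rule L2_norm_tendsto_0_dominated[OF f f])
    have "(\<lambda>n. F n x) \<longlonglongrightarrow> f x" for x
    proof (cases "f x = 0")
      case False
      have "\<forall>\<^sub>F n in sequentially. inverse (real (Suc n)) < \<bar>f x\<bar>"
        using False by (intro order_tendstoD(2)[OF LIMSEQ_inverse_real_of_nat]) auto
      moreover have "\<forall>\<^sub>F n in sequentially. \<bar>f x\<bar> \<le> real (Suc n)"
        using eventually_ge_at_top[of "nat \<lceil>\<bar>f x\<bar>\<rceil>"] by eventually_elim linarith
      ultimately have "\<forall>\<^sub>F n in sequentially. F n x = f x"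
        by eventually_elim (simp add: F_def inverse_eq_divide)
      then show ?thesis by (rule tendsto_eventually)
    qed (simp add: F_def)
    then show "AE x in lebesgue. (\<lambda>n. F n x) \<longlonglongrightarrow> f x" by simp
  qed (auto simp: F_def)
  moreover have "\<bar>F n x\<bar> \<le> \<bar>f x\<bar>" for n x by (simp add: F_def)
  ultimately show ?thesis by (rule that)
qed

section \<open>Positivity and mass of the semigroup on bounded integrable functions\<close>

locale symmetric_markov_semigroup =
  fixes T :: "real \<Rightarrow> ('a::euclidean_space \<Rightarrow> real) \<Rightarrow> 'a \<Rightarrow> real"
  assumes C0: "C0_semigroup T"
    and symmetric: "symmetric_semigroup T"
    and submarkov: "submarkovian T"
begin

lemma T_L2: "0 \<le> t \<Longrightarrow> f \<in> Lp_space 2 \<Longrightarrow> T t f \<in> Lp_space 2"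
  using C0 unfolding C0_semigroup_def by blast

lemma T_lincomb:
  "0 \<le> t \<Longrightarrow> f \<in> Lp_space 2 \<Longrightarrow> g \<in> Lp_space 2 \<Longrightarrow>
    AE x in lebesgue. T t (\<lambda>y. a * f y + b * g y) x = a * T t f x + b * T t g x"
  using C0 unfolding C0_semigroup_def by blast

lemma T_diff:
  "0 \<le> t \<Longrightarrow> f \<in> Lp_space 2 \<Longrightarrow> g \<in> Lp_space 2 \<Longrightarrow>
    AE x in lebesgue. T t (\<lambda>y. f y - g y) x = T t f x - T t g x"
  using T_lincomb[of t f g 1 "-1"] by simp

lemma T_scale:
  "0 \<le> t \<Longrightarrow> f \<in> Lp_space 2 \<Longrightarrow> AE x in lebesgue. T t (\<lambda>y. a * f y) x = a * T t f x"
  using T_lincomb[of t f f a 0] by simp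

lemma T_bounded:
  assumes "0 \<le> t"
  obtains M where "0 \<le> M" "\<And>f. f \<in> Lp_space 2 \<Longrightarrow> Lp_norm 2 (T t f) \<le> M * Lp_norm 2 f"
proof -
  obtain M where M: "\<forall>f\<in>Lp_space 2. Lp_norm 2 (T t f) \<le> M * Lp_norm 2 f"
    using C0 assms unfolding C0_semigroup_def by blast
  have "Lp_norm 2 (T t f) \<le> max M 0 * Lp_norm 2 f" if "f \<in> Lp_space 2" for f
  proof -
    have "M * Lp_norm 2 f \<le> max M 0 * Lp_norm 2 f" by (intro mult_right_mono) auto
    then show ?thesis using M that by fastforce
  qed
  then show ?thesis by (intro that[of "max M 0"]) auto
qed

text \<open>Functions stand for classes, and \<open>C0_semigroup\<close> does not state that
  \<open>T t\<close> respects equality almost everywhere. Boundedness gives it for null functions,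
  and linearity then in general.\<close>

lemma T_eq_0:
  assumes "0 \<le> t" "f \<in> Lp_space 2" "AE x in lebesgue. f x = 0"
  shows "AE x in lebesgue. T t f x = 0"
proof (rule L2_norm_eq_0)
  obtain M where M: "\<And>f. f \<in> Lp_space 2 \<Longrightarrow> Lp_norm 2 (T t f) \<le> M * Lp_norm 2 f"
    using T_bounded assms(1) by blast
  have "Lp_norm 2 f = Lp_norm 2 (\<lambda>x::'a. 0 :: real)"
    by (rule L2_norm_cong_AE) (use assms L2_zero in auto)
  then have "Lp_norm 2 f = 0" by (simp add: Lp_norm_def)
  then show "Lp_norm 2 (T t f) = 0" using M[OF assms(2)] Lp_norm_nonneg[of 2 "T t f"] by simp
qed (use assms T_L2 in auto)

lemma T_cong_AE:
  assumes "0 \<le> t" "f \<in> Lp_space 2" "g \<in> Lp_space 2" "AE x in lebesgue. f x = g x"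
  shows "AE x in lebesgue. T t f x = T t g x"
proof -
  have "AE x in lebesgue. T t (\<lambda>x. f x - g x) x = 0"
    by (rule T_eq_0) (use assms L2_diff in auto)
  with T_diff[OF assms(1-3)] show ?thesis by eventually_elim simp
qed

lemma T_inner_lincomb:
  assumes "0 \<le> t" "f \<in> Lp_space 2" "g \<in> Lp_space 2" "h \<in> Lp_space 2"
  shows "L2_inner (T t (\<lambda>x. a * f x + b * g x)) h = a * L2_inner (T t f) h + b * L2_inner (T t g) h"
proof -
  have "L2_inner (T t (\<lambda>x. a * f x + b * g x)) h = L2_inner (\<lambda>x. a * T t f x + b * T t g x) h"
    by (intro L2_inner_cong_AE T_lincomb T_L2 L2_lincomb assms)
  then show ?thesis using assms by (simp add: L2_inner_lincomb T_L2)
qed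

lemma T_inner_add:
  "0 \<le> t \<Longrightarrow> f \<in> Lp_space 2 \<Longrightarrow> g \<in> Lp_space 2 \<Longrightarrow> h \<in> Lp_space 2 \<Longrightarrow>
    L2_inner (T t (\<lambda>x. f x + g x)) h = L2_inner (T t f) h + L2_inner (T t g) h"
  using T_inner_lincomb[of t f g h 1 1] by simp

lemma T_inner_diff:
  "0 \<le> t \<Longrightarrow> f \<in> Lp_space 2 \<Longrightarrow> g \<in> Lp_space 2 \<Longrightarrow> h \<in> Lp_space 2 \<Longrightarrow>
    L2_inner (T t (\<lambda>x. f x - g x)) h = L2_inner (T t f) h - L2_inner (T t g) h"
  using T_inner_lincomb[of t f g h 1 "-1"] by simp

lemma T_inner_scale:
  "0 \<le> t \<Longrightarrow> f \<in> Lp_space 2 \<Longrightarrow> h \<in> Lp_space 2 \<Longrightarrow>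
    L2_inner (T t (\<lambda>x. a * f x)) h = a * L2_inner (T t f) h"
  using T_inner_lincomb[of t f f h a 0] by simp

lemma T_symmetric:
  "0 \<le> t \<Longrightarrow> f \<in> Lp_space 2 \<Longrightarrow> g \<in> Lp_space 2 \<Longrightarrow> L2_inner (T t f) g = L2_inner f (T t g)"
  using symmetric unfolding symmetric_semigroup_def by blast

lemma T_inner_commute:
  "0 \<le> t \<Longrightarrow> f \<in> Lp_space 2 \<Longrightarrow> g \<in> Lp_space 2 \<Longrightarrow> L2_inner (T t f) g = L2_inner (T t g) f"
  by (subst T_symmetric) (simp_all add: L2_inner_commute)

lemma T_plus:
  "0 \<le> s \<Longrightarrow> 0 \<le> t \<Longrightarrow> f \<in> Lp_space 2 \<Longrightarrow> AE x in lebesgue. T (s + t) f x = T s (T t f) x"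
  using C0 unfolding C0_semigroup_def by blast

lemma T_inner_plus:
  assumes "0 \<le> s" "0 \<le> t" "f \<in> Lp_space 2" "g \<in> Lp_space 2"
  shows "L2_inner (T s f) (T t g) = L2_inner (T (s + t) f) g"
proof -
  have "L2_inner (T (s + t) f) g = L2_inner (T (t + s) f) g" by (simp add: add.commute)
  also have "\<dots> = L2_inner (T t (T s f)) g"
    by (intro L2_inner_cong_AE T_plus T_L2 assms add_nonneg_nonneg)
  also have "\<dots> = L2_inner (T s f) (T t g)" by (intro T_symmetric T_L2 assms)
  finally show ?thesis by simp
qed

lemma T_0_inner:
  assumes "f \<in> Lp_space 2" "g \<in> Lp_space 2"
  shows "L2_inner (T 0 f) g = L2_inner f g"
proof (rule L2_inner_cong_AE)
  show "AE x in lebesgue. T 0 f x = f x" using C0 assms unfolding C0_semigroup_def by blast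
qed (use assms T_L2 in auto)

lemma T_tendsto_0:
  "f \<in> Lp_space 2 \<Longrightarrow> ((\<lambda>t. Lp_norm 2 (\<lambda>x. T t f x - f x)) \<longlongrightarrow> 0) (at_right 0)"
  using C0 unfolding C0_semigroup_def by blast

lemma T_between:
  assumes t: "0 \<le> t" and f: "f \<in> Lp_space 2" and b: "AE x in lebesgue. 0 \<le> f x \<and> f x \<le> M"
  shows "AE x in lebesgue. 0 \<le> T t f x \<and> T t f x \<le> M"
proof (cases "M > 0")
  case True
  define c where "c = inverse M"
  have c: "c > 0" "c * M = 1" using True by (auto simp: c_def)
  have "AE x in lebesgue. 0 \<le> c * f x \<and> c * f x \<le> 1"
    using b
  proof eventually_elim
    case (elim x)
    then have "c * f x \<le> c * M" using c by (intro mult_left_mono) auto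
    with elim c show ?case by simp
  qed
  then have "AE x in lebesgue. 0 \<le> T t (\<lambda>x. c * f x) x \<and> T t (\<lambda>x. c * f x) x \<le> 1"
    using submarkov[unfolded submarkovian_def, rule_format, OF t L2_scale[OF f, of c]] by simp
  with T_scale[OF t f, of c] show ?thesis
  proof eventually_elim
    case (elim x)
    then have "0 \<le> c * T t f x" "c * T t f x \<le> c * M" using c by auto
    then show ?case using c(1) by (simp add: zero_le_mult_iff mult_le_cancel_left_pos)
  qed
next
  case False
  have "AE x in lebesgue. f x = 0" using b by eventually_elim (use False in linarith)
  from b T_eq_0[OF t f this] show ?thesis by eventually_elim linarith
qed

lemma T_nonneg:
  assumes t: "0 \<le> t" and f: "f \<in> Lp_space 1 \<inter> Linf_space" and b: "AE x in lebesgue. 0 \<le> f x"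
  shows "AE x in lebesgue. 0 \<le> T t f x"
proof -
  obtain M where M: "AE x in lebesgue. \<bar>f x\<bar> \<le> M" using f unfolding L1_Linf_iff by auto
  have "AE x in lebesgue. 0 \<le> f x \<and> f x \<le> M" using M b by eventually_elim auto
  from T_between[OF t L1_Linf_imp_L2[OF f] this] show ?thesis by eventually_elim simp
qed

text \<open>\<open>T t\<close> maps the negative part to a nonnegative function and the positive
  part, which lies between \<open>0\<close> and \<open>c\<close>, to a function below
  \<open>c\<close>.\<close>

lemma T_le_const:
  assumes t: "0 \<le> t" and f: "f \<in> Lp_space 1 \<inter> Linf_space" and c: "0 \<le> c" and b: "AE x in lebesgue. f x \<le> c"
  shows "AE x in lebesgue. T t f x \<le> c"
proof -
  have m: "f \<in> borel_measurable lebesgue" using f unfolding L1_Linf_iff by auto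
  let ?p = "\<lambda>x. max (f x) 0" and ?n = "\<lambda>x. max (- f x) 0"
  have p: "?p \<in> Lp_space 1 \<inter> Linf_space" and n: "?n \<in> Lp_space 1 \<inter> Linf_space"
    by (auto intro!: L1_Linf_dominated[OF f, where C = 1] simp del: Int_iff) (use m in measurable)
  have "AE x in lebesgue. T t (\<lambda>x. ?p x - ?n x) x = T t ?p x - T t ?n x"
    by (intro T_diff t L1_Linf_imp_L2 p n)
  moreover have "(\<lambda>x. ?p x - ?n x) = f" by (auto simp: max_def)
  ultimately have 1: "AE x in lebesgue. T t f x = T t ?p x - T t ?n x" by simp
  have "AE x in lebesgue. 0 \<le> ?p x \<and> ?p x \<le> c" using b by eventually_elim (use c in auto)
  from T_between[OF t L1_Linf_imp_L2[OF p] this] 1 T_nonneg[OF t n]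
  show ?thesis by auto
qed

lemma T_mono:
  assumes t: "0 \<le> t" and f: "f \<in> Lp_space 1 \<inter> Linf_space" and g: "g \<in> Lp_space 1 \<inter> Linf_space"
    and fg: "AE x in lebesgue. f x \<le> g x"
  shows "AE x in lebesgue. T t f x \<le> T t g x"
proof -
  have "(\<lambda>x. g x - f x) \<in> Lp_space 1 \<inter> Linf_space" using L1_Linf_lincomb[OF g f, of 1 "-1"] by simp
  then have "AE x in lebesgue. 0 \<le> T t (\<lambda>x. g x - f x) x"
    by (rule T_nonneg[OF t]) (use fg in auto)
  with T_diff[OF t L1_Linf_imp_L2[OF g] L1_Linf_imp_L2[OF f]] show ?thesis by eventually_elim simp
qed

lemma T_abs_le:
  assumes t: "0 \<le> t" and f: "f \<in> Lp_space 1 \<inter> Linf_space"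
  shows "AE x in lebesgue. \<bar>T t f x\<bar> \<le> T t (\<lambda>x. \<bar>f x\<bar>) x"
proof -
  have "(\<lambda>x. (-1) * f x + 0 * f x) \<in> Lp_space 1 \<inter> Linf_space" by (intro L1_Linf_lincomb f)
  then have m: "(\<lambda>x. - f x) \<in> Lp_space 1 \<inter> Linf_space" by simp
  have "AE x in lebesgue. T t (\<lambda>x. - f x) x \<le> T t (\<lambda>x. \<bar>f x\<bar>) x"
    by (intro T_mono t m L1_Linf_abs f) auto
  moreover have "AE x in lebesgue. T t f x \<le> T t (\<lambda>x. \<bar>f x\<bar>) x"
    by (intro T_mono t L1_Linf_abs f) auto
  moreover have "AE x in lebesgue. T t (\<lambda>x. - f x) x = - T t f x"
    using T_scale[OF t L1_Linf_imp_L2[OF f], of "-1"] by simp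
  ultimately show ?thesis by eventually_elim auto
qed

text \<open>By duality: the integral of \<open>T t f\<close> over a ball equals that of
  \<open>f\<close> against \<open>T t\<close> of the indicator, which is at most \<open>1\<close>.
  The constant \<open>1\<close> itself is not square integrable, so the balls exhaust the space and
  Fatou's lemma gives the limit.\<close>

lemma T_integral_le:
  assumes t: "0 \<le> t" and f: "f \<in> Lp_space 1 \<inter> Linf_space" and nonneg: "AE x in lebesgue. 0 \<le> f x"
  shows "integrable lebesgue (T t f)" "(LINT x|lebesgue. T t f x) \<le> (LINT x|lebesgue. f x)"
proof -
  note f2 = L1_Linf_imp_L2[OF f]
  have int: "integrable lebesgue f" using f unfolding L1_Linf_iff by auto
  have m[measurable]: "T t f \<in> borel_measurable lebesgue"
    using T_L2[OF t f2] by (simp add: Lp_space_2_iff)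
  note Tn = T_nonneg[OF t f nonneg]
  define E :: "nat \<Rightarrow> 'a \<Rightarrow> real" where "E n = indicator (cball 0 (real n))" for n
  have E: "E n \<in> Lp_space 1 \<inter> Linf_space" for n
    unfolding E_def by (intro L1_Linf_indicator) (use emeasure_lborel_cball_finite in auto)
  have Em[measurable]: "E n \<in> borel_measurable lebesgue" for n
    using E[of n] unfolding L1_Linf_iff by auto
  have le: "(\<integral>\<^sup>+x. ennreal (T t f x * E n x) \<partial>lebesgue) \<le> ennreal (LINT x|lebesgue. f x)" for n
  proof -
    have "AE x in lebesgue. 0 \<le> T t f x * E n x"
      using Tn by eventually_elim (simp add: E_def)
    then have "(\<integral>\<^sup>+x. ennreal (T t f x * E n x) \<partial>lebesgue) = ennreal (L2_inner (T t f) (E n))"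
      unfolding L2_inner_def
      by (intro nn_integral_eq_integral L2_integrable_mult T_L2 t f2 L1_Linf_imp_L2 E)
    also have "L2_inner (T t f) (E n) = L2_inner f (T t (E n))"
      by (intro T_symmetric t f2 L1_Linf_imp_L2 E)
    also have "\<dots> \<le> (LINT x|lebesgue. f x)"
      unfolding L2_inner_def
    proof (rule integral_mono_AE)
      show "integrable lebesgue (\<lambda>x. f x * T t (E n) x)"
        by (intro L2_integrable_mult T_L2 t f2 L1_Linf_imp_L2 E)
      have "AE x in lebesgue. T t (E n) x \<le> 1"
        by (rule T_le_const[OF t E]) (auto simp: E_def indicator_def)
      with nonneg show "AE x in lebesgue. f x * T t (E n) x \<le> f x"
        by eventually_elim (simp add: mult_left_le)
    qed (rule int)
    finally show ?thesis by (simp add: ennreal_leI)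
  qed
  have nn: "(\<integral>\<^sup>+x. ennreal (T t f x) \<partial>lebesgue) \<le> ennreal (LINT x|lebesgue. f x)"
  proof -
    have "(\<integral>\<^sup>+x. ennreal (T t f x) \<partial>lebesgue) = (\<integral>\<^sup>+x. liminf (\<lambda>n. ennreal (T t f x * E n x)) \<partial>lebesgue)"
    proof (rule nn_integral_cong)
      fix x
      have "\<forall>\<^sub>F n in sequentially. ennreal (T t f x * E n x) = ennreal (T t f x)"
        using eventually_ge_at_top[of "nat \<lceil>norm x\<rceil>"]
        by eventually_elim (auto simp: E_def indicator_def; linarith)
      then have "(\<lambda>n. ennreal (T t f x * E n x)) \<longlonglongrightarrow> ennreal (T t f x)" by (rule tendsto_eventually)
      then show "ennreal (T t f x) = liminf (\<lambda>n. ennreal (T t f x * E n x))"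
        by (simp add: lim_imp_Liminf)
    qed
    also have "\<dots> \<le> liminf (\<lambda>n. \<integral>\<^sup>+x. ennreal (T t f x * E n x) \<partial>lebesgue)"
      by (rule nn_integral_liminf) measurable
    also have "\<dots> \<le> liminf (\<lambda>n::nat. ennreal (LINT x|lebesgue. f x))"
      by (intro Liminf_mono always_eventually allI le)
    finally show ?thesis by (simp add: Liminf_const)
  qed
  show *: "integrable lebesgue (T t f)"
    by (rule integrableI_nonneg) (use nn Tn in \<open>auto simp: less_top[symmetric] top_unique\<close>)
  have "(LINT x|lebesgue. f x) \<ge> 0" using nonneg by (rule integral_nonneg_AE)
  moreover have "ennreal (LINT x|lebesgue. T t f x) \<le> ennreal (LINT x|lebesgue. f x)"
    using nn by (subst (asm) nn_integral_eq_integral[OF * Tn])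
  ultimately show "(LINT x|lebesgue. T t f x) \<le> (LINT x|lebesgue. f x)"
    by simp
qed

lemma T_L1_Linf:
  assumes t: "0 \<le> t" and f: "f \<in> Lp_space 1 \<inter> Linf_space"
  shows "T t f \<in> Lp_space 1 \<inter> Linf_space"
proof -
  let ?a = "\<lambda>x. \<bar>f x\<bar>"
  have a: "?a \<in> Lp_space 1 \<inter> Linf_space" by (rule L1_Linf_abs[OF f])
  obtain M where M: "AE x in lebesgue. \<bar>f x\<bar> \<le> M" using f unfolding L1_Linf_iff by auto
  have "AE x in lebesgue. 0 \<le> T t ?a x \<and> T t ?a x \<le> M"
    by (rule T_between[OF t L1_Linf_imp_L2[OF a]]) (use M in auto)
  then have "AE x in lebesgue. \<bar>T t ?a x\<bar> \<le> M" by auto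
  then have "T t ?a \<in> Lp_space 1 \<inter> Linf_space"
    using T_integral_le(1)[OF t a] unfolding L1_Linf_iff by auto
  then show ?thesis
  proof (rule L1_Linf_dominated[where C = 1])
    show "AE x in lebesgue. \<bar>T t f x\<bar> \<le> 1 * \<bar>T t ?a x\<bar>"
      using T_abs_le[OF t f] by eventually_elim simp
    show "T t f \<in> borel_measurable lebesgue"
      using T_L2[OF t L1_Linf_imp_L2[OF f]] by (simp add: Lp_space_2_iff)
  qed
qed

end

section \<open>Jensen's inequality and contraction properties\<close>

context symmetric_markov_semigroup
begin

text \<open>The tangent lines of \<open>\<Phi>\<close> with rational points of contact turn the submarkov property into
  a pointwise inequality.\<close>

lemma T_Jensen:
  assumes t: "0 \<le> t" and f: "f \<in> Lp_space 1 \<inter> Linf_space" and nonneg: "AE x in lebesgue. 0 \<le> f x"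
    and tangent: "\<And>a b. 0 \<le> a \<Longrightarrow> 0 \<le> b \<Longrightarrow> \<Phi> a + F a * (b - a) \<le> \<Phi> b"
    and \<Phi>0: "\<Phi> 0 = 0" and cont: "continuous_on {0..} \<Phi>" "continuous_on {0..} F"
    and \<Phi>f: "(\<lambda>x. \<Phi> (f x)) \<in> Lp_space 1 \<inter> Linf_space"
  shows "AE x in lebesgue. \<Phi> (T t f x) \<le> T t (\<lambda>x. \<Phi> (f x)) x"
proof -
  have *: "AE x in lebesgue. F a * T t f x - T t (\<lambda>x. \<Phi> (f x)) x \<le> a * F a - \<Phi> a" if a: "0 \<le> a" for a
  proof -
    have h: "(\<lambda>x. F a * f x + (-1) * \<Phi> (f x)) \<in> Lp_space 1 \<inter> Linf_space"
      by (intro L1_Linf_lincomb f \<Phi>f)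
    have "AE x in lebesgue. T t (\<lambda>x. F a * f x + (-1) * \<Phi> (f x)) x \<le> a * F a - \<Phi> a"
    proof (rule T_le_const[OF t h])
      \<comment> \<open>The tangent at \<open>a\<close> lies below \<open>\<Phi>\<close> at
        \<open>0\<close>, so its intercept is nonpositive. The sign matters because
        \<open>T t\<close> may lose mass: only nonnegative constants are preserved as upper
        bounds.\<close>
      show "0 \<le> a * F a - \<Phi> a" using tangent[OF a, of 0] \<Phi>0 by (simp add: mult.commute)
      show "AE x in lebesgue. F a * f x + - 1 * \<Phi> (f x) \<le> a * F a - \<Phi> a"
        using nonneg
      proof eventually_elim
        case (elim x)
        show ?case using tangent[OF a elim] by (simp add: algebra_simps)
      qed
    qed
    with T_lincomb[OF t L1_Linf_imp_L2[OF f] L1_Linf_imp_L2[OF \<Phi>f], of "F a" "-1"]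
    show ?thesis by eventually_elim simp
  qed
  define a where "a i j = real i / real (Suc j)" for i j
  have "AE x in lebesgue. \<forall>i j. F (a i j) * T t f x - T t (\<lambda>x. \<Phi> (f x)) x \<le> a i j * F (a i j) - \<Phi> (a i j)"
    unfolding AE_all_countable by (intro allI *) (simp add: a_def)
  with T_nonneg[OF t f nonneg] show ?thesis
  proof eventually_elim
    case (elim x)
    define y where "y = T t f x"
    have y: "0 \<le> y" using elim by (simp add: y_def)
    define b where "b n = a (nat \<lfloor>y * real (Suc n)\<rfloor>) n" for n
    have b0: "0 \<le> b n" for n by (simp add: b_def a_def)
    have blim: "b \<longlonglongrightarrow> y"
    proof (rule LIMSEQ_I)
      fix r :: real assume "r > 0"
      then obtain N where N: "inverse (real (Suc N)) < r" using reals_Archimedean by blast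
      have "norm (b n - y) < r" if "n \<ge> N" for n
      proof -
        have "0 \<le> y * real (Suc n)" using y by simp
        then have "\<bar>real (nat \<lfloor>y * real (Suc n)\<rfloor>) - y * real (Suc n)\<bar> \<le> 1" by linarith
        then have "\<bar>real (nat \<lfloor>y * real (Suc n)\<rfloor>) - y * real (Suc n)\<bar> / real (Suc n) \<le> 1 / real (Suc n)"
          by (intro divide_right_mono) auto
        also have "\<bar>real (nat \<lfloor>y * real (Suc n)\<rfloor>) - y * real (Suc n)\<bar> / real (Suc n) = \<bar>b n - y\<bar>"
        proof -
          have "b n - y = (real (nat \<lfloor>y * real (Suc n)\<rfloor>) - y * real (Suc n)) / real (Suc n)"
            by (simp add: b_def a_def diff_divide_distrib)
          then show ?thesis by (simp only: abs_divide abs_of_nat)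
        qed
        also have "1 / real (Suc n) \<le> inverse (real (Suc N))"
          using that by (simp add: field_simps)
        finally show ?thesis using N by simp
      qed
      then show "\<exists>no. \<forall>n\<ge>no. norm (b n - y) < r" by blast
    qed
    have "(\<lambda>n. \<Phi> (b n)) \<longlonglongrightarrow> \<Phi> y" "(\<lambda>n. F (b n)) \<longlonglongrightarrow> F y"
      by (intro continuous_on_tendsto_compose[OF cont(1) blim] continuous_on_tendsto_compose[OF cont(2) blim];
          use b0 y in simp)+
    then have "(\<lambda>n. F (b n) * y - b n * F (b n) + \<Phi> (b n)) \<longlonglongrightarrow> F y * y - y * F y + \<Phi> y"
      by (intro tendsto_intros blim)
    moreover have "F (b n) * y - b n * F (b n) + \<Phi> (b n) \<le> T t (\<lambda>x. \<Phi> (f x)) x" for n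
    proof -
      have "F (b n) * y - T t (\<lambda>x. \<Phi> (f x)) x \<le> b n * F (b n) - \<Phi> (b n)"
        using elim unfolding b_def y_def by blast
      then show ?thesis by linarith
    qed
    ultimately have "F y * y - y * F y + \<Phi> y \<le> T t (\<lambda>x. \<Phi> (f x)) x"
      by (intro LIMSEQ_le_const2) auto
    then show ?case by (simp add: y_def)
  qed
qed

lemma T_integral_convex_le:
  assumes t: "0 \<le> t" and f: "f \<in> Lp_space 1 \<inter> Linf_space" and nonneg: "AE x in lebesgue. 0 \<le> f x"
    and tangent: "\<And>a b. 0 \<le> a \<Longrightarrow> 0 \<le> b \<Longrightarrow> \<Phi> a + F a * (b - a) \<le> \<Phi> b"
    and \<Phi>0: "\<Phi> 0 = 0" and F0: "F 0 = 0" and cont: "continuous_on {0..} \<Phi>" "continuous_on {0..} F"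
    and \<Phi>f: "(\<lambda>x. \<Phi> (f x)) \<in> Lp_space 1 \<inter> Linf_space"
    and \<Phi>Tf: "(\<lambda>x. \<Phi> (T t f x)) \<in> Lp_space 1 \<inter> Linf_space"
  shows "(LINT x|lebesgue. \<Phi> (T t f x)) \<le> (LINT x|lebesgue. \<Phi> (f x))"
proof -
  have \<Phi>_nonneg: "0 \<le> \<Phi> a" if "0 \<le> a" for a using tangent[of 0 a] that \<Phi>0 F0 by simp
  have nn: "AE x in lebesgue. 0 \<le> \<Phi> (f x)" using nonneg by eventually_elim (rule \<Phi>_nonneg)
  have "(LINT x|lebesgue. \<Phi> (T t f x)) \<le> (LINT x|lebesgue. T t (\<lambda>x. \<Phi> (f x)) x)"
    by (rule integral_mono_AE[OF L1_Linf_integrable[OF \<Phi>Tf] L1_Linf_integrable[OF T_L1_Linf[OF t \<Phi>f]]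
          T_Jensen[OF t f nonneg tangent \<Phi>0 cont \<Phi>f]])
  also have "\<dots> \<le> (LINT x|lebesgue. \<Phi> (f x))" by (rule T_integral_le(2)[OF t \<Phi>f nn])
  finally show ?thesis .
qed

text \<open>Jensen's inequality is available for nonnegative functions, hence the passage to
  \<open>|f|\<close>; integrating it uses that the mass does not increase.\<close>

lemma T_Lp_contraction:
  assumes t: "0 \<le> t" and f: "f \<in> Lp_space 1 \<inter> Linf_space" and p: "1 < p"
  shows "(LINT x|lebesgue. \<bar>T t f x\<bar> powr p) \<le> (LINT x|lebesgue. \<bar>f x\<bar> powr p)"
proof -
  define g where "g = (\<lambda>x. \<bar>f x\<bar>)"
  have g: "g \<in> Lp_space 1 \<inter> Linf_space" unfolding g_def by (rule L1_Linf_abs[OF f])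
  have gnn: "AE x in lebesgue. 0 \<le> g x" by (simp add: g_def)
  have Tg: "T t g \<in> Lp_space 1 \<inter> Linf_space" by (rule T_L1_Linf[OF t g])
  have mTg: "T t g \<in> borel_measurable lebesgue" by (rule L1_Linf_measurable[OF Tg])
  have "(LINT x|lebesgue. \<bar>T t f x\<bar> powr p) \<le> (LINT x|lebesgue. \<bar>T t g x\<bar> powr p)"
  proof (rule integral_mono_AE)
    show "integrable lebesgue (\<lambda>x. \<bar>T t f x\<bar> powr p)" "integrable lebesgue (\<lambda>x. \<bar>T t g x\<bar> powr p)"
      using p by (intro L1_Linf_integrable L1_Linf_powr T_L1_Linf t f Tg; simp)+
    show "AE x in lebesgue. \<bar>T t f x\<bar> powr p \<le> \<bar>T t g x\<bar> powr p"
      using T_abs_le[OF t f] by eventually_elim (use p in \<open>auto simp: g_def intro!: powr_mono2\<close>)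
  qed
  also have "\<dots> \<le> (LINT x|lebesgue. \<bar>g x\<bar> powr p)"
  proof (rule T_integral_convex_le[OF t g gnn, where F = "\<lambda>a. p * \<bar>a\<bar> powr (p - 1)"])
    show "\<bar>a\<bar> powr p + p * \<bar>a\<bar> powr (p - 1) * (b - a) \<le> \<bar>b\<bar> powr p" if "0 \<le> a" "0 \<le> b" for a b
      using powr_tangent_line[OF that p] that by simp
    show "continuous_on {0..} (\<lambda>a. \<bar>a\<bar> powr p)" "continuous_on {0..} (\<lambda>a. p * \<bar>a\<bar> powr (p - 1))"
      by (intro continuous_intros continuous_on_powr'; use p in auto)+
  qed (use p L1_Linf_powr[OF g, of p] L1_Linf_powr[OF Tg, of p] in auto)
  finally show ?thesis by (simp add: g_def)
qed

text \<open>\<open>C0_semigroup\<close> gives only some bound \<open>M\<close> for each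
  \<open>t\<close>. The contraction holds on bounded integrable functions by the case of exponent
  \<open>2\<close>, and in the passage to the limit \<open>M\<close> multiplies only an error
  tending to \<open>0\<close>.\<close>

lemma T_L2_contraction:
  assumes t: "0 \<le> t" and f: "f \<in> Lp_space 2"
  shows "Lp_norm 2 (T t f) \<le> Lp_norm 2 f"
proof -
  obtain F :: "nat \<Rightarrow> 'a \<Rightarrow> real" where F: "\<And>n. F n \<in> Lp_space 1 \<inter> Linf_space"
    "(\<lambda>n. Lp_norm 2 (\<lambda>x. F n x - f x)) \<longlonglongrightarrow> 0" "\<And>n x. \<bar>F n x\<bar> \<le> \<bar>f x\<bar>"
    by (rule L2_approx_L1_Linf[OF f]) blast
  note F2 = L1_Linf_imp_L2[OF F(1)]
  obtain M where M: "0 \<le> M" "\<And>f. f \<in> Lp_space 2 \<Longrightarrow> Lp_norm 2 (T t f) \<le> M * Lp_norm 2 f"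
    using T_bounded[OF t] by blast
  have le: "Lp_norm 2 (T t f) \<le> Lp_norm 2 f + M * Lp_norm 2 (\<lambda>x. F n x - f x)" for n
  proof -
    have "Lp_norm 2 (T t f) = Lp_norm 2 (\<lambda>x. T t (\<lambda>x. f x - F n x) x + T t (F n) x)"
    proof (rule L2_norm_cong_AE)
      show "AE x in lebesgue. T t f x = T t (\<lambda>x. f x - F n x) x + T t (F n) x"
        using T_diff[OF t f F2[of n]] by eventually_elim simp
    qed (intro T_L2 L2_add L2_diff t f F2)+
    also have "\<dots> \<le> Lp_norm 2 (T t (\<lambda>x. f x - F n x)) + Lp_norm 2 (T t (F n))"
      by (intro L2_norm_triangle T_L2 L2_diff t f F2)
    also have "Lp_norm 2 (T t (\<lambda>x. f x - F n x)) \<le> M * Lp_norm 2 (\<lambda>x. F n x - f x)"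
      using M(2)[OF L2_diff[OF f F2[of n]]] L2_norm_minus[of f "F n"] by simp
    also have "Lp_norm 2 (T t (F n)) \<le> Lp_norm 2 (F n)"
      unfolding Lp_norm_def by (intro powr_mono2 T_Lp_contraction t F) (auto intro: integral_nonneg_AE)
    also have "Lp_norm 2 (F n) \<le> Lp_norm 2 f"
    proof -
      have "(LINT x|lebesgue. (F n x)\<^sup>2) \<le> (LINT x|lebesgue. (f x)\<^sup>2)"
        by (rule integral_mono_AE) (use F(3) F2[of n] f in \<open>auto simp: Lp_space_2_iff abs_le_square_iff\<close>)
      then show ?thesis by (simp add: Lp_norm_2 L2_inner_def power2_eq_square)
    qed
    finally show ?thesis by simp
  qed
  have "(\<lambda>n. Lp_norm 2 f + M * Lp_norm 2 (\<lambda>x. F n x - f x)) \<longlonglongrightarrow> Lp_norm 2 f + M * 0"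
    by (intro tendsto_intros F)
  then show ?thesis using LIMSEQ_le_const[of _ _ "Lp_norm 2 (T t f)"] le by auto
qed

section \<open>Approximating forms and convexity in time\<close>

lemma T_inner_le:
  assumes t: "0 \<le> t" and f: "f \<in> Lp_space 2"
  shows "L2_inner (T t f) f \<le> L2_inner f f"
proof -
  have "\<bar>L2_inner (T t f) f\<bar> \<le> Lp_norm 2 (T t f) * Lp_norm 2 f"
    by (intro L2_Cauchy_Schwarz T_L2 t f)
  also have "\<dots> \<le> Lp_norm 2 f * Lp_norm 2 f"
    by (intro mult_right_mono T_L2_contraction t f) simp
  finally show ?thesis by (simp add: Lp_norm_2)
qed

lemma T_inner_half:
  assumes "0 \<le> t" "f \<in> Lp_space 2"
  shows "L2_inner (T t f) f = L2_inner (T (t / 2) f) (T (t / 2) f)"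
  using T_inner_plus[of "t / 2" "t / 2" f f] assms by simp

lemma T_T_inner:
  assumes "0 \<le> h" "0 \<le> s" "0 \<le> t" "f \<in> Lp_space 2"
  shows "L2_inner (T h (T s f)) (T t f) = L2_inner (T (s + t + h) f) f"
proof -
  have "L2_inner (T h (T s f)) (T t f) = L2_inner (T (h + s) f) (T t f)"
    by (rule sym) (intro L2_inner_cong_AE T_plus T_L2 assms add_nonneg_nonneg)
  also have "\<dots> = L2_inner (T (h + s + t) f) f" using assms by (intro T_inner_plus) auto
  finally show ?thesis by (simp add: ac_simps)
qed

text \<open>The bilinear form of \<open>1 - T h\<close>. Divided by \<open>h\<close>, it
  approximates the form of \<open>A\<close> as \<open>h\<close> tends to \<open>0\<close>, and it is
  defined on all of L^2.\<close>

definition dissipation :: "real \<Rightarrow> ('a \<Rightarrow> real) \<Rightarrow> ('a \<Rightarrow> real) \<Rightarrow> real" where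
  "dissipation h f g = L2_inner f g - L2_inner (T h f) g"

lemma dissipation_commute:
  "0 \<le> h \<Longrightarrow> f \<in> Lp_space 2 \<Longrightarrow> g \<in> Lp_space 2 \<Longrightarrow> dissipation h f g = dissipation h g f"
  unfolding dissipation_def by (simp add: T_inner_commute[of h f g] L2_inner_commute[of f g])

lemma dissipation_nonneg: "0 \<le> h \<Longrightarrow> f \<in> Lp_space 2 \<Longrightarrow> 0 \<le> dissipation h f f"
  using T_inner_le by (simp add: dissipation_def)

lemma dissipation_add:
  "0 \<le> h \<Longrightarrow> f \<in> Lp_space 2 \<Longrightarrow> f' \<in> Lp_space 2 \<Longrightarrow> g \<in> Lp_space 2 \<Longrightarrow>
    dissipation h (\<lambda>x. f x + f' x) g = dissipation h f g + dissipation h f' g"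
  by (simp add: dissipation_def L2_inner_add T_inner_add)

lemma dissipation_diff:
  "0 \<le> h \<Longrightarrow> f \<in> Lp_space 2 \<Longrightarrow> f' \<in> Lp_space 2 \<Longrightarrow> g \<in> Lp_space 2 \<Longrightarrow>
    dissipation h (\<lambda>x. f x - f' x) g = dissipation h f g - dissipation h f' g"
  by (simp add: dissipation_def L2_inner_diff T_inner_diff)

lemma dissipation_scale:
  "0 \<le> h \<Longrightarrow> f \<in> Lp_space 2 \<Longrightarrow> g \<in> Lp_space 2 \<Longrightarrow>
    dissipation h (\<lambda>x. a * f x) g = a * dissipation h f g"
  by (simp add: dissipation_def L2_inner_scale T_inner_scale algebra_simps)

lemma dissipation_add_self:
  assumes "0 \<le> h" "f \<in> Lp_space 2" "g \<in> Lp_space 2"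
  shows "dissipation h (\<lambda>x. f x + g x) (\<lambda>x. f x + g x) =
    dissipation h f f + 2 * dissipation h f g + dissipation h g g"
  using assms
  by (simp add: dissipation_add L2_add dissipation_commute[of h _ "\<lambda>x. f x + g x"]
      dissipation_commute[of h g f])

lemma dissipation_scale_self:
  assumes "0 \<le> h" "f \<in> Lp_space 2"
  shows "dissipation h (\<lambda>x. a * f x) (\<lambda>x. a * f x) = a\<^sup>2 * dissipation h f f"
  using assms
  by (simp add: dissipation_scale L2_scale dissipation_commute[of h _ "\<lambda>x. a * f x"] power2_eq_square)

lemma dissipation_Cauchy_Schwarz:
  assumes "0 \<le> h" "f \<in> Lp_space 2" "g \<in> Lp_space 2"
  shows "\<bar>dissipation h f g\<bar> \<le> sqrt (dissipation h f f) * sqrt (dissipation h g g)"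
proof -
  have "(dissipation h f g)\<^sup>2 \<le> dissipation h f f * dissipation h g g"
  proof (rule square_le_mult_if_quadratic_nonneg)
    fix t
    have "0 \<le> dissipation h (\<lambda>x. f x + t * g x) (\<lambda>x. f x + t * g x)"
      by (intro dissipation_nonneg L2_add L2_scale assms)
    also have "\<dots> = dissipation h f f + 2 * t * dissipation h f g + t\<^sup>2 * dissipation h g g"
      using assms
      by (simp add: dissipation_add_self L2_scale dissipation_scale_self
          dissipation_commute[of h f "\<lambda>x. t * g x"] dissipation_scale dissipation_commute[of h g f])
    finally show "0 \<le> dissipation h f f + 2 * t * dissipation h f g + t\<^sup>2 * dissipation h g g" .
  qed
  then have "\<bar>dissipation h f g\<bar> \<le> sqrt (dissipation h f f * dissipation h g g)"
    by (simp add: real_le_rsqrt)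
  then show ?thesis by (simp add: real_sqrt_mult)
qed

lemma dissipation_add_le:
  assumes "0 \<le> h" "f \<in> Lp_space 2" "g \<in> Lp_space 2"
  shows "dissipation h (\<lambda>x. f x + g x) (\<lambda>x. f x + g x) \<le> 2 * dissipation h f f + 2 * dissipation h g g"
proof -
  have "0 \<le> dissipation h (\<lambda>x. f x - g x) (\<lambda>x. f x - g x)"
    by (intro dissipation_nonneg L2_diff assms)
  also have "\<dots> = dissipation h f f - 2 * dissipation h f g + dissipation h g g"
    using assms by (simp add: dissipation_diff L2_diff dissipation_commute[of h _ "\<lambda>x. f x - g x"]
      dissipation_commute[of h g f])
  finally show ?thesis using assms by (simp add: dissipation_add_self)
qed

lemma dissipation_T:
  assumes "0 \<le> h" "0 \<le> s" "0 \<le> t" "f \<in> Lp_space 2"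
  shows "dissipation h (T s f) (T t f) = L2_inner (T (s + t) f) f - L2_inner (T (s + t + h) f) f"
  using assms by (simp add: dissipation_def T_T_inner T_inner_plus)

text \<open>Strong continuity is assumed only at \<open>0\<close> from the right. The semigroup law
  and the contraction property carry the same modulus of continuity to every time, on both
  sides.\<close>

lemma T_inner_continuous:
  assumes f: "f \<in> Lp_space 2"
  shows "continuous_on {0..} (\<lambda>t. L2_inner (T t f) f)"
proof -
  let ?g = "\<lambda>t. L2_inner (T t f) f"
  have le: "\<bar>?g (t + h) - ?g t\<bar> \<le> Lp_norm 2 (\<lambda>x. T h f x - f x) * Lp_norm 2 f" if "0 \<le> t" "0 \<le> h" for t h
  proof -
    have "?g (t + h) - ?g t = L2_inner (T t (\<lambda>x. T h f x - f x)) f"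
      using that f T_symmetric[of t "T h f" f] T_inner_plus[of h t f f]
      by (simp add: T_inner_diff T_L2 add.commute)
    also have "\<bar>\<dots>\<bar> \<le> Lp_norm 2 (T t (\<lambda>x. T h f x - f x)) * Lp_norm 2 f"
      by (intro L2_Cauchy_Schwarz T_L2 L2_diff f that)
    also have "\<dots> \<le> Lp_norm 2 (\<lambda>x. T h f x - f x) * Lp_norm 2 f"
      by (intro mult_right_mono T_L2_contraction T_L2 L2_diff f that) simp
    finally show ?thesis .
  qed
  show ?thesis
    unfolding continuous_on_iff
  proof (intro ballI allI impI)
    fix s e :: real assume s: "s \<in> {0..}" and e: "0 < e"
    have "((\<lambda>h. Lp_norm 2 (\<lambda>x. T h f x - f x) * Lp_norm 2 f) \<longlongrightarrow> 0 * Lp_norm 2 f) (at_right 0)"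
      by (intro tendsto_intros T_tendsto_0 f)
    then have "\<forall>\<^sub>F h in at_right 0. Lp_norm 2 (\<lambda>x. T h f x - f x) * Lp_norm 2 f < e"
      using e by (intro order_tendstoD(2)) auto
    then obtain d where d: "d > 0" "\<And>h. 0 < h \<Longrightarrow> h < d \<Longrightarrow> Lp_norm 2 (\<lambda>x. T h f x - f x) * Lp_norm 2 f < e"
      unfolding eventually_at_right_field by auto
    have "\<bar>?g t - ?g s\<bar> < e" if "t \<in> {0..}" "\<bar>t - s\<bar> < d" for t
    proof (cases t s rule: linorder_cases)
      case less
      then show ?thesis using le[of t "s - t"] d(2)[of "s - t"] that by (simp add: abs_minus_commute)
    next
      case greater
      then show ?thesis using le[of s "t - s"] d(2)[of "t - s"] that s by simp
    qed (use e in simp)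
    then show "\<exists>d>0. \<forall>x'\<in>{0..}. dist x' s < d \<longrightarrow> dist (?g x') (?g s) < e"
      using d(1) by (auto simp: dist_real_def)
  qed
qed

text \<open>The second difference with step \<open>k\<close> at \<open>x\<close> is the squared norm
  of \<open>T (x / 2) f - T (x / 2 + k) f\<close>.\<close>

lemma T_inner_convex:
  assumes f: "f \<in> Lp_space 2"
  shows "convex_on {0..} (\<lambda>t. L2_inner (T t f) f)"
proof (rule midpoint_convex_imp_convex_on[OF T_inner_continuous[OF f]])
  fix x k :: real assume xk: "0 \<le> x" "0 \<le> k"
  let ?a = "T (x / 2) f" and ?b = "T (x / 2 + k) f"
  have "0 \<le> L2_inner (\<lambda>x. ?a x - ?b x) (\<lambda>x. ?a x - ?b x)" by simp
  also have "\<dots> = L2_inner ?a ?a - 2 * L2_inner ?a ?b + L2_inner ?b ?b"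
    using xk f by (simp add: L2_inner_diff L2_inner_diff_right T_L2 L2_diff L2_inner_commute[of ?b ?a])
  finally show "2 * L2_inner (T (x + k) f) f \<le> L2_inner (T x f) f + L2_inner (T (x + 2 * k) f) f"
    using xk f by (simp add: T_inner_plus)
qed

text \<open>The second difference is again a square, with the nonnegative form
  \<open>dissipation h\<close> in place of the inner product.\<close>

lemma T_inner_difference_convex:
  assumes f: "f \<in> Lp_space 2" and h: "0 \<le> h"
  shows "convex_on {0..} (\<lambda>t. L2_inner (T t f) f - L2_inner (T (t + h) f) f)"
proof (rule midpoint_convex_imp_convex_on)
  show "continuous_on {0..} (\<lambda>t. L2_inner (T t f) f - L2_inner (T (t + h) f) f)"
    using h by (intro continuous_intros T_inner_continuous f continuous_on_compose2[OF T_inner_continuous[OF f]]) auto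
  fix x k :: real assume xk: "0 \<le> x" "0 \<le> k"
  let ?a = "T (x / 2) f" and ?b = "T (x / 2 + k) f"
  have "0 \<le> dissipation h (\<lambda>x. ?a x - ?b x) (\<lambda>x. ?a x - ?b x)"
    using xk f h by (intro dissipation_nonneg L2_diff T_L2) auto
  also have "\<dots> = dissipation h ?a ?a - 2 * dissipation h ?a ?b + dissipation h ?b ?b"
    using xk f h by (simp add: dissipation_diff L2_diff dissipation_commute[of h _ "\<lambda>x. ?a x - ?b x"]
      dissipation_commute[of h ?b ?a] T_L2)
  finally show "2 * (L2_inner (T (x + k) f) f - L2_inner (T (x + k + h) f) f)
     \<le> L2_inner (T x f) f - L2_inner (T (x + h) f) f
      + (L2_inner (T (x + 2 * k) f) f - L2_inner (T (x + 2 * k + h) f) f)"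
    using xk f h by (simp add: dissipation_T)
qed

lemma dissipation_quotient_antimono:
  assumes f: "f \<in> Lp_space 2" and "0 < h" "h \<le> k"
  shows "dissipation k f f / k \<le> dissipation h f f / h"
  using convex_on_slope_mono[OF T_inner_convex[OF f], of 0 0 h k] assms
  by (simp add: dissipation_def T_0_inner diff_divide_distrib)

lemma T_inner_nonneg: "0 \<le> t \<Longrightarrow> f \<in> Lp_space 2 \<Longrightarrow> 0 \<le> L2_inner (T t f) f"
  by (simp add: T_inner_half)

text \<open>In spectral terms this is the bound of \<open>\<lambda> e^(- t \<lambda>)\<close> by
  \<open>1 / t\<close>. Here convexity compares the slope after \<open>t\<close> with the mean slope
  on \<open>[0, t]\<close>, and that one is controlled because the function stays
  nonnegative.\<close>

lemma T_inner_slope: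
  assumes f: "f \<in> Lp_space 2" and "0 < h" "0 < t"
  shows "L2_inner (T t f) f - L2_inner (T (t + h) f) f \<le> h / t * L2_inner f f"
proof -
  have "(L2_inner (T t f) f - L2_inner f f) / t \<le> (L2_inner (T (t + h) f) f - L2_inner (T t f) f) / h"
    using convex_on_slope_mono[OF T_inner_convex[OF f], of 0 t t h] assms by (simp add: T_0_inner)
  then have "(L2_inner (T t f) f - L2_inner (T (t + h) f) f) / h \<le> (L2_inner f f - L2_inner (T t f) f) / t"
    by (simp add: diff_divide_distrib)
  also have "\<dots> \<le> L2_inner f f / t"
    using T_inner_nonneg[of t f] assms by (intro divide_right_mono) auto
  finally show ?thesis using assms by (simp add: field_simps)
qed

lemma dissipation_T_le:
  assumes f: "f \<in> Lp_space 2" and "0 < h" "0 < s"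
  shows "dissipation h (T s f) (T s f) \<le> h / (2 * s) * L2_inner f f"
  using T_inner_slope[OF f, of h "2 * s"] assms by (simp add: dissipation_T)

text \<open>A quantitative form of analyticity: increments at time \<open>t\<close> have norm at
  most \<open>h / t\<close> times that of \<open>f\<close>. Their squared norm is a second
  difference of \<open>L2_inner (T t f) f\<close> at \<open>2 * t\<close>; convexity of the first
  difference and then \<open>T_inner_slope\<close> each contribute a factor \<open>h / t\<close>.
  The square is what makes the error in the energy balance negligible.\<close>

lemma T_increment:
  assumes f: "f \<in> Lp_space 2" and "0 < h" "0 < t"
  shows "L2_inner (\<lambda>x. T t f x - T (t + h) f x) (\<lambda>x. T t f x - T (t + h) f x) \<le> (h / t)\<^sup>2 * L2_inner f f"
proof -
  let ?d = "\<lambda>x. L2_inner (T x f) f - L2_inner (T (x + h) f) f"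
  have "L2_inner (\<lambda>x. T t f x - T (t + h) f x) (\<lambda>x. T t f x - T (t + h) f x)
      = ?d (t + t) - ?d (t + t + h)"
    using assms by (simp add: L2_inner_diff L2_inner_diff_right T_L2 L2_diff T_inner_plus algebra_simps)
  then have "L2_inner (\<lambda>x. T t f x - T (t + h) f x) (\<lambda>x. T t f x - T (t + h) f x) / h
      = (?d (t + t) - ?d (t + t + h)) / h" by simp
  also have "(?d (t + t) - ?d t) / t \<le> (?d (t + t + h) - ?d (t + t)) / h"
    using convex_on_slope_mono[OF T_inner_difference_convex[OF f], of h t "t + t" t h] assms by simp
  then have "(?d (t + t) - ?d (t + t + h)) / h \<le> (?d t - ?d (t + t)) / t"
    unfolding diff_divide_distrib by linarith
  also have "\<dots> \<le> ?d t / t"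
  proof (intro divide_right_mono)
    have "0 \<le> dissipation h (T t f) (T t f)" using assms by (intro dissipation_nonneg T_L2) auto
    then show "?d t - ?d (t + t) \<le> ?d t" using assms by (simp add: dissipation_T)
  qed (use assms in auto)
  also have "?d t / t \<le> h / t * L2_inner f f / t"
    by (intro divide_right_mono T_inner_slope) (use assms in auto)
  finally have "L2_inner (\<lambda>x. T t f x - T (t + h) f x) (\<lambda>x. T t f x - T (t + h) f x) / h
      \<le> h / t * L2_inner f f / t" .
  then show ?thesis using assms by (simp add: field_simps power2_eq_square)
qed

end

section \<open>The closed form as a limit of difference quotients\<close>

lemma (in symmetric_markov_semigroup) dissipation_cong_AE:
  assumes "0 \<le> h" "f \<in> Lp_space 2" "g \<in> Lp_space 2" "AE x in lebesgue. f x = g x"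
  shows "dissipation h f f = dissipation h g g"
proof -
  have "L2_inner f f = L2_inner g g"
    using L2_inner_cong_AE[OF assms(4) assms(2,3,2)] L2_inner_cong_AE_right[OF assms(4) assms(2,3,3)] by simp
  moreover have "L2_inner (T h f) f = L2_inner (T h g) f"
    by (intro L2_inner_cong_AE T_cong_AE T_L2 assms)
  moreover have "\<dots> = L2_inner (T h g) g"
    by (intro L2_inner_cong_AE_right T_L2 assms)
  ultimately show ?thesis by (simp add: dissipation_def)
qed

lemma (in symmetric_markov_semigroup) T_norm_diff_le:
  assumes "0 \<le> h" "f \<in> Lp_space 2" "g \<in> Lp_space 2"
  shows "Lp_norm 2 (\<lambda>x. T h f x - T h g x) \<le> Lp_norm 2 (\<lambda>x. f x - g x)"
proof -
  have "AE x in lebesgue. T h f x - T h g x = T h (\<lambda>x. f x - g x) x"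
    using T_diff[OF assms] by eventually_elim simp
  then have "Lp_norm 2 (\<lambda>x. T h f x - T h g x) = Lp_norm 2 (T h (\<lambda>x. f x - g x))"
    by (intro L2_norm_cong_AE L2_diff T_L2 assms)
  also have "\<dots> \<le> Lp_norm 2 (\<lambda>x. f x - g x)" by (intro T_L2_contraction L2_diff assms)
  finally show ?thesis .
qed

lemma (in symmetric_markov_semigroup) dissipation_tendsto:
  assumes h: "0 \<le> h" and F: "\<And>n. F n \<in> Lp_space 2" and G: "\<And>n. G n \<in> Lp_space 2"
    and f: "f \<in> Lp_space 2" and g: "g \<in> Lp_space 2"
    and limF: "(\<lambda>n::nat. Lp_norm 2 (\<lambda>x. F n x - f x)) \<longlonglongrightarrow> 0"
    and limG: "(\<lambda>n::nat. Lp_norm 2 (\<lambda>x. G n x - g x)) \<longlonglongrightarrow> 0"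
  shows "(\<lambda>n. dissipation h (F n) (G n)) \<longlonglongrightarrow> dissipation h f g"
proof -
  have "(\<lambda>n. Lp_norm 2 (\<lambda>x. T h (F n) x - T h f x)) \<longlonglongrightarrow> 0"
    by (rule tendsto_sandwich[OF _ _ tendsto_const limF]) (auto intro!: T_norm_diff_le h F f always_eventually)
  then show ?thesis unfolding dissipation_def
    by (intro tendsto_diff L2_inner_tendsto limF limG f g T_L2 h) (auto intro!: T_L2 h F G always_eventually)
qed

locale heat_flow = symmetric_markov_semigroup T
  for T :: "real \<Rightarrow> ('a::euclidean_space \<Rightarrow> real) \<Rightarrow> 'a \<Rightarrow> real" +
  fixes D :: "('a \<Rightarrow> real) set" and A :: "('a \<Rightarrow> real) \<Rightarrow> 'a \<Rightarrow> real"
  assumes sa: "self_adjoint D A" and heat: "heat_semigroup D A T"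
begin

lemma D_L2: "z \<in> D \<Longrightarrow> z \<in> Lp_space 2" and A_L2: "z \<in> D \<Longrightarrow> A z \<in> Lp_space 2"
  using sa unfolding self_adjoint_def densely_defined_linear_operator_def by blast+

lemma D_diff: "f \<in> D \<Longrightarrow> g \<in> D \<Longrightarrow> (\<lambda>x. f x - g x) \<in> D"
proof -
  assume "f \<in> D" "g \<in> D"
  then have "(\<lambda>x. 1 * f x + (-1) * g x) \<in> D"
    using sa unfolding self_adjoint_def densely_defined_linear_operator_def by blast
  then show ?thesis by simp
qed

lemma D_dense: "f \<in> Lp_space 2 \<Longrightarrow> 0 < e \<Longrightarrow> \<exists>g\<in>D. Lp_norm 2 (\<lambda>x. f x - g x) < e"
  using sa unfolding self_adjoint_def densely_defined_linear_operator_def by blast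

lemma generator_iff:
  "f \<in> Lp_space 2 \<Longrightarrow> g \<in> Lp_space 2 \<Longrightarrow>
    (f \<in> D \<and> (AE x in lebesgue. A f x = g x)) \<longleftrightarrow>
    ((\<lambda>h. Lp_norm 2 (\<lambda>x. (T h f x - f x) / h - (- g x))) \<longlongrightarrow> 0) (at_right 0)"
  using heat unfolding heat_semigroup_def by blast

lemma generator_tendsto:
  "z \<in> D \<Longrightarrow> ((\<lambda>h. Lp_norm 2 (\<lambda>x. (T h z x - z x) / h - (- A z x))) \<longlongrightarrow> 0) (at_right 0)"
  using generator_iff[OF D_L2 A_L2] by blast

text \<open>The difference quotients at \<open>T s z\<close> are the images under \<open>T s\<close>
  of those at \<open>z\<close>, so contraction transfers their convergence, with limit
  \<open>- T s (A z)\<close>.\<close>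

lemma T_D:
  assumes z: "z \<in> D" and s: "0 \<le> s"
  shows "T s z \<in> D"
proof -
  note z2 = D_L2[OF z] and Az2 = A_L2[OF z]
  have "((\<lambda>h. Lp_norm 2 (\<lambda>x. (T h (T s z) x - T s z x) / h - (- T s (A z) x))) \<longlongrightarrow> 0) (at_right 0)"
  proof (rule tendsto_sandwich[OF _ _ tendsto_const generator_tendsto[OF z]])
    show "\<forall>\<^sub>F h in at_right 0. Lp_norm 2 (\<lambda>x. (T h (T s z) x - T s z x) / h - (- T s (A z) x))
      \<le> Lp_norm 2 (\<lambda>x. (T h z x - z x) / h - (- A z x))"
      using eventually_at_right_less[of 0]
    proof eventually_elim
      case (elim h)
      then have h: "0 \<le> h" by simp
      define k where "k = (\<lambda>x. (1 / h) * (T h z x - z x) + 1 * A z x)"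
      have k: "k \<in> Lp_space 2" unfolding k_def by (intro L2_lincomb L2_diff T_L2 h z2 Az2)
      have "AE x in lebesgue. T s k x = (1 / h) * T s (\<lambda>x. T h z x - z x) x + 1 * T s (A z) x"
        unfolding k_def by (intro T_lincomb L2_diff T_L2 h s z2 Az2)
      moreover have "AE x in lebesgue. T s (\<lambda>x. T h z x - z x) x = T s (T h z) x - T s z x"
        by (intro T_diff T_L2 h s z2)
      moreover have "AE x in lebesgue. T (s + h) z x = T s (T h z) x" by (intro T_plus h s z2)
      moreover have "AE x in lebesgue. T (h + s) z x = T h (T s z) x" by (intro T_plus h s z2)
      ultimately have "AE x in lebesgue. (T h (T s z) x - T s z x) / h - (- T s (A z) x) = T s k x"
        by eventually_elim (simp add: add.commute)
      moreover have "(\<lambda>x. (1 / h) * (T h (T s z) x - T s z x) + 1 * T s (A z) x) \<in> Lp_space 2"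
        by (intro L2_lincomb L2_diff T_L2 h s z2 Az2)
      ultimately have "Lp_norm 2 (\<lambda>x. (T h (T s z) x - T s z x) / h - (- T s (A z) x)) = Lp_norm 2 (T s k)"
        by (intro L2_norm_cong_AE T_L2 s k) simp_all
      also have "\<dots> \<le> Lp_norm 2 k" by (rule T_L2_contraction[OF s k])
      finally show ?case by (simp add: k_def)
    qed
  qed auto
  then show ?thesis using generator_iff[of "T s z" "T s (A z)"] T_L2 s z2 Az2 by blast
qed

lemma dissipation_tendsto_inner:
  assumes z: "z \<in> D" and w: "w \<in> Lp_space 2"
  shows "((\<lambda>h. dissipation h z w / h) \<longlongrightarrow> L2_inner (A z) w) (at_right 0)"
proof -
  note z2 = D_L2[OF z] and Az2 = A_L2[OF z]
  let ?F = "\<lambda>h x. (1 / h) * (z x - T h z x)"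
  have ev: "\<forall>\<^sub>F h in at_right 0. 0 \<le> h \<and> ?F h \<in> Lp_space 2"
    using eventually_at_right_less[of 0] by eventually_elim (intro conjI less_imp_le L2_scale L2_diff T_L2 z2)
  have "((\<lambda>h. L2_inner (?F h) w) \<longlongrightarrow> L2_inner (A z) w) (at_right 0)"
  proof (rule L2_inner_tendsto[OF _ _ _ _ Az2 w])
    have "(\<lambda>x. ?F h x - A z x) = (\<lambda>x. (-1) * ((T h z x - z x) / h - (- A z x)))" for h
      by (auto simp: fun_eq_iff algebra_simps diff_divide_distrib)
    then have "Lp_norm 2 (\<lambda>x. ?F h x - A z x) = Lp_norm 2 (\<lambda>x. (T h z x - z x) / h - (- A z x))" for h
      by (simp only: L2_norm_scale)
    then show "((\<lambda>h. Lp_norm 2 (\<lambda>x. ?F h x - A z x)) \<longlongrightarrow> 0) (at_right 0)"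
      using generator_tendsto[OF z] by simp
    show "((\<lambda>h. Lp_norm 2 (\<lambda>x. w x - w x)) \<longlongrightarrow> 0) (at_right 0)"
      by (simp add: Lp_norm_def)
  qed (use ev w in \<open>auto elim: eventually_mono\<close>)
  moreover have "\<forall>\<^sub>F h in at_right 0. L2_inner (?F h) w = dissipation h z w / h"
    using ev
  proof eventually_elim
    case (elim h)
    have "L2_inner (?F h) w = (1 / h) * L2_inner (\<lambda>x. z x - T h z x) w" by (rule L2_inner_scale)
    with elim show ?case by (simp add: L2_inner_diff T_L2 z2 w dissipation_def)
  qed
  ultimately show ?thesis by (rule Lim_transform_eventually)
qed

lemma dissipation_le_form:
  assumes z: "z \<in> D" and h: "0 < h"
  shows "dissipation h z z / h \<le> L2_inner (A z) z"
proof (rule tendsto_lowerbound[OF dissipation_tendsto_inner[OF z D_L2[OF z]]])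
  show "\<forall>\<^sub>F k in at_right 0. dissipation h z z / h \<le> dissipation k z z / k"
    using eventually_at_right_less[of 0] eventually_at_right_real[OF h]
    by eventually_elim (auto intro!: dissipation_quotient_antimono D_L2 z)
qed simp

section \<open>Functions with bounded form quotients\<close>

context
  fixes f :: "'a \<Rightarrow> real" and M :: real
  assumes f: "f \<in> Lp_space 2" and bound: "\<And>h. 0 < h \<Longrightarrow> dissipation h f f / h \<le> M"
begin

text \<open>The candidate for \<open>form D A f f\<close>; monotonicity of the quotients makes the
  supremum also their limit as \<open>h\<close> tends to \<open>0\<close>.\<close>

definition energy_limit :: real where
  "energy_limit = (SUP h\<in>{0<..}. dissipation h f f / h)"

lemma energy_upper: "0 < h \<Longrightarrow> dissipation h f f / h \<le> energy_limit"
  unfolding energy_limit_def by (intro cSUP_upper bdd_aboveI2[where M = M]) (auto intro: bound)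

lemma energy_limit_le: "energy_limit \<le> M"
  unfolding energy_limit_def by (intro cSUP_least bound) auto

lemma energy_limit_nonneg: "0 \<le> energy_limit"
  using energy_upper[of 1] dissipation_nonneg[of 1 f] f by simp

lemma energy_approx:
  assumes "0 < e"
  obtains k where "0 < k" "energy_limit - e < dissipation k f f / k"
proof -
  have "\<exists>k\<in>{0<..}. energy_limit - e < dissipation k f f / k"
    using assms unfolding energy_limit_def
    by (subst less_cSUP_iff[symmetric]) (auto intro!: bdd_aboveI2[where M = M] bound)
  then show ?thesis using that by auto
qed

lemma energy_tendsto: "((\<lambda>h. dissipation h f f / h) \<longlongrightarrow> energy_limit) (at_right 0)"
proof (rule order_tendstoI)
  fix a assume "a < energy_limit"
  then obtain k where k: "0 < k" "a < dissipation k f f / k"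
    using energy_approx[of "energy_limit - a"] by auto
  show "\<forall>\<^sub>F h in at_right 0. a < dissipation h f f / h"
    using eventually_at_right_real[OF k(1)]
  proof eventually_elim
    case (elim h)
    then show ?case using dissipation_quotient_antimono[OF f, of h k] k by auto
  qed
next
  fix a assume a: "energy_limit < a"
  show "\<forall>\<^sub>F h in at_right 0. dissipation h f f / h < a"
    using eventually_at_right_less[of 0] by eventually_elim (use energy_upper a in \<open>auto intro: le_less_trans\<close>)
qed

text \<open>With \<open>G x h\<close> the negative slope of
  \<open>t \<mapsto> L2_inner (T t f) f\<close> on \<open>[x, x + h]\<close>, the left side is
  \<open>h\<close> times \<open>G (2 s) h - 2 G (s + t) h + G (2 t) h\<close>. All values of
  \<open>G\<close> are at most \<open>energy_limit\<close>, and the middle one is close to it for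
  small arguments. The bound must be uniform in \<open>h\<close>, since \<open>h\<close> will tend
  to \<open>0\<close> afterwards.\<close>

lemma dissipation_smoothed_Cauchy:
  assumes e: "0 < e"
  obtains k d where "0 < k" "0 < d"
    "\<And>h s t. 0 < h \<Longrightarrow> h \<le> k \<Longrightarrow> 0 \<le> s \<Longrightarrow> s \<le> d \<Longrightarrow> 0 \<le> t \<Longrightarrow> t \<le> d \<Longrightarrow>
      dissipation h (\<lambda>x. T s f x - T t f x) (\<lambda>x. T s f x - T t f x) \<le> h * e"
proof -
  define g where "g t = L2_inner (T t f) f" for t
  define G where "G x h = (g x - g (x + h)) / h" for x h
  have G0: "G 0 h = dissipation h f f / h" for h
    by (simp add: G_def g_def dissipation_def T_0_inner f)
  have conv: "convex_on {0..} g" unfolding g_def by (rule T_inner_convex[OF f])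
  have Gmono: "G y l \<le> G x h" if "0 \<le> x" "x \<le> y" "0 < h" "0 < l" "x + h \<le> y + l" for x y h l
    using convex_on_slope_mono[OF conv that] unfolding G_def diff_divide_distrib by linarith
  \<comment> \<open>Fixing \<open>k\<close> first reduces the uniformity in \<open>h\<close> to the
    continuity of one function at \<open>0\<close>. The choice of \<open>k\<close> and the
    continuity each cost \<open>e / 4\<close>, and the middle term counts twice.\<close>
  obtain k where k: "0 < k" "energy_limit - e / 4 < G 0 k"
    using energy_approx[of "e / 4"] e G0 by auto
  have gc: "continuous_on {0..} g" unfolding g_def by (rule T_inner_continuous[OF f])
  have "continuous_on {0..} (\<lambda>x. G (2 * x) k)"
    unfolding G_def using k(1)
    by (intro continuous_intros continuous_on_compose2[OF gc]) auto
  then have "\<exists>d>0. \<forall>x\<in>{0..}. dist x 0 < d \<longrightarrow> dist (G (2 * x) k) (G (2 * 0) k) < e / 4"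
    using e unfolding continuous_on_iff by (metis atLeast_iff order_refl divide_pos_pos zero_less_numeral)
  then obtain d where d: "d > 0" "\<And>x. 0 \<le> x \<Longrightarrow> x < d \<Longrightarrow> \<bar>G (2 * x) k - G 0 k\<bar> < e / 4"
    by (auto simp: dist_real_def)
  show ?thesis
  proof (rule that[of k "d / 2"])
    fix h s t :: real assume h: "0 < h" "h \<le> k" and s: "0 \<le> s" "s \<le> d / 2" and t: "0 \<le> t" "t \<le> d / 2"
    have "dissipation h (\<lambda>x. T s f x - T t f x) (\<lambda>x. T s f x - T t f x)
      = dissipation h (T s f) (T s f) - 2 * dissipation h (T s f) (T t f) + dissipation h (T t f) (T t f)"
      using h s t f by (simp add: dissipation_diff L2_diff T_L2 dissipation_commute[of h _ "\<lambda>x. T s f x - T t f x"]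
          dissipation_commute[of h "T t f" "T s f"])
    also have "\<dots> = h * (G (s + s) h - 2 * G (s + t) h + G (t + t) h)"
    proof -
      have hG: "h * G x h = g x - g (x + h)" for x using h by (simp add: G_def)
      have "h * (G (s + s) h - 2 * G (s + t) h + G (t + t) h)
        = h * G (s + s) h - 2 * (h * G (s + t) h) + h * G (t + t) h" by (simp add: algebra_simps)
      then show ?thesis using h s t f by (simp only: hG) (simp add: dissipation_T g_def)
    qed
    also have "\<dots> \<le> h * e"
    proof (rule mult_left_mono)
      have "G (s + s) h \<le> G 0 h" "G (t + t) h \<le> G 0 h"
        by (rule Gmono; use h s t in simp)+
      moreover have "G 0 h \<le> energy_limit"
        using energy_upper[OF h(1)] by (simp add: G0)
      moreover have "G (2 * (d / 2)) k \<le> G (s + t) h"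
        by (rule Gmono) (use h s t k in auto)
      moreover have "\<bar>G (2 * (d / 2)) k - G 0 k\<bar> < e / 4"
        by (rule d(2)) (use d(1) in auto)
      then have "G (2 * (d / 2)) k > energy_limit - e / 2"
        using k(2) by linarith
      ultimately show "G (s + s) h - 2 * G (s + t) h + G (t + t) h \<le> e" by simp
    qed (use h in auto)
    finally show "dissipation h (\<lambda>x. T s f x - T t f x) (\<lambda>x. T s f x - T t f x) \<le> h * e" .
  qed (use k d in auto)
qed

text \<open>\<open>T s f\<close> is the natural approximation, but \<open>T_D\<close> places it in
  \<open>D\<close> only when \<open>f\<close> is in \<open>D\<close>. So \<open>T (s n)\<close> is
  applied to an element of \<open>D\<close> at distance less than \<open>s n\<close> from
  \<open>f\<close>. By \<open>dissipation_T_le\<close> smoothing leaves of this error a form of size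
  at most \<open>s n / 2\<close>.\<close>

lemma form_approx_exists: "\<exists>F. form_approx D A F f"
proof -
  define s where "s n = inverse (real (Suc n))" for n
  have s0: "0 < s n" "s n \<le> 1" for n by (auto simp: s_def field_simps)
  have slim: "s \<longlonglongrightarrow> 0" unfolding s_def by (rule LIMSEQ_inverse_real_of_nat)
  have "\<forall>n. \<exists>g. g \<in> D \<and> Lp_norm 2 (\<lambda>x. f x - g x) < s n"
    using D_dense[OF f s0(1)] by blast
  then obtain z where z: "\<And>n. z n \<in> D" "\<And>n. Lp_norm 2 (\<lambda>x. f x - z n x) < s n"
    by metis
  note z2 = D_L2[OF z(1)]
  have zn: "Lp_norm 2 (\<lambda>x. z n x - f x) < s n" for n
    using z(2)[of n] L2_norm_minus[of f "z n"] by simp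
  define F where "F n = T (s n) (z n)" for n
  have FD: "F n \<in> D" for n unfolding F_def by (intro T_D z less_imp_le s0)
  have "(\<lambda>n. Lp_norm 2 (\<lambda>x. F n x - f x)) \<longlonglongrightarrow> 0"
  proof (rule tendsto_sandwich[OF _ _ tendsto_const])
    have "filterlim s (at_right 0) sequentially"
      using slim s0 by (intro filterlim_at_withinI[where A = "{0<..}"] always_eventually) (auto simp: less_imp_neq[symmetric])
    then have "(\<lambda>n. Lp_norm 2 (\<lambda>x. T (s n) f x - f x)) \<longlonglongrightarrow> 0"
      using filterlim_compose[OF T_tendsto_0[OF f]] by blast
    then show "(\<lambda>n. s n + Lp_norm 2 (\<lambda>x. T (s n) f x - f x)) \<longlonglongrightarrow> 0"
      using tendsto_add[OF slim] by fastforce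
    have "Lp_norm 2 (\<lambda>x. F n x - f x) \<le> s n + Lp_norm 2 (\<lambda>x. T (s n) f x - f x)" for n
    proof -
      have s: "0 \<le> s n" using s0(1)[of n] by simp
      have "Lp_norm 2 (\<lambda>x. F n x - f x) \<le> Lp_norm 2 (\<lambda>x. F n x - T (s n) f x) + Lp_norm 2 (\<lambda>x. T (s n) f x - f x)"
        unfolding F_def by (intro L2_norm_triangle_diff T_L2 s z2 f)
      moreover have "Lp_norm 2 (\<lambda>x. F n x - T (s n) f x) \<le> Lp_norm 2 (\<lambda>x. z n x - f x)"
        unfolding F_def by (intro T_norm_diff_le s z2 f)
      ultimately show ?thesis using zn[of n] by linarith
    qed
    then show "\<forall>\<^sub>F n in sequentially. Lp_norm 2 (\<lambda>x. F n x - f x) \<le> s n + Lp_norm 2 (\<lambda>x. T (s n) f x - f x)"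
      by simp
  qed simp
  moreover have "\<exists>K. \<forall>m\<ge>K. \<forall>n\<ge>K. L2_inner (A (\<lambda>x. F m x - F n x)) (\<lambda>x. F m x - F n x) < e" if e: "e > 0" for e
  proof -
    \<comment> \<open>\<open>F m - F n\<close> is split into three terms. Two uses of
      \<open>dissipation_add_le\<close> give them the weights \<open>4\<close>, \<open>4\<close> and
      \<open>2\<close>, so \<open>e / 16\<close> each adds up to \<open>5 / 8\<close> of
      \<open>e\<close>, leaving room for the strict inequality.\<close>
    obtain k d where kd: "0 < k" "0 < d" and *:
      "\<And>h s t. 0 < h \<Longrightarrow> h \<le> k \<Longrightarrow> 0 \<le> s \<Longrightarrow> s \<le> d \<Longrightarrow> 0 \<le> t \<Longrightarrow> t \<le> d \<Longrightarrow>
      dissipation h (\<lambda>x. T s f x - T t f x) (\<lambda>x. T s f x - T t f x) \<le> h * (e / 16)"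
      using dissipation_smoothed_Cauchy[of "e / 16"] e by auto
    have "\<forall>\<^sub>F n in sequentially. s n < min d (e / 16)"
      using kd e by (intro order_tendstoD(2)[OF slim]) auto
    then obtain K where K: "\<And>n. n \<ge> K \<Longrightarrow> s n < d \<and> s n < e / 16"
      unfolding eventually_sequentially by auto
    have "L2_inner (A (\<lambda>x. F m x - F n x)) (\<lambda>x. F m x - F n x) < e" if mn: "m \<ge> K" "n \<ge> K" for m n
    proof -
      have smooth: "dissipation h (T (s i) (\<lambda>x. z i x - f x)) (T (s i) (\<lambda>x. z i x - f x)) \<le> h * (e / 16)"
        if h: "0 < h" and i: "i \<ge> K" for h i
      proof -
        have "dissipation h (T (s i) (\<lambda>x. z i x - f x)) (T (s i) (\<lambda>x. z i x - f x))
            \<le> h / (2 * s i) * L2_inner (\<lambda>x. z i x - f x) (\<lambda>x. z i x - f x)"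
          by (intro dissipation_T_le L2_diff z2 f h s0)
        also have "\<dots> \<le> h / (2 * s i) * (s i)\<^sup>2"
          unfolding Lp_norm_2_squared[symmetric]
          by (intro mult_left_mono power_mono) (use zn[of i] h s0(1)[of i] in auto)
        also have "\<dots> = h * (s i / 2)" using s0(1)[of i] by (simp add: power2_eq_square)
        also have "\<dots> \<le> h * (e / 16)"
          using K[OF i] h e s0(1)[of i] by (intro mult_left_mono) auto
        finally show ?thesis .
      qed
      have "dissipation h (\<lambda>x. F m x - F n x) (\<lambda>x. F m x - F n x) / h \<le> e * (5 / 8)" if h: "0 < h" "h \<le> k" for h
      proof -
        have nonneg: "0 \<le> h" "0 \<le> s m" "0 \<le> s n" using h s0(1)[of m] s0(1)[of n] by auto
        let ?x = "T (s m) (\<lambda>x. z m x - f x)" and ?y = "\<lambda>x. T (s m) f x - T (s n) f x"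
          and ?w = "T (s n) (\<lambda>x. z n x - f x)"
        have m: "?x \<in> Lp_space 2" "?y \<in> Lp_space 2" "?w \<in> Lp_space 2" "(\<lambda>x. (-1) * ?w x) \<in> Lp_space 2"
          by (intro T_L2 L2_diff L2_scale z2 f nonneg)+
        have "AE x in lebesgue. F m x - F n x = (?x x + ?y x) + (-1) * ?w x"
          using T_diff[OF nonneg(2) z2[of m] f] T_diff[OF nonneg(3) z2[of n] f]
          by eventually_elim (simp add: F_def)
        then have "dissipation h (\<lambda>x. F m x - F n x) (\<lambda>x. F m x - F n x)
            = dissipation h (\<lambda>x. (?x x + ?y x) + (-1) * ?w x) (\<lambda>x. (?x x + ?y x) + (-1) * ?w x)"
          by (intro dissipation_cong_AE L2_add L2_diff D_L2 FD nonneg m)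
        also have "\<dots> \<le> 2 * dissipation h (\<lambda>x. ?x x + ?y x) (\<lambda>x. ?x x + ?y x)
            + 2 * dissipation h (\<lambda>x. (-1) * ?w x) (\<lambda>x. (-1) * ?w x)"
          by (intro dissipation_add_le L2_add nonneg m)
        also have "dissipation h (\<lambda>x. (-1) * ?w x) (\<lambda>x. (-1) * ?w x) = dissipation h ?w ?w"
          using dissipation_scale_self[OF nonneg(1) m(3), of "-1"] by simp
        also have "dissipation h (\<lambda>x. ?x x + ?y x) (\<lambda>x. ?x x + ?y x) \<le> 2 * dissipation h ?x ?x + 2 * dissipation h ?y ?y"
          by (intro dissipation_add_le nonneg m)
        finally have "dissipation h (\<lambda>x. F m x - F n x) (\<lambda>x. F m x - F n x)
            \<le> 4 * dissipation h ?x ?x + 4 * dissipation h ?y ?y + 2 * dissipation h ?w ?w" by simp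
        moreover have "dissipation h ?x ?x \<le> h * (e / 16)" "dissipation h ?w ?w \<le> h * (e / 16)"
          using smooth h mn by auto
        moreover have "dissipation h ?y ?y \<le> h * (e / 16)"
          using K[OF mn(1)] K[OF mn(2)] nonneg h by (intro *) auto
        ultimately have "dissipation h (\<lambda>x. F m x - F n x) (\<lambda>x. F m x - F n x) \<le> 10 * (h * (e / 16))"
          by linarith
        then show ?thesis using h by (simp add: field_simps)
      qed
      then have "\<forall>\<^sub>F h in at_right 0. dissipation h (\<lambda>x. F m x - F n x) (\<lambda>x. F m x - F n x) / h \<le> e * (5 / 8)"
        using eventually_at_right_real[OF kd(1)] by (auto elim!: eventually_mono)
      then have "L2_inner (A (\<lambda>x. F m x - F n x)) (\<lambda>x. F m x - F n x) \<le> e * (5 / 8)"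
        by (intro tendsto_upperbound[OF dissipation_tendsto_inner]) (auto intro!: D_diff FD D_L2)
      then show ?thesis using e by simp
    qed
    then show ?thesis by blast
  qed
  ultimately have "form_approx D A F f" unfolding form_approx_def using FD by blast
  then show ?thesis by blast
qed

text \<open>The Cauchy condition bounds the quotients of \<open>F n - F m\<close> through
  \<open>dissipation_le_form\<close>; for fixed \<open>h\<close> the approximating form is
  continuous on L^2, so \<open>m\<close> can tend to infinity although \<open>f\<close> need not lie
  in \<open>D\<close>.\<close>

lemma form_approx_dissipation:
  assumes F: "form_approx D A F f" and e: "0 < e"
  obtains K where "\<And>n h. K \<le> n \<Longrightarrow> 0 < h \<Longrightarrow>
    dissipation h (\<lambda>x. F n x - f x) (\<lambda>x. F n x - f x) \<le> h * e"
proof -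
  have FD: "\<And>n. F n \<in> D" and lim: "(\<lambda>n. Lp_norm 2 (\<lambda>x. F n x - f x)) \<longlonglongrightarrow> 0"
    using F unfolding form_approx_def by auto
  note F2 = D_L2[OF FD]
  obtain K where K: "\<And>m n. m \<ge> K \<Longrightarrow> n \<ge> K \<Longrightarrow>
      L2_inner (A (\<lambda>x. F m x - F n x)) (\<lambda>x. F m x - F n x) < e"
    using F e unfolding form_approx_def by metis
  show ?thesis
  proof (rule that)
    fix n h assume n: "K \<le> n" and h: "(0::real) < h"
    have lim': "(\<lambda>m. Lp_norm 2 (\<lambda>x. (F n x - F m x) - (F n x - f x))) \<longlonglongrightarrow> 0"
      using lim by (simp add: L2_norm_minus[of f])
    have "(\<lambda>m. dissipation h (\<lambda>x. F n x - F m x) (\<lambda>x. F n x - F m x))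
        \<longlonglongrightarrow> dissipation h (\<lambda>x. F n x - f x) (\<lambda>x. F n x - f x)"
      by (rule dissipation_tendsto[OF _ _ _ _ _ lim' lim']) (use h F2 f L2_diff in auto)
    moreover have "dissipation h (\<lambda>x. F n x - F m x) (\<lambda>x. F n x - F m x) \<le> h * e" if "m \<ge> K" for m
    proof -
      have "dissipation h (\<lambda>x. F n x - F m x) (\<lambda>x. F n x - F m x) / h \<le> e"
        using dissipation_le_form[OF D_diff[OF FD[of n] FD[of m]] h] K[OF n that] by linarith
      then show ?thesis using h by (simp add: pos_divide_le_eq mult.commute)
    qed
    ultimately show "dissipation h (\<lambda>x. F n x - f x) (\<lambda>x. F n x - f x) \<le> h * e"
      by (intro LIMSEQ_le_const2) auto
  qed
qed

lemma form_approx_inner_tendsto: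
  assumes F: "form_approx D A F f" and G: "form_approx D A G f"
  shows "(\<lambda>n. L2_inner (A (F n)) (G n)) \<longlonglongrightarrow> energy_limit"
proof (rule LIMSEQ_I)
  fix r :: real assume r: "r > 0"
  let ?L = energy_limit
  \<comment> \<open>The error is split into the forms of \<open>F n - f\<close> against
    \<open>G n\<close> and of \<open>G n - f\<close> against \<open>f\<close>. The two summands
    bound, after Cauchy-Schwarz, the factors coming from \<open>G n\<close> and from
    \<open>f\<close>; \<open>e\<close> is then chosen so that
    \<open>sqrt e * C <= r / 2\<close>.\<close>
  define C where "C = sqrt (2 + 2 * ?L) + sqrt ?L"
  have C: "0 < C" using energy_limit_nonneg by (simp add: C_def add_pos_nonneg)
  define e where "e = min 1 ((r / (2 * C))\<^sup>2)"
  have e: "0 < e" "e \<le> 1" "sqrt e \<le> r / (2 * C)"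
    using C r by (auto simp: e_def intro: real_le_lsqrt)
  have FD: "F n \<in> D" "G n \<in> D" for n using F G unfolding form_approx_def by auto
  note F2 = D_L2[OF FD(1)] and G2 = D_L2[OF FD(2)]
  obtain K1 where K1: "\<And>n h. K1 \<le> n \<Longrightarrow> 0 < h \<Longrightarrow>
    dissipation h (\<lambda>x. F n x - f x) (\<lambda>x. F n x - f x) \<le> h * e"
    using form_approx_dissipation[OF F e(1)] by blast
  obtain K2 where K2: "\<And>n h. K2 \<le> n \<Longrightarrow> 0 < h \<Longrightarrow>
    dissipation h (\<lambda>x. G n x - f x) (\<lambda>x. G n x - f x) \<le> h * e"
    using form_approx_dissipation[OF G e(1)] by blast
  have "norm (L2_inner (A (F n)) (G n) - ?L) < r" if n: "n \<ge> max K1 K2" for n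
  proof -
    have "\<bar>dissipation h (F n) (G n) / h - dissipation h f f / h\<bar> \<le> r / 2" if h: "0 < h" for h
    proof -
      let ?a = "\<lambda>x. F n x - f x" and ?b = "\<lambda>x. G n x - f x"
      have h': "0 \<le> h" using h by simp
      have ab: "?a \<in> Lp_space 2" "?b \<in> Lp_space 2" by (intro L2_diff F2 G2 f)+
      have da: "sqrt (dissipation h ?a ?a) \<le> sqrt h * sqrt e" and db: "dissipation h ?b ?b \<le> h * e"
        using K1 K2 n h by (auto simp flip: real_sqrt_mult)
      have df: "dissipation h f f \<le> h * ?L" using energy_upper[OF h] h by (simp add: field_simps)
      have "dissipation h (\<lambda>x. ?b x + f x) (\<lambda>x. ?b x + f x) \<le> 2 * dissipation h ?b ?b + 2 * dissipation h f f"
        by (intro dissipation_add_le ab f h')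
      also have "\<dots> \<le> 2 * (h * e) + 2 * (h * ?L)" using db df by simp
      also have "\<dots> \<le> h * (2 + 2 * ?L)" using e h by (simp add: algebra_simps)
      finally have dG: "sqrt (dissipation h (G n) (G n)) \<le> sqrt h * sqrt (2 + 2 * ?L)"
        by (simp flip: real_sqrt_mult)
      have "dissipation h (F n) (G n) - dissipation h f f = dissipation h ?a (G n) + dissipation h ?b f"
        using h' f F2 G2 by (simp add: dissipation_diff dissipation_commute[of h "G n" f])
      moreover have "\<bar>dissipation h ?a (G n)\<bar> \<le> sqrt (dissipation h ?a ?a) * sqrt (dissipation h (G n) (G n))"
        by (intro dissipation_Cauchy_Schwarz ab G2 h')
      moreover have "\<dots> \<le> (sqrt h * sqrt e) * (sqrt h * sqrt (2 + 2 * ?L))"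
        using da dG h e by (intro mult_mono) (auto intro!: dissipation_nonneg G2)
      moreover have "\<bar>dissipation h ?b f\<bar> \<le> sqrt (dissipation h ?b ?b) * sqrt (dissipation h f f)"
        by (intro dissipation_Cauchy_Schwarz ab f h')
      moreover have "\<dots> \<le> (sqrt h * sqrt e) * (sqrt h * sqrt ?L)"
        using db df h e energy_limit_nonneg by (intro mult_mono) (auto intro!: dissipation_nonneg f simp flip: real_sqrt_mult)
      moreover have "(sqrt h * sqrt e) * (sqrt h * sqrt (2 + 2 * ?L)) + (sqrt h * sqrt e) * (sqrt h * sqrt ?L)
          = h * (sqrt e * C)"
      proof -
        have "(sqrt h * sqrt e) * (sqrt h * sqrt (2 + 2 * ?L)) + (sqrt h * sqrt e) * (sqrt h * sqrt ?L)
            = (sqrt h * sqrt h) * (sqrt e * C)"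
          unfolding C_def by (simp only: distrib_left distrib_right ac_simps)
        also have "sqrt h * sqrt h = h" using h by simp
        finally show ?thesis .
      qed
      ultimately have "\<bar>dissipation h (F n) (G n) - dissipation h f f\<bar> \<le> h * (sqrt e * C)" by linarith
      also have "\<dots> \<le> h * (r / (2 * C) * C)" using e C h by (intro mult_left_mono mult_right_mono) auto
      finally have "\<bar>dissipation h (F n) (G n) - dissipation h f f\<bar> \<le> h * (r / 2)" using C by simp
      then have "\<bar>(dissipation h (F n) (G n) - dissipation h f f) / h\<bar> \<le> r / 2"
        using h by (simp add: abs_divide field_simps)
      then show ?thesis by (simp only: diff_divide_distrib)
    qed
    then have "\<forall>\<^sub>F h in at_right 0. \<bar>dissipation h (F n) (G n) / h - dissipation h f f / h\<bar> \<le> r / 2"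
      using eventually_at_right_less[of 0] by (auto elim!: eventually_mono)
    then have "\<bar>L2_inner (A (F n)) (G n) - ?L\<bar> \<le> r / 2"
      by (intro tendsto_upperbound[OF tendsto_rabs[OF tendsto_diff[OF
              dissipation_tendsto_inner[OF FD(1) G2] energy_tendsto]]]) auto
    then show ?thesis using r by simp
  qed
  then show "\<exists>no. \<forall>n\<ge>no. norm (L2_inner (A (F n)) (G n) - ?L) < r" by blast
qed

lemma form_domain_if_bounded_dissipation: "f \<in> form_domain D A"
  using f form_approx_exists by (simp add: form_domain_def)

lemma form_le_if_bounded_dissipation: "form D A f f \<le> M"
proof -
  \<comment> \<open>Existence matters for the value as well: without an approximating sequence every
    number would satisfy the condition under \<open>THE\<close>.\<close>
  obtain F0 where F0: "form_approx D A F0 f" using form_approx_exists by blast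
  have "form D A f f = energy_limit"
    unfolding form_def
    by (rule the_equality) (use form_approx_inner_tendsto F0 LIMSEQ_unique in blast)+
  then show ?thesis using energy_limit_le by simp
qed

end

end

section \<open>The Stroock-Varopoulos inequality\<close>

text \<open>The finite Beurling-Deny decomposition: row sums carry the killing part, off-diagonal
  entries the jump part.\<close>

lemma sum_sum_polarized:
  fixes d :: "'i \<Rightarrow> 'i \<Rightarrow> real"
  assumes sym: "\<And>i j. d i j = d j i"
  shows "(\<Sum>i\<in>I. \<Sum>j\<in>I. a i * b j * d i j) =
    (\<Sum>i\<in>I. a i * b i * (\<Sum>j\<in>I. d i j)) - (\<Sum>i\<in>I. \<Sum>j\<in>I. d i j * ((a i - a j) * (b i - b j))) / 2"
proof -
  have 1: "(\<Sum>i\<in>I. \<Sum>j\<in>I. a j * b j * d i j) = (\<Sum>i\<in>I. \<Sum>j\<in>I. a i * b i * d i j)"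
    by (subst sum.swap) (simp add: sym)
  have 2: "(\<Sum>i\<in>I. \<Sum>j\<in>I. a j * b i * d i j) = (\<Sum>i\<in>I. \<Sum>j\<in>I. a i * b j * d i j)"
    by (subst sum.swap) (simp add: sym)
  have "(\<Sum>i\<in>I. \<Sum>j\<in>I. d i j * ((a i - a j) * (b i - b j))) =
      (\<Sum>i\<in>I. \<Sum>j\<in>I. a i * b i * d i j) + (\<Sum>i\<in>I. \<Sum>j\<in>I. a j * b j * d i j)
      - (\<Sum>i\<in>I. \<Sum>j\<in>I. a i * b j * d i j) - (\<Sum>i\<in>I. \<Sum>j\<in>I. a j * b i * d i j)"
    unfolding sum.distrib[symmetric] sum_subtractf[symmetric]
    by (intro sum.cong refl) (simp add: algebra_simps)
  moreover have "(\<Sum>i\<in>I. a i * b i * (\<Sum>j\<in>I. d i j)) = (\<Sum>i\<in>I. \<Sum>j\<in>I. a i * b i * d i j)"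
    by (simp add: sum_distrib_left)
  ultimately show ?thesis using 1 2 by linarith
qed

text \<open>After polarization the comparison holds term by term: \<open>comp0\<close> is multiplied
  by nonnegative row sums, \<open>comp\<close> by nonpositive entries that occur with a minus sign,
  and the diagonal differences vanish.\<close>

lemma quadratic_comparison:
  fixes d :: "'i \<Rightarrow> 'i \<Rightarrow> real"
  assumes sym: "\<And>i j. d i j = d j i"
    and off: "\<And>i j. i \<in> I \<Longrightarrow> j \<in> I \<Longrightarrow> i \<noteq> j \<Longrightarrow> d i j \<le> 0"
    and row: "\<And>i. i \<in> I \<Longrightarrow> 0 \<le> (\<Sum>j\<in>I. d i j)"
    and comp: "\<And>i j. c * (g i - g j)\<^sup>2 \<le> (a i - a j) * (b i - b j)"
    and comp0: "\<And>i. c * (g i)\<^sup>2 \<le> a i * b i"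
  shows "c * (\<Sum>i\<in>I. \<Sum>j\<in>I. g i * g j * d i j) \<le> (\<Sum>i\<in>I. \<Sum>j\<in>I. a i * b j * d i j)"
proof -
  have "c * (\<Sum>i\<in>I. g i * g i * (\<Sum>j\<in>I. d i j)) \<le> (\<Sum>i\<in>I. a i * b i * (\<Sum>j\<in>I. d i j))"
    unfolding sum_distrib_left[of c]
  proof (rule sum_mono)
    fix i assume i: "i \<in> I"
    show "c * (g i * g i * (\<Sum>j\<in>I. d i j)) \<le> a i * b i * (\<Sum>j\<in>I. d i j)"
      using mult_right_mono[OF comp0[of i] row[OF i]] by (simp add: power2_eq_square mult.assoc)
  qed
  moreover have "(\<Sum>i\<in>I. \<Sum>j\<in>I. d i j * ((a i - a j) * (b i - b j)))
      \<le> c * (\<Sum>i\<in>I. \<Sum>j\<in>I. d i j * ((g i - g j) * (g i - g j)))"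
    unfolding sum_distrib_left[of c]
  proof (intro sum_mono)
    fix i j assume ij: "i \<in> I" "j \<in> I"
    show "d i j * ((a i - a j) * (b i - b j)) \<le> c * (d i j * ((g i - g j) * (g i - g j)))"
    proof (cases "i = j")
      case False
      then show ?thesis
        using mult_left_mono_neg[OF comp[of i j] off[OF ij]] by (simp add: power2_eq_square mult_ac)
    qed simp
  qed
  ultimately show ?thesis
    unfolding sum_sum_polarized[OF sym, of g g] sum_sum_polarized[OF sym, of a b] by (simp add: right_diff_distrib)
qed

lemma L1_Linf_sum:
  assumes "finite I" "\<And>i. i \<in> I \<Longrightarrow> f i \<in> Lp_space 1 \<inter> Linf_space"
  shows "(\<lambda>x. \<Sum>i\<in>I. a i * f i x) \<in> Lp_space 1 \<inter> Linf_space"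
  using assms
proof (induction I rule: finite_induct)
  case empty
  show ?case unfolding L1_Linf_iff by (auto intro: exI[of _ 0])
next
  case (insert i I)
  then show ?case using L1_Linf_lincomb[of "f i" "\<lambda>x. \<Sum>i\<in>I. a i * f i x" "a i" 1] by simp
qed

context symmetric_markov_semigroup
begin

lemma dissipation_sum:
  assumes "finite I" "\<And>i. i \<in> I \<Longrightarrow> f i \<in> Lp_space 1 \<inter> Linf_space" "g \<in> Lp_space 2" "0 \<le> h"
  shows "dissipation h (\<lambda>x. \<Sum>i\<in>I. a i * f i x) g = (\<Sum>i\<in>I. a i * dissipation h (f i) g)"
  using assms
proof (induction I rule: finite_induct)
  case empty
  have "dissipation h (\<lambda>x. 0 * g x) g = 0" using empty by (simp only: dissipation_scale)
  then show ?case by simp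
next
  case (insert i I)
  have m: "f i \<in> Lp_space 2" "(\<lambda>x. \<Sum>i\<in>I. a i * f i x) \<in> Lp_space 2"
    using insert by (auto intro!: L1_Linf_imp_L2 L1_Linf_sum simp del: Int_iff)
  have "dissipation h (\<lambda>x. \<Sum>i\<in>insert i I. a i * f i x) g = dissipation h (\<lambda>x. a i * f i x + (\<Sum>i\<in>I. a i * f i x)) g"
    using insert by simp
  also have "\<dots> = a i * dissipation h (f i) g + dissipation h (\<lambda>x. \<Sum>i\<in>I. a i * f i x) g"
    using insert m by (simp add: dissipation_add dissipation_scale L2_scale)
  finally show ?case using insert by simp
qed

lemma dissipation_sum_sum:
  assumes I: "finite I" "\<And>i. i \<in> I \<Longrightarrow> f i \<in> Lp_space 1 \<inter> Linf_space" and h: "0 \<le> h"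
  shows "dissipation h (\<lambda>x. \<Sum>i\<in>I. a i * f i x) (\<lambda>x. \<Sum>i\<in>I. b i * f i x) =
    (\<Sum>i\<in>I. \<Sum>j\<in>I. a i * b j * dissipation h (f i) (f j))"
proof -
  have f2: "f i \<in> Lp_space 2" if "i \<in> I" for i using I(2)[OF that] by (rule L1_Linf_imp_L2)
  have S: "(\<lambda>x. \<Sum>i\<in>I. b i * f i x) \<in> Lp_space 2" by (intro L1_Linf_imp_L2 L1_Linf_sum I)
  have "dissipation h (f i) (\<lambda>x. \<Sum>i\<in>I. b i * f i x) = (\<Sum>j\<in>I. b j * dissipation h (f i) (f j))" if i: "i \<in> I" for i
  proof -
    have "dissipation h (f i) (\<lambda>x. \<Sum>i\<in>I. b i * f i x) = dissipation h (\<lambda>x. \<Sum>i\<in>I. b i * f i x) (f i)"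
      by (intro dissipation_commute h f2 i S)
    also have "\<dots> = (\<Sum>j\<in>I. b j * dissipation h (f j) (f i))"
      by (intro dissipation_sum I f2 i h)
    also have "\<dots> = (\<Sum>j\<in>I. b j * dissipation h (f i) (f j))"
      using h f2 i by (intro sum.cong refl) (simp add: dissipation_commute)
    finally show ?thesis .
  qed
  then show ?thesis
    by (simp add: dissipation_sum[OF I S h] sum_distrib_left mult.assoc)
qed

text \<open>The matrix is the approximating form on indicators. Off the diagonal it is nonpositive
  because the sets are disjoint and \<open>T h\<close> preserves positivity. A row sum integrates
  \<open>u - T h u\<close> over \<open>E i\<close>, where \<open>u\<close> is the indicator of the
  union, and there \<open>u = 1\<close> while \<open>T h u <= 1\<close>.\<close>

lemma dissipation_simple_comparison:
  fixes E :: "nat \<Rightarrow> 'a set"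
  assumes I: "finite I" and E: "\<And>i. indicat_real (E i) \<in> Lp_space 1 \<inter> Linf_space"
    and disj: "\<And>i j. i \<noteq> j \<Longrightarrow> E i \<inter> E j = {}"
    and h: "0 \<le> h"
    and comp: "\<And>i j. c * (g i - g j)\<^sup>2 \<le> (a i - a j) * (b i - b j)"
    and comp0: "\<And>i. c * (g i)\<^sup>2 \<le> a i * b i"
  shows "c * dissipation h (\<lambda>x. \<Sum>i\<in>I. g i * indicator (E i) x) (\<lambda>x. \<Sum>i\<in>I. g i * indicator (E i) x)
    \<le> dissipation h (\<lambda>x. \<Sum>i\<in>I. a i * indicator (E i) x) (\<lambda>x. \<Sum>i\<in>I. b i * indicator (E i) x)"
  unfolding dissipation_sum_sum[OF I E h]
proof (rule quadratic_comparison[OF _ _ _ comp comp0])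
  note E2 = L1_Linf_imp_L2[OF E]
  show "dissipation h (indicat_real (E i)) (indicat_real (E j)) = dissipation h (indicat_real (E j)) (indicat_real (E i))" for i j
    by (intro dissipation_commute h E2)
  show "dissipation h (indicat_real (E i)) (indicat_real (E j)) \<le> 0" if "i \<noteq> j" for i j
  proof -
    have eq: "(\<lambda>x. indicat_real (E i) x * indicat_real (E j) x) = (\<lambda>x. 0)"
      using disj[OF that] by (auto simp: indicator_def fun_eq_iff)
    have "L2_inner (indicat_real (E i)) (indicat_real (E j)) = 0" unfolding L2_inner_def eq by simp
    moreover have "0 \<le> L2_inner (T h (indicat_real (E i))) (indicat_real (E j))"
      unfolding L2_inner_def
    proof (rule integral_nonneg_AE)
      have "AE x in lebesgue. 0 \<le> T h (indicat_real (E i)) x" by (rule T_nonneg[OF h E]) simp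
      then show "AE x in lebesgue. 0 \<le> T h (indicat_real (E i)) x * indicat_real (E j) x"
        by eventually_elim simp
    qed
    ultimately show ?thesis by (simp add: dissipation_def)
  qed
  fix i assume i: "i \<in> I"
  define u where "u = (\<lambda>x. \<Sum>j\<in>I. 1 * indicat_real (E j) x)"
  have u: "u \<in> Lp_space 1 \<inter> Linf_space" unfolding u_def by (intro L1_Linf_sum I E)
  note u2 = L1_Linf_imp_L2[OF u]
  have u1: "u x \<le> 1" "x \<in> E i \<Longrightarrow> u x = 1" for x
  proof -
    have *: "u x = 1" if "j \<in> I" "x \<in> E j" for j
    proof -
      have "indicat_real (E k) x = (if k = j then 1 else 0)" for k
        using disj[of k j] that by (auto simp: indicator_def)
      then show ?thesis using that I by (simp add: u_def)
    qed
    then show "x \<in> E i \<Longrightarrow> u x = 1" using i by blast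
    show "u x \<le> 1"
    proof (cases "\<exists>j\<in>I. x \<in> E j")
      case False
      then have "u x = 0" unfolding u_def by (intro sum.neutral) auto
      then show ?thesis by simp
    qed (use * in auto)
  qed
  have "(\<Sum>j\<in>I. dissipation h (indicat_real (E i)) (indicat_real (E j))) = dissipation h u (indicat_real (E i))"
    unfolding u_def dissipation_sum[OF I E E2 h] using h E2 by (simp add: dissipation_commute)
  also have "\<dots> = L2_inner (\<lambda>x. u x - T h u x) (indicat_real (E i))"
    using h u2 E2 by (simp add: dissipation_def L2_inner_diff T_L2)
  also have "\<dots> \<ge> 0"
    unfolding L2_inner_def
  proof (rule integral_nonneg_AE)
    have "AE x in lebesgue. T h u x \<le> 1" by (rule T_le_const[OF h u]) (use u1 in auto)
    then show "AE x in lebesgue. 0 \<le> (u x - T h u x) * indicat_real (E i) x"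
      by eventually_elim (use u1(2) in \<open>auto simp: indicator_def\<close>)
  qed
  finally show "0 \<le> (\<Sum>j\<in>I. dissipation h (indicat_real (E i)) (indicat_real (E j)))" .
qed

end

section \<open>Convex energies and locally Lipschitz functions of the solution\<close>

lemma continuous_on_if_Lipschitz_on_intervals:
  fixes g :: "real \<Rightarrow> real"
  assumes "\<And>M. 0 \<le> M \<Longrightarrow> \<exists>L\<ge>0. \<forall>a\<in>{0..M}. \<forall>b\<in>{0..M}. \<bar>g a - g b\<bar> \<le> L * \<bar>a - b\<bar>"
  shows "continuous_on {0..} g"
  unfolding continuous_on_iff
proof (intro ballI allI impI)
  fix x e :: real assume x: "x \<in> {0..}" and e: "0 < e"
  then obtain L where L: "L \<ge> 0" "\<And>a b. a \<in> {0..x + 1} \<Longrightarrow> b \<in> {0..x + 1} \<Longrightarrow> \<bar>g a - g b\<bar> \<le> L * \<bar>a - b\<bar>"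
    using assms[of "x + 1"] by auto
  have "dist (g y) (g x) < e" if y: "y \<in> {0..}" "dist y x < min 1 (e / (L + 1))" for y
  proof -
    have "\<bar>g y - g x\<bar> \<le> L * \<bar>y - x\<bar>" using x y by (intro L(2)) (auto simp: dist_real_def)
    also have "\<dots> \<le> (L + 1) * \<bar>y - x\<bar>" by (intro mult_right_mono) auto
    also have "\<dots> < (L + 1) * (e / (L + 1))"
      using y L(1) by (intro mult_strict_left_mono) (auto simp: dist_real_def)
    finally show ?thesis using L(1) by (simp add: dist_real_def)
  qed
  then show "\<exists>d>0. \<forall>x'\<in>{0..}. dist x' x < d \<longrightarrow> dist (g x') (g x) < e"
    using e L(1) by (intro exI[of _ "min 1 (e / (L + 1))"]) auto
qed

text \<open>As \<open>g\<close> vanishes at \<open>0\<close> and \<open>f\<close> is bounded,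
  \<open>|g (f x)| <= L * |f x|\<close>, which keeps both integrability and boundedness.\<close>

lemma L1_Linf_comp_Lipschitz:
  assumes f: "f \<in> Lp_space 1 \<inter> Linf_space" and nonneg: "AE x in lebesgue. 0 \<le> f x"
    and g: "g \<in> borel_measurable borel" "g 0 = 0"
    and Lip: "\<And>M. 0 \<le> M \<Longrightarrow> \<exists>L\<ge>0. \<forall>a\<in>{0..M}. \<forall>b\<in>{0..M}. \<bar>g a - g b\<bar> \<le> L * \<bar>a - b\<bar>"
  shows "(\<lambda>x. g (f x)) \<in> Lp_space 1 \<inter> Linf_space"
proof -
  obtain M where M: "AE x in lebesgue. \<bar>f x\<bar> \<le> M" using f unfolding L1_Linf_iff by auto
  obtain L where L: "\<And>a b. a \<in> {0..max M 0} \<Longrightarrow> b \<in> {0..max M 0} \<Longrightarrow> \<bar>g a - g b\<bar> \<le> L * \<bar>a - b\<bar>"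
    using Lip[of "max M 0"] by fastforce
  show ?thesis
  proof (rule L1_Linf_dominated[OF f, where C = L])
    show "(\<lambda>x. g (f x)) \<in> borel_measurable lebesgue"
      using g(1) L1_Linf_measurable[OF f] by measurable
    show "AE x in lebesgue. \<bar>g (f x)\<bar> \<le> L * \<bar>f x\<bar>"
      using nonneg M
    proof eventually_elim
      case (elim x)
      then show ?case using L[of "f x" 0] g(2) by auto
    qed
  qed
qed

text \<open>The derivative relations are encoded by increments: \<open>tangent\<close> says that
  \<open>F\<close> is a subgradient of \<open>\<Phi>\<close>, and \<open>comparison\<close> is the
  integrated form of \<open>c (\<psi>')^2 <= F'\<close>. The Lipschitz condition on \<open>F\<close>
  makes the error of linearizing the energy quadratic.\<close>

locale energy_functions =
  fixes \<Phi> F \<psi> :: "real \<Rightarrow> real" and c :: real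
  assumes tangent: "\<And>a b. 0 \<le> a \<Longrightarrow> 0 \<le> b \<Longrightarrow> \<Phi> a + F a * (b - a) \<le> \<Phi> b"
    and zero: "\<Phi> 0 = 0" "F 0 = 0" "\<psi> 0 = 0"
    and F_Lipschitz: "\<And>M. 0 \<le> M \<Longrightarrow> \<exists>L\<ge>0. \<forall>a\<in>{0..M}. \<forall>b\<in>{0..M}. \<bar>F a - F b\<bar> \<le> L * \<bar>a - b\<bar>"
    and \<psi>_Lipschitz: "\<And>M. 0 \<le> M \<Longrightarrow> \<exists>L\<ge>0. \<forall>a\<in>{0..M}. \<forall>b\<in>{0..M}. \<bar>\<psi> a - \<psi> b\<bar> \<le> L * \<bar>a - b\<bar>"
    and c_pos: "0 < c"
    and comparison: "\<And>a b. 0 \<le> a \<Longrightarrow> 0 \<le> b \<Longrightarrow> c * (\<psi> a - \<psi> b)\<^sup>2 \<le> (a - b) * (F a - F b)"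
    and measurable_functions: "\<Phi> \<in> borel_measurable borel" "F \<in> borel_measurable borel" "\<psi> \<in> borel_measurable borel"
begin

lemma \<Phi>_nonneg: "0 \<le> a \<Longrightarrow> 0 \<le> \<Phi> a"
  using tangent[of 0 a] zero by simp

lemma \<Phi>_Lipschitz:
  assumes M: "0 \<le> M"
  shows "\<exists>L\<ge>0. \<forall>a\<in>{0..M}. \<forall>b\<in>{0..M}. \<bar>\<Phi> a - \<Phi> b\<bar> \<le> L * \<bar>a - b\<bar>"
proof -
  obtain L where L: "L \<ge> 0" "\<And>a b. a \<in> {0..M} \<Longrightarrow> b \<in> {0..M} \<Longrightarrow> \<bar>F a - F b\<bar> \<le> L * \<bar>a - b\<bar>"
    using F_Lipschitz[OF M] by blast
  have F: "\<bar>F a\<bar> \<le> L * M" if "a \<in> {0..M}" for a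
  proof -
    have "\<bar>F a\<bar> \<le> L * a" using L(2)[OF that, of 0] zero that by auto
    also have "\<dots> \<le> L * M" using L(1) that by (intro mult_left_mono) auto
    finally show ?thesis .
  qed
  have "\<Phi> a - \<Phi> b \<le> L * M * \<bar>a - b\<bar>" if ab: "a \<in> {0..M}" "b \<in> {0..M}" for a b
  proof -
    have "\<Phi> a - \<Phi> b \<le> F a * (a - b)" using tangent[of a b] ab by (simp add: algebra_simps)
    also have "\<dots> \<le> \<bar>F a\<bar> * \<bar>a - b\<bar>" by (metis abs_ge_self abs_mult)
    also have "\<dots> \<le> L * M * \<bar>a - b\<bar>" using F[OF ab(1)] by (intro mult_right_mono) auto
    finally show ?thesis .
  qed
  then have "\<bar>\<Phi> a - \<Phi> b\<bar> \<le> L * M * \<bar>a - b\<bar>" if "a \<in> {0..M}" "b \<in> {0..M}" for a b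
    using that abs_minus_commute[of a b] by (metis abs_le_iff minus_diff_eq)
  then show ?thesis using L(1) M by (intro exI[of _ "L * M"]) auto
qed

lemmas \<Phi>_continuous = continuous_on_if_Lipschitz_on_intervals[OF \<Phi>_Lipschitz]
  and F_continuous = continuous_on_if_Lipschitz_on_intervals[OF F_Lipschitz]
  and \<psi>_continuous = continuous_on_if_Lipschitz_on_intervals[OF \<psi>_Lipschitz]

lemmas \<Phi>_comp = L1_Linf_comp_Lipschitz[OF _ _ measurable_functions(1) zero(1) \<Phi>_Lipschitz]
  and F_comp = L1_Linf_comp_Lipschitz[OF _ _ measurable_functions(2) zero(2) F_Lipschitz]
  and \<psi>_comp = L1_Linf_comp_Lipschitz[OF _ _ measurable_functions(3) zero(3) \<psi>_Lipschitz]

end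

locale markov_energy = symmetric_markov_semigroup T + energy_functions \<Phi> F \<psi> c
  for T :: "real \<Rightarrow> ('a::euclidean_space \<Rightarrow> real) \<Rightarrow> 'a \<Rightarrow> real" and \<Phi> F \<psi> c
begin

text \<open>The Stroock-Varopoulos inequality. For functions with finitely many values it is a
  statement about a symmetric matrix with nonpositive off-diagonal entries and nonnegative row
  sums; the general case follows by rounding the values down.\<close>

lemma dissipation_comparison:
  assumes f: "f \<in> Lp_space 1 \<inter> Linf_space" and nonneg: "AE x in lebesgue. 0 \<le> f x" and h: "0 \<le> h"
  shows "c * dissipation h (\<lambda>x. \<psi> (f x)) (\<lambda>x. \<psi> (f x)) \<le> dissipation h f (\<lambda>x. F (f x))"
proof -
  obtain M where "AE x in lebesgue. \<bar>f x\<bar> \<le> M" using f unfolding L1_Linf_iff by auto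
  with nonneg have fM: "AE x in lebesgue. 0 \<le> f x \<and> f x \<le> M" by eventually_elim auto
  have [measurable]: "f \<in> borel_measurable lebesgue" by (rule L1_Linf_measurable[OF f])
  \<comment> \<open>The level \<open>k = 0\<close> is left out because that set may have infinite
    measure; all functions to be approximated vanish at \<open>0\<close>, so nothing is lost
    there.\<close>
  define E where "E n k = {x. 0 < k \<and> real k \<le> f x * real (Suc n) \<and> f x * real (Suc n) < real k + 1}" for n k :: nat
  have Emeas: "E n k \<in> sets lebesgue" for n k
  proof -
    have "E n k = {x \<in> space lebesgue. 0 < k \<and> real k \<le> f x * real (Suc n) \<and> f x * real (Suc n) < real k + 1}"
      by (simp add: E_def)
    also have "\<dots> \<in> sets lebesgue" by measurable
    finally show ?thesis .
  qed
  have E: "indicat_real (E n k) \<in> Lp_space 1 \<inter> Linf_space" for n k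
  proof (rule L1_Linf_dominated[OF f, where C = "real (Suc n)"])
    show "indicat_real (E n k) \<in> borel_measurable lebesgue" using Emeas by measurable
    have "\<bar>indicat_real (E n k) x\<bar> \<le> real (Suc n) * \<bar>f x\<bar>" for x
    proof (cases "x \<in> E n k")
      case True
      then have "1 \<le> f x * real (Suc n)" by (simp add: E_def)
      also have "\<dots> \<le> real (Suc n) * \<bar>f x\<bar>" by (simp add: mult.commute mult_left_mono)
      finally show ?thesis by (simp add: indicator_def)
    qed (simp add: indicator_def)
    then show "AE x in lebesgue. \<bar>indicat_real (E n k) x\<bar> \<le> real (Suc n) * \<bar>f x\<bar>" by simp
  qed
  have disj: "E n i \<inter> E n j = {}" if "i \<noteq> j" for n i j
    using that by (fastforce simp: E_def)
  define I where "I n = {1..nat \<lceil>M * real (Suc n)\<rceil>}" for n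
  define S where "S g n x = (\<Sum>k\<in>I n. g (real k / real (Suc n)) * indicat_real (E n k) x)" for g :: "real \<Rightarrow> real" and n x
  have SX: "S g n \<in> Lp_space 1 \<inter> Linf_space" for g n
    unfolding S_def by (intro L1_Linf_sum E) (simp add: I_def)
  define r where "r n y = real (nat \<lfloor>y * real (Suc n)\<rfloor>) / real (Suc n)" for n and y :: real
  have r: "0 \<le> r n y \<and> r n y \<le> y \<and> y - r n y \<le> inverse (real (Suc n))" if y: "0 \<le> y" for n y
  proof -
    have "0 \<le> y * real (Suc n)" using y by simp
    then have "real (nat \<lfloor>y * real (Suc n)\<rfloor>) \<le> y * real (Suc n)" "y * real (Suc n) \<le> real (nat \<lfloor>y * real (Suc n)\<rfloor>) + 1"
      by linarith+
    then have "r n y \<le> y" "y \<le> (real (nat \<lfloor>y * real (Suc n)\<rfloor>) + 1) / real (Suc n)"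
      unfolding r_def by (simp_all only: pos_divide_le_eq pos_le_divide_eq of_nat_0_less_iff zero_less_Suc)
    then show ?thesis by (auto simp: r_def add_divide_distrib inverse_eq_divide)
  qed
  have S_eq: "S g n x = g (r n (f x))" if g: "g 0 = 0" and x: "0 \<le> f x" "f x \<le> M" for g n x
  proof -
    define m where "m = nat \<lfloor>f x * real (Suc n)\<rfloor>"
    have pos: "0 \<le> f x * real (Suc n)" using x by simp
    then have "x \<in> E n k \<longleftrightarrow> 0 < k \<and> k = m" for k
      unfolding E_def m_def by (auto; linarith)
    then have "S g n x = (\<Sum>k\<in>I n. if k = m then g (real m / real (Suc n)) else 0)"
      unfolding S_def by (intro sum.cong refl) (auto simp: I_def indicator_def)
    also have "\<dots> = (if m \<in> I n then g (real m / real (Suc n)) else 0)"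
      by (simp add: I_def)
    also have "\<dots> = g (real m / real (Suc n))"
    proof -
      have "f x * real (Suc n) \<le> M * real (Suc n)" using x by (intro mult_right_mono) auto
      then have "m \<le> nat \<lceil>M * real (Suc n)\<rceil>" unfolding m_def by linarith
      then show ?thesis using g by (cases "m = 0") (auto simp: I_def)
    qed
    finally show ?thesis by (simp add: r_def m_def)
  qed
  have lim: "(\<lambda>n. Lp_norm 2 (\<lambda>x. S g n x - g (f x))) \<longlonglongrightarrow> 0" and gX: "(\<lambda>x. g (f x)) \<in> Lp_space 1 \<inter> Linf_space"
    if g: "g \<in> borel_measurable borel" "g 0 = 0"
    and Lip: "\<And>M. 0 \<le> M \<Longrightarrow> \<exists>L\<ge>0. \<forall>a\<in>{0..M}. \<forall>b\<in>{0..M}. \<bar>g a - g b\<bar> \<le> L * \<bar>a - b\<bar>" for g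
  proof -
    show gX: "(\<lambda>x. g (f x)) \<in> Lp_space 1 \<inter> Linf_space"
      by (rule L1_Linf_comp_Lipschitz[OF f nonneg g Lip])
    obtain L where L: "L \<ge> 0" "\<And>a b. a \<in> {0..max M 0} \<Longrightarrow> b \<in> {0..max M 0} \<Longrightarrow> \<bar>g a - g b\<bar> \<le> L * \<bar>a - b\<bar>"
      using Lip[of "max M 0"] by auto
    have le: "\<bar>S g n x - g (f x)\<bar> \<le> L * (f x - r n (f x))" if x: "0 \<le> f x" "f x \<le> M" for n x
      unfolding S_eq[of g, OF g(2) x] using L(2)[of "r n (f x)" "f x"] r[OF x(1), of n] x by auto
    show "(\<lambda>n. Lp_norm 2 (\<lambda>x. S g n x - g (f x))) \<longlonglongrightarrow> 0"
    proof (rule L2_norm_tendsto_0_dominated[OF L1_Linf_imp_L2[OF gX] L2_scale[OF L1_Linf_imp_L2[OF f]]])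
      show "S g n \<in> borel_measurable lebesgue" for n by (rule L1_Linf_measurable[OF SX])
      show "AE x in lebesgue. (\<lambda>n. S g n x) \<longlonglongrightarrow> g (f x)"
        using fM
      proof eventually_elim
        case (elim x)
        have "(\<lambda>n. S g n x - g (f x)) \<longlonglongrightarrow> 0"
        proof (rule Lim_null_comparison)
          show "(\<lambda>n. L * inverse (real (Suc n))) \<longlonglongrightarrow> 0"
            using tendsto_mult_right_zero[OF LIMSEQ_inverse_real_of_nat] by simp
          have "\<bar>S g n x - g (f x)\<bar> \<le> L * inverse (real (Suc n))" for n
          proof -
            have "L * (f x - r n (f x)) \<le> L * inverse (real (Suc n))"
              using r[of "f x" n] elim L(1) by (intro mult_left_mono) auto
            then show ?thesis using le[of x n] elim by linarith
          qed
          then show "\<forall>\<^sub>F n in sequentially. norm (S g n x - g (f x)) \<le> L * inverse (real (Suc n))" by simp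
        qed
        then show ?case by (simp add: LIM_zero_iff)
      qed
      show "AE x in lebesgue. \<bar>S g n x - g (f x)\<bar> \<le> \<bar>L * f x\<bar>" for n
        using fM
      proof eventually_elim
        case (elim x)
        have "L * (f x - r n (f x)) \<le> L * f x"
          using r[of "f x" n] elim L(1) by (intro mult_left_mono) auto
        moreover have "L * f x \<le> \<bar>L * f x\<bar>" by simp
        ultimately show ?case using le[of x n] elim by linarith
      qed
    qed
  qed
  have id: "\<exists>L\<ge>0. \<forall>a\<in>{0..M}. \<forall>b\<in>{0..M}. \<bar>a - b\<bar> \<le> L * \<bar>a - b\<bar>" for M :: real
    by (rule exI[of _ 1]) auto
  have lim_id: "(\<lambda>n. Lp_norm 2 (\<lambda>x. S (\<lambda>a. a) n x - f x)) \<longlonglongrightarrow> 0"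
    by (rule lim[of "\<lambda>a. a", OF _ _ id]) auto
  note lim_F = lim[of F, OF measurable_functions(2) zero(2) F_Lipschitz]
  note lim_\<psi> = lim[of \<psi>, OF measurable_functions(3) zero(3) \<psi>_Lipschitz]
  note F2 = L1_Linf_imp_L2[OF F_comp[OF f nonneg]] and \<psi>2 = L1_Linf_imp_L2[OF \<psi>_comp[OF f nonneg]]
    and f2 = L1_Linf_imp_L2[OF f] and S2 = L1_Linf_imp_L2[OF SX]
  have "(\<lambda>n. c * dissipation h (S \<psi> n) (S \<psi> n)) \<longlonglongrightarrow> c * dissipation h (\<lambda>x. \<psi> (f x)) (\<lambda>x. \<psi> (f x))"
    by (intro tendsto_mult tendsto_const dissipation_tendsto h S2 \<psi>2 lim_\<psi>)
  moreover have "(\<lambda>n. dissipation h (S (\<lambda>a. a) n) (S F n)) \<longlonglongrightarrow> dissipation h f (\<lambda>x. F (f x))"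
    by (intro dissipation_tendsto h S2 f2 F2 lim_F lim_id)
  moreover have "c * dissipation h (S \<psi> n) (S \<psi> n) \<le> dissipation h (S (\<lambda>a. a) n) (S F n)" for n
    unfolding S_def
  proof (rule dissipation_simple_comparison[OF _ E disj h])
    show "c * (\<psi> (real i / real (Suc n)) - \<psi> (real j / real (Suc n)))\<^sup>2
      \<le> (real i / real (Suc n) - real j / real (Suc n)) * (F (real i / real (Suc n)) - F (real j / real (Suc n)))" for i j
      by (rule comparison) auto
    show "c * (\<psi> (real i / real (Suc n)))\<^sup>2 \<le> real i / real (Suc n) * F (real i / real (Suc n))" for i
      using comparison[of "real i / real (Suc n)" 0] zero by simp
  qed (simp add: I_def)
  ultimately show ?thesis by (intro LIMSEQ_le) auto
qed

end

section \<open>Decay of the energy\<close>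

context markov_energy
begin

context
  fixes v :: "'a \<Rightarrow> real"
  assumes v: "v \<in> Lp_space 1 \<inter> Linf_space" and v_nonneg: "AE x in lebesgue. 0 \<le> v x"
begin

definition energy :: "real \<Rightarrow> real" where
  "energy t = (LINT x|lebesgue. \<Phi> (T t v x))"

lemma flow_L1_Linf: "0 \<le> t \<Longrightarrow> T t v \<in> Lp_space 1 \<inter> Linf_space"
  by (rule T_L1_Linf[OF _ v])

lemma flow_nonneg: "0 \<le> t \<Longrightarrow> AE x in lebesgue. 0 \<le> T t v x"
  by (rule T_nonneg[OF _ v v_nonneg])

lemmas flow_L2 = L1_Linf_imp_L2[OF flow_L1_Linf]

lemma flow_\<Phi>: "0 \<le> t \<Longrightarrow> (\<lambda>x. \<Phi> (T t v x)) \<in> Lp_space 1 \<inter> Linf_space"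
  by (intro \<Phi>_comp flow_L1_Linf flow_nonneg)

lemma energy_nonneg: "0 \<le> t \<Longrightarrow> 0 \<le> energy t"
proof -
  assume t: "0 \<le> t"
  have "AE x in lebesgue. 0 \<le> \<Phi> (T t v x)"
    using flow_nonneg[OF t] by eventually_elim (rule \<Phi>_nonneg)
  then show ?thesis unfolding energy_def by (rule integral_nonneg_AE)
qed

lemma energy_le_initial:
  assumes t: "0 \<le> t"
  shows "energy t \<le> (LINT x|lebesgue. \<Phi> (v x))"
  unfolding energy_def
  by (rule T_integral_convex_le[OF t v v_nonneg tangent zero(1,2) \<Phi>_continuous F_continuous \<Phi>_comp[OF v v_nonneg] flow_\<Phi>[OF t]])

lemma energy_antimono:
  assumes "0 \<le> t" "0 \<le> h"
  shows "energy (t + h) \<le> energy t"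
proof -
  have TT: "T h (T t v) \<in> Lp_space 1 \<inter> Linf_space" by (intro T_L1_Linf flow_L1_Linf assms)
  have TTn: "AE x in lebesgue. 0 \<le> T h (T t v) x" by (intro T_nonneg flow_L1_Linf flow_nonneg assms)
  have \<Phi>TT: "(\<lambda>x. \<Phi> (T h (T t v) x)) \<in> Lp_space 1 \<inter> Linf_space" by (intro \<Phi>_comp TT TTn)
  have "energy (h + t) = (LINT x|lebesgue. \<Phi> (T h (T t v) x))"
    unfolding energy_def
  proof (rule integral_cong_AE)
    show "AE x in lebesgue. \<Phi> (T (h + t) v x) = \<Phi> (T h (T t v) x)"
      using T_plus[OF assms(2,1) L1_Linf_imp_L2[OF v]] by eventually_elim simp
  qed (use L1_Linf_measurable[OF \<Phi>TT] L1_Linf_measurable[OF flow_\<Phi>[of "h + t"]] assms in auto)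
  also have "\<dots> \<le> energy t" unfolding energy_def
    by (rule T_integral_convex_le[OF assms(2) flow_L1_Linf[OF assms(1)] flow_nonneg[OF assms(1)] tangent
          zero(1,2) \<Phi>_continuous F_continuous flow_\<Phi>[OF assms(1)] \<Phi>TT])
  finally show ?thesis by (simp add: add.commute)
qed

text \<open>The flow stays between \<open>0\<close> and an upper bound of \<open>v\<close>, so a
  single Lipschitz constant of \<open>F\<close> serves all times.\<close>

lemma F_bound:
  obtains L where "0 \<le> L"
    "\<And>s t. 0 \<le> s \<Longrightarrow> 0 \<le> t \<Longrightarrow> AE x in lebesgue. \<bar>F (T s v x) - F (T t v x)\<bar> \<le> L * \<bar>T s v x - T t v x\<bar>"
    "\<And>t. 0 \<le> t \<Longrightarrow> AE x in lebesgue. \<bar>F (T t v x)\<bar> \<le> L * \<bar>T t v x\<bar>"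
proof -
  obtain M where "AE x in lebesgue. \<bar>v x\<bar> \<le> M" using v unfolding L1_Linf_iff by auto
  with v_nonneg have "AE x in lebesgue. 0 \<le> v x \<and> v x \<le> max M 0" by eventually_elim auto
  then have b: "AE x in lebesgue. 0 \<le> T t v x \<and> T t v x \<le> max M 0" if "0 \<le> t" for t
    by (intro T_between that L1_Linf_imp_L2 v)
  obtain L where L: "L \<ge> 0" "\<And>a b. a \<in> {0..max M 0} \<Longrightarrow> b \<in> {0..max M 0} \<Longrightarrow> \<bar>F a - F b\<bar> \<le> L * \<bar>a - b\<bar>"
    using F_Lipschitz[of "max M 0"] by auto
  show ?thesis
  proof (rule that[OF L(1)])
    show "AE x in lebesgue. \<bar>F (T s v x) - F (T t v x)\<bar> \<le> L * \<bar>T s v x - T t v x\<bar>" if "0 \<le> s" "0 \<le> t" for s t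
      using b[OF that(1)] b[OF that(2)] by eventually_elim (rule L(2); simp)
    show "AE x in lebesgue. \<bar>F (T t v x)\<bar> \<le> L * \<bar>T t v x\<bar>" if "0 \<le> t" for t
      using b[OF that]
    proof eventually_elim
      case (elim x)
      then show ?case using L(2)[of "T t v x" 0] zero by simp
    qed
  qed
qed

text \<open>With \<open>u\<close> and \<open>u'\<close> the solution at \<open>t\<close> and
  \<open>t + h\<close>, the tangent at \<open>u'\<close> gives
  \<open>\<Phi> u - \<Phi> u' >= F u' (u - u')\<close>. Replacing \<open>F u'\<close> by
  \<open>F u\<close> costs \<open>L (u - u')^2\<close>, which is of order \<open>h^2\<close> by
  \<open>T_increment\<close>; what remains integrates to \<open>dissipation h u (F u)\<close>, to
  which the Stroock-Varopoulos inequality applies.\<close>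

lemma energy_decrement:
  assumes t: "0 < t"
  obtains C where "0 \<le> C" "\<And>h. 0 < h \<Longrightarrow>
    c * dissipation h (\<lambda>x. \<psi> (T t v x)) (\<lambda>x. \<psi> (T t v x)) - C * h\<^sup>2 \<le> energy t - energy (t + h)"
proof -
  obtain L where L: "0 \<le> L"
    "\<And>s t. 0 \<le> s \<Longrightarrow> 0 \<le> t \<Longrightarrow> AE x in lebesgue. \<bar>F (T s v x) - F (T t v x)\<bar> \<le> L * \<bar>T s v x - T t v x\<bar>"
    by (rule F_bound) blast
  define C where "C = L * (L2_inner v v / t\<^sup>2)"
  show ?thesis
  proof (rule that[of C])
    show "0 \<le> C" using L by (simp add: C_def)
    fix h :: real assume h: "0 < h"
    have t0: "0 \<le> t" "0 \<le> t + h" "0 \<le> h" using t h by auto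
    let ?u = "T t v" and ?u' = "T (t + h) v"
    let ?e = "\<lambda>x. ?u x - ?u' x"
    note u = flow_L2[OF t0(1)] and u' = flow_L2[OF t0(2)]
    have e: "?e \<in> Lp_space 2" by (intro L2_diff u u')
    have Fu: "(\<lambda>x. F (?u x)) \<in> Lp_space 2" by (intro L1_Linf_imp_L2 F_comp flow_L1_Linf flow_nonneg t0)
    have "(LINT x|lebesgue. ?e x * F (?u x) - L * (?e x * ?e x)) \<le> (LINT x|lebesgue. \<Phi> (?u x) - \<Phi> (?u' x))"
    proof (rule integral_mono_AE)
      show "AE x in lebesgue. ?e x * F (?u x) - L * (?e x * ?e x) \<le> \<Phi> (?u x) - \<Phi> (?u' x)"
        using flow_nonneg[OF t0(1)] flow_nonneg[OF t0(2)] L(2)[OF t0(1,2)]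
      proof eventually_elim
        case (elim x)
        have "F (?u' x) * ?e x \<le> \<Phi> (?u x) - \<Phi> (?u' x)"
          using tangent[OF elim(2,1)] by simp
        moreover have "(F (?u x) - F (?u' x)) * ?e x \<le> L * (?e x * ?e x)"
        proof -
          have "(F (?u x) - F (?u' x)) * ?e x \<le> \<bar>F (?u x) - F (?u' x)\<bar> * \<bar>?e x\<bar>"
            by (metis abs_ge_self abs_mult)
          also have "\<dots> \<le> (L * \<bar>?e x\<bar>) * \<bar>?e x\<bar>" using elim(3) by (intro mult_right_mono) auto
          finally show ?thesis by (simp add: mult.assoc flip: abs_mult)
        qed
        ultimately show ?case by (simp add: algebra_simps)
      qed
    qed (use L2_integrable_mult[OF e Fu] L2_integrable_mult[OF e e] L1_Linf_integrable[OF flow_\<Phi>] t0 in auto)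
    then have "L2_inner ?e (\<lambda>x. F (?u x)) - L * L2_inner ?e ?e \<le> energy t - energy (t + h)"
      unfolding energy_def L2_inner_def
      using L2_integrable_mult[OF e Fu] L2_integrable_mult[OF e e] L1_Linf_integrable[OF flow_\<Phi>] t0 by simp
    moreover have "L2_inner ?e ?e \<le> (h / t)\<^sup>2 * L2_inner v v"
      by (rule T_increment[OF L1_Linf_imp_L2[OF v] h t])
    then have "L * L2_inner ?e ?e \<le> L * ((h / t)\<^sup>2 * L2_inner v v)"
      by (rule mult_left_mono[OF _ L(1)])
    then have "L * L2_inner ?e ?e \<le> C * h\<^sup>2"
      by (simp add: C_def power_divide mult_ac)
    moreover have "L2_inner ?e (\<lambda>x. F (?u x)) = dissipation h ?u (\<lambda>x. F (?u x))"
    proof -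
      have "AE x in lebesgue. ?u' x = T h ?u x"
        using T_plus[OF t0(3,1) L1_Linf_imp_L2[OF v]] by (simp add: add.commute)
      then have "L2_inner ?u' (\<lambda>x. F (?u x)) = L2_inner (T h ?u) (\<lambda>x. F (?u x))"
        by (intro L2_inner_cong_AE u' T_L2 t0 u Fu)
      then show ?thesis using u u' Fu by (simp add: L2_inner_diff dissipation_def)
    qed
    moreover have "c * dissipation h (\<lambda>x. \<psi> (?u x)) (\<lambda>x. \<psi> (?u x)) \<le> dissipation h ?u (\<lambda>x. F (?u x))"
      by (intro dissipation_comparison flow_L1_Linf flow_nonneg t0)
    ultimately show "c * dissipation h (\<lambda>x. \<psi> (?u x)) (\<lambda>x. \<psi> (?u x)) - C * h\<^sup>2 \<le> energy t - energy (t + h)"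
      by linarith
  qed
qed

text \<open>The tangent at the earlier time gives the opposite estimate, linear in \<open>h\<close>.
  It supplies the continuity of the energy.\<close>

lemma energy_increment_le:
  obtains K where "0 \<le> K" "\<And>t h. 0 < t \<Longrightarrow> 0 < h \<Longrightarrow> energy t - energy (t + h) \<le> K * (h / t)"
proof -
  obtain L where L: "0 \<le> L" "\<And>t. 0 \<le> t \<Longrightarrow> AE x in lebesgue. \<bar>F (T t v x)\<bar> \<le> L * \<bar>T t v x\<bar>"
    by (rule F_bound) blast
  note v2 = L1_Linf_imp_L2[OF v]
  show ?thesis
  proof (rule that[of "Lp_norm 2 v * (L * Lp_norm 2 v)"])
    show "0 \<le> Lp_norm 2 v * (L * Lp_norm 2 v)" using L(1) by simp
    fix t h :: real assume t: "0 < t" and h: "0 < h"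
    have t0: "0 \<le> t" "0 \<le> t + h" "0 \<le> h" using t h by auto
    let ?u = "T t v" and ?u' = "T (t + h) v"
    let ?e = "\<lambda>x. ?u x - ?u' x"
    note u = flow_L2[OF t0(1)] and u' = flow_L2[OF t0(2)]
    have e: "?e \<in> Lp_space 2" by (intro L2_diff u u')
    have Fu: "(\<lambda>x. F (?u x)) \<in> Lp_space 2" by (intro L1_Linf_imp_L2 F_comp flow_L1_Linf flow_nonneg t0)
    have "energy t - energy (t + h) = (LINT x|lebesgue. \<Phi> (?u x) - \<Phi> (?u' x))"
      unfolding energy_def using L1_Linf_integrable[OF flow_\<Phi>] t0 by simp
    also have "\<dots> \<le> L2_inner ?e (\<lambda>x. F (?u x))"
      unfolding L2_inner_def
    proof (rule integral_mono_AE)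
      show "AE x in lebesgue. \<Phi> (?u x) - \<Phi> (?u' x) \<le> ?e x * F (?u x)"
        using flow_nonneg[OF t0(1)] flow_nonneg[OF t0(2)]
      proof eventually_elim
        case (elim x)
        show ?case using tangent[OF elim] by (simp add: algebra_simps)
      qed
    qed (use L2_integrable_mult[OF e Fu] L1_Linf_integrable[OF flow_\<Phi>] t0 in auto)
    also have "\<dots> \<le> Lp_norm 2 ?e * Lp_norm 2 (\<lambda>x. F (?u x))"
      using L2_Cauchy_Schwarz[OF e Fu] by simp
    also have "\<dots> \<le> (h / t * Lp_norm 2 v) * (L * Lp_norm 2 v)"
    proof (rule mult_mono)
      have "(Lp_norm 2 ?e)\<^sup>2 \<le> (h / t * Lp_norm 2 v)\<^sup>2"
        using T_increment[OF v2 h t] by (simp only: Lp_norm_2_squared power_mult_distrib)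
      then show "Lp_norm 2 ?e \<le> h / t * Lp_norm 2 v" by (rule power2_le_imp_le) (use h t in auto)
      have "L2_inner (\<lambda>x. F (?u x)) (\<lambda>x. F (?u x)) \<le> L2_inner (\<lambda>x. L * ?u x) (\<lambda>x. L * ?u x)"
        unfolding L2_inner_def
      proof (rule integral_mono_AE)
        show "AE x in lebesgue. F (?u x) * F (?u x) \<le> (L * ?u x) * (L * ?u x)"
          using L(2)[OF t0(1)]
        proof eventually_elim
          case (elim x)
          then have "\<bar>F (?u x)\<bar> * \<bar>F (?u x)\<bar> \<le> (L * \<bar>?u x\<bar>) * (L * \<bar>?u x\<bar>)" by (intro mult_mono) auto
          then show ?case by (simp add: mult.assoc mult.left_commute flip: abs_mult)
        qed
      qed (intro L2_integrable_mult Fu L2_scale u)+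
      then have "Lp_norm 2 (\<lambda>x. F (?u x)) \<le> Lp_norm 2 (\<lambda>x. L * ?u x)" by (simp add: Lp_norm_2)
      also have "\<dots> = L * Lp_norm 2 ?u" using L(1) by (simp add: L2_norm_scale)
      also have "\<dots> \<le> L * Lp_norm 2 v" by (intro mult_left_mono T_L2_contraction v2 t0 L)
      finally show "Lp_norm 2 (\<lambda>x. F (?u x)) \<le> L * Lp_norm 2 v" .
    qed (use h t in auto)
    finally show "energy t - energy (t + h) \<le> Lp_norm 2 v * (L * Lp_norm 2 v) * (h / t)"
      by (simp add: mult_ac)
  qed
qed

text \<open>Monotonicity bounds the increments on one side, \<open>energy_increment_le\<close> on
  the other. The Lipschitz constant \<open>K / a\<close> degenerates at time
  \<open>0\<close>.\<close>

lemma energy_continuous: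
  assumes a: "0 < a"
  shows "continuous_on {a..b} energy"
proof -
  obtain K where K: "0 \<le> K" "\<And>t h. 0 < t \<Longrightarrow> 0 < h \<Longrightarrow> energy t - energy (t + h) \<le> K * (h / t)"
    by (rule energy_increment_le) blast
  have le: "\<bar>energy s - energy t\<bar> \<le> K / a * \<bar>s - t\<bar>" if st: "a \<le> s" "s < t" for s t
  proof -
    have "energy t \<le> energy s" using energy_antimono[of s "t - s"] a st by simp
    moreover have "energy s - energy t \<le> K * ((t - s) / s)" using K(2)[of s "t - s"] a st by simp
    moreover have "K * ((t - s) / s) \<le> K * ((t - s) / a)"
      using K(1) a st by (intro mult_left_mono divide_left_mono) auto
    ultimately show ?thesis using st by simp
  qed
  have "(K / a)-lipschitz_on {a..b} energy"
  proof (rule lipschitz_onI)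
    fix s t assume "s \<in> {a..b}" "t \<in> {a..b}"
    then show "dist (energy s) (energy t) \<le> K / a * dist s t"
      using le[of s t] le[of t s]
      by (cases s t rule: linorder_cases) (auto simp: dist_real_def abs_minus_commute)
  qed (use K a in auto)
  then show ?thesis by (rule lipschitz_on_continuous_on)
qed

text \<open>The premise \<open>rate\<close> says that \<open>R\<close> is at most the supremum of
  the form quotients, which may be infinite. If the energy dropped more slowly than
  \<open>\<eta>\<close> just after \<open>t\<close>, \<open>energy_decrement\<close> would bound the
  quotients for small \<open>h\<close> by \<open>(\<eta> + C h) / c\<close>; monotonicity extends
  this to all of them and gives \<open>R <= \<eta> / c\<close>.\<close>

lemma energy_rate:
  assumes t: "0 < t" and rate: "\<And>m. (\<And>h. 0 < h \<Longrightarrow> dissipation h (\<lambda>x. \<psi> (T t v x)) (\<lambda>x. \<psi> (T t v x)) / h \<le> m) \<Longrightarrow> R \<le> m"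
    and \<eta>: "\<eta> < c * R" and \<delta>: "0 < \<delta>"
  shows "\<exists>h. 0 < h \<and> h < \<delta> \<and> \<eta> * h \<le> energy t - energy (t + h)"
proof (rule ccontr)
  assume "\<not> ?thesis"
  then have *: "energy t - energy (t + h) < \<eta> * h" if "0 < h" "h < \<delta>" for h using that by force
  let ?w = "\<lambda>x. \<psi> (T t v x)"
  have w: "?w \<in> Lp_space 2" using t by (intro L1_Linf_imp_L2 \<psi>_comp flow_L1_Linf flow_nonneg) auto
  obtain C where C: "0 \<le> C" "\<And>h. 0 < h \<Longrightarrow> c * dissipation h ?w ?w - C * h\<^sup>2 \<le> energy t - energy (t + h)"
    using energy_decrement[OF t] by blast
  have "R \<le> \<eta> / c"
  proof (rule rate)
    fix k :: real assume k: "0 < k"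
    have le: "dissipation k ?w ?w / k \<le> (\<eta> + C * h) / c" if h: "0 < h" "h < min \<delta> k" for h
    proof -
      have "dissipation k ?w ?w / k \<le> dissipation h ?w ?w / h"
        by (intro dissipation_quotient_antimono w) (use h in auto)
      moreover have "c * dissipation h ?w ?w \<le> \<eta> * h + C * h\<^sup>2" using C(2)[OF h(1)] *[of h] h by simp
      then have "dissipation h ?w ?w / h \<le> (\<eta> + C * h) / c"
        using h c_pos by (simp add: field_simps power2_eq_square)
      ultimately show ?thesis by linarith
    qed
    have "((\<lambda>h. (\<eta> + C * h) / c) \<longlongrightarrow> (\<eta> + C * 0) / c) (at_right 0)"
      using c_pos by (intro tendsto_intros) auto
    moreover have "\<forall>\<^sub>F h in at_right 0. dissipation k ?w ?w / k \<le> (\<eta> + C * h) / c"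
      using eventually_at_right_real[of 0 "min \<delta> k"] k \<delta> le by (auto elim!: eventually_mono)
    ultimately show "dissipation k ?w ?w / k \<le> \<eta> / c"
      using tendsto_lowerbound by fastforce
  qed
  then show False using \<eta> c_pos by (simp add: field_simps)
qed

text \<open>A differential inequality \<open>y' \<le> - c \<kappa> y powr (1 + \<alpha>)\<close> makes \<open>y powr - \<alpha>\<close> grow linearly.\<close>

lemma energy_decay:
  assumes \<alpha>: "0 < \<alpha>" and \<kappa>: "0 < \<kappa>"
    and rate: "\<And>t m. 0 < t \<Longrightarrow> 0 < energy t \<Longrightarrow>
      (\<And>h. 0 < h \<Longrightarrow> dissipation h (\<lambda>x. \<psi> (T t v x)) (\<lambda>x. \<psi> (T t v x)) / h \<le> m) \<Longrightarrow>
      \<kappa> * energy t powr (1 + \<alpha>) \<le> m"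
    and t: "0 < t"
  shows "energy t \<le> (\<alpha> * (c * \<kappa>) * (t / 2)) powr (- (1 / \<alpha>))"
proof (cases "energy t = 0")
  case False
  then have pos_t: "0 < energy t" using energy_nonneg[of t] t by simp
  have anti: "energy b \<le> energy a" if "t / 2 \<le> a" "a \<le> b" for a b
    using energy_antimono[of a "b - a"] that t by simp
  then have pos: "0 < energy s" if "t / 2 \<le> s" "s \<le> t" for s using that pos_t by (meson less_le_trans)
  let ?z = "\<lambda>s. energy s powr - \<alpha>"
  \<comment> \<open>The interval starts at \<open>t / 2\<close> because continuity of the energy is
    available only away from \<open>0\<close>; this is the origin of \<open>t / 2\<close> in the
    bound.\<close>
  have "\<alpha> * (c * \<kappa>) * (t - t / 2) \<le> ?z t - ?z (t / 2)"
  proof (rule increment_ge_of_right_difference_quotients)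
    show "continuous_on {t / 2..t} ?z"
      by (intro continuous_on_powr continuous_on_const energy_continuous) (use t pos in force)+
    fix s \<eta> \<delta> :: real assume s: "t / 2 \<le> s" "s < t" and \<eta>: "\<eta> < \<alpha> * (c * \<kappa>)" and \<delta>: "0 < \<delta>"
    let ?y = "energy s"
    have y: "0 < ?y" using pos[of s] s by simp
    have s0: "0 < s" using s t by simp
    have "max 0 \<eta> / \<alpha> < c * \<kappa>" using \<eta> \<alpha> \<kappa> c_pos by (simp add: field_simps)
    then have "max 0 \<eta> / \<alpha> * ?y powr (1 + \<alpha>) < c * \<kappa> * ?y powr (1 + \<alpha>)"
      using y by (intro mult_strict_right_mono) auto
    then have "\<exists>h. 0 < h \<and> h < min \<delta> (t - s) \<and> max 0 \<eta> / \<alpha> * ?y powr (1 + \<alpha>) * h \<le> energy s - energy (s + h)"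
      using s \<delta> by (intro energy_rate[OF s0 rate[OF s0 y]]) (auto simp: mult.assoc)
    then obtain h where h: "0 < h" "h < \<delta>" "h < t - s"
      "max 0 \<eta> / \<alpha> * ?y powr (1 + \<alpha>) * h \<le> energy s - energy (s + h)" by auto
    have "?z s + \<alpha> * ?y powr (- \<alpha> - 1) * (?y - energy (s + h)) \<le> ?z (s + h)"
      by (rule powr_neg_tangent_line) (use pos[of "s + h"] anti[of s "s + h"] h s \<alpha> in auto)
    moreover have "\<alpha> * ?y powr (- \<alpha> - 1) * (max 0 \<eta> / \<alpha> * ?y powr (1 + \<alpha>) * h)
      \<le> \<alpha> * ?y powr (- \<alpha> - 1) * (?y - energy (s + h))"
      using h(4) \<alpha> by (intro mult_left_mono) auto
    moreover have "\<alpha> * ?y powr (- \<alpha> - 1) * (max 0 \<eta> / \<alpha> * ?y powr (1 + \<alpha>) * h) = max 0 \<eta> * h"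
    proof -
      have "\<alpha> * ?y powr (- \<alpha> - 1) * (max 0 \<eta> / \<alpha> * ?y powr (1 + \<alpha>) * h)
        = max 0 \<eta> * h * (?y powr (- \<alpha> - 1) * ?y powr (1 + \<alpha>))" using \<alpha> by simp
      also have "?y powr (- \<alpha> - 1) * ?y powr (1 + \<alpha>) = 1" using y by (simp flip: powr_add)
      finally show ?thesis by simp
    qed
    moreover have "\<eta> * h \<le> max 0 \<eta> * h" using h by (intro mult_right_mono) auto
    ultimately have "\<eta> * h \<le> ?z (s + h) - ?z s" by linarith
    then show "\<exists>h>0. h < \<delta> \<and> \<eta> * h \<le> ?z (s + h) - ?z s" using h by blast
  qed (use t in auto)
  also have "\<dots> \<le> ?z t" by simp
  also have "t - t / 2 = t / 2" by simp
  finally have le: "\<alpha> * (c * \<kappa>) * (t / 2) \<le> ?z t" .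
  have "energy t = (?z t) powr (- (1 / \<alpha>))" using pos_t \<alpha> by (simp add: powr_powr)
  also have "\<dots> \<le> (\<alpha> * (c * \<kappa>) * (t / 2)) powr (- (1 / \<alpha>))"
    by (intro powr_mono2' le) (use \<alpha> \<kappa> t c_pos in auto)
  finally show ?thesis .
qed simp

end

end

section \<open>From the hypothesis to a lower bound by L^1 and L^2 norms\<close>

text \<open>The level \<open>(b / a) powr (1 / (P - 1))\<close> makes the two terms of
  \<open>powr_interpolation\<close> equal. Hence the factor \<open>2\<close>, where Hoelder's
  inequality would have \<open>1\<close>.\<close>

lemma integral_powr_interpolation:
  fixes w :: "'a::euclidean_space \<Rightarrow> real"
  assumes w: "w \<in> Lp_space 1 \<inter> Linf_space" and r: "1 \<le> r" "r \<le> P" "1 < P"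
    and pos: "0 < (LINT x|lebesgue. \<bar>w x\<bar>)" "0 < (LINT x|lebesgue. \<bar>w x\<bar> powr P)"
  shows "(LINT x|lebesgue. \<bar>w x\<bar> powr r) \<le> 2 * (LINT x|lebesgue. \<bar>w x\<bar>) powr ((P - r) / (P - 1))
    * (LINT x|lebesgue. \<bar>w x\<bar> powr P) powr ((r - 1) / (P - 1))"
proof -
  define a where "a = (LINT x|lebesgue. \<bar>w x\<bar>)"
  define b where "b = (LINT x|lebesgue. \<bar>w x\<bar> powr P)"
  have ab: "0 < a" "0 < b" using pos by (auto simp: a_def b_def)
  define l where "l = (b / a) powr (1 / (P - 1))"
  have l: "0 < l" using ab by (simp add: l_def)
  have l_powr: "l powr e = b powr (e / (P - 1)) * a powr (- (e / (P - 1)))" for e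
    using ab by (simp add: l_def powr_powr powr_divide powr_minus_divide)
  have int: "integrable lebesgue (\<lambda>x. \<bar>w x\<bar>)" "integrable lebesgue (\<lambda>x. \<bar>w x\<bar> powr P)"
    "integrable lebesgue (\<lambda>x. \<bar>w x\<bar> powr r)"
    using r by (auto intro!: L1_Linf_integrable L1_Linf_abs L1_Linf_powr w simp del: Int_iff)
  have "(LINT x|lebesgue. \<bar>w x\<bar> powr r) \<le> (LINT x|lebesgue. l powr (r - 1) * \<bar>w x\<bar> + l powr (r - P) * \<bar>w x\<bar> powr P)"
    using int by (intro integral_mono powr_interpolation l r) auto
  also have "\<dots> = l powr (r - 1) * a + l powr (r - P) * b"
    using int by (simp add: a_def b_def)
  also have "l powr (r - 1) * a = a powr ((P - r) / (P - 1)) * b powr ((r - 1) / (P - 1))"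
  proof -
    have "l powr (r - 1) * a = b powr ((r - 1) / (P - 1)) * (a powr (- ((r - 1) / (P - 1))) * a powr 1)"
      using ab by (simp add: l_powr)
    also have "a powr (- ((r - 1) / (P - 1))) * a powr 1 = a powr ((P - r) / (P - 1))"
      unfolding powr_add[symmetric] using r by (intro arg_cong[where f = "\<lambda>e. a powr e"]) (simp add: field_simps)
    finally show ?thesis by simp
  qed
  also have "l powr (r - P) * b = a powr ((P - r) / (P - 1)) * b powr ((r - 1) / (P - 1))"
  proof -
    have "l powr (r - P) * b = a powr (- ((r - P) / (P - 1))) * (b powr ((r - P) / (P - 1)) * b powr 1)"
      using ab by (simp add: l_powr)
    also have "b powr ((r - P) / (P - 1)) * b powr 1 = b powr ((r - 1) / (P - 1))"
      unfolding powr_add[symmetric] using r by (intro arg_cong[where f = "\<lambda>e. b powr e"]) (simp add: field_simps)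
    also have "- ((r - P) / (P - 1)) = (P - r) / (P - 1)" by (metis minus_diff_eq minus_divide_left)
    finally show ?thesis .
  qed
  finally show ?thesis by (simp add: a_def b_def)
qed

lemma integral_powr_eq_0:
  fixes w :: "'a::euclidean_space \<Rightarrow> real"
  assumes w: "w \<in> Lp_space 1 \<inter> Linf_space" and r: "1 \<le> r" and 0: "(LINT x|lebesgue. \<bar>w x\<bar> powr r) = 0"
  shows "AE x in lebesgue. w x = 0"
proof -
  have "AE x in lebesgue. \<bar>w x\<bar> powr r = 0"
    using 0 integral_nonneg_eq_0_iff_AE[OF L1_Linf_integrable[OF L1_Linf_powr[OF w r]]] by simp
  then show ?thesis by eventually_elim simp
qed

text \<open>The hypothesis is applied to \<open>w\<close> divided by its L^r norm, and that norm is
  interpolated between L^1 and L^2. The bound \<open>m\<close> on the quotients gives both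
  membership in the form domain and the upper bound for the form.\<close>

lemma (in heat_flow) Nash_inequality:
  fixes r d C1 :: real
  assumes r: "1 \<le> r" "r < 2" and d: "0 < d" and C1: "0 < C1"
    and Nash: "\<And>f. f \<in> form_domain D A \<inter> Lp_space 1 \<inter> Lp_space 2 \<Longrightarrow> Lp_norm r f = 1 \<Longrightarrow>
           C1 * (Lp_norm 2 f)\<^sup>2 * min 1 (Lp_norm 2 f powr (2 / d)) \<le> form D A f f"
    and w: "w \<in> Lp_space 1 \<inter> Linf_space"
    and bound: "\<And>h. 0 < h \<Longrightarrow> dissipation h w w / h \<le> m"
  shows "C1 * 2 powr (- (2 / (r * d))) * L2_inner w w *
    min 1 ((L2_inner w w / (LINT x|lebesgue. \<bar>w x\<bar>)\<^sup>2) powr ((2 - r) / (r * d))) \<le> m"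
proof -
  define a where "a = (LINT x|lebesgue. \<bar>w x\<bar>)"
  define b where "b = L2_inner w w"
  define R where "R = (LINT x|lebesgue. \<bar>w x\<bar> powr r)"
  note w2 = L1_Linf_imp_L2[OF w]
  have b_eq: "b = (LINT x|lebesgue. \<bar>w x\<bar> powr 2)" by (simp add: b_def L2_inner_def power2_eq_square)
  show ?thesis
  proof (cases "b = 0")
    case True
    have "0 \<le> dissipation 1 w w / 1" using dissipation_nonneg[of 1 w] w2 by simp
    then show ?thesis using bound[of 1] True by (simp add: b_def)
  next
    case False
    then have b: "0 < b" using L2_inner_nonneg[of w] by (simp add: b_def less_le)
    have nz: "\<not> (AE x in lebesgue. w x = 0)"
    proof
      assume "AE x in lebesgue. w x = 0"
      then have "b = L2_inner (\<lambda>x. 0) w" unfolding b_def by (intro L2_inner_cong_AE w2 L2_zero)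
      then show False using b by (simp add: L2_inner_def)
    qed
    have R: "0 < R" using integral_powr_eq_0[OF w r(1)] nz
      by (auto simp: R_def less_le intro: integral_nonneg_AE)
    have a: "0 < a" using integral_powr_eq_0[OF w, of 1] nz
      by (auto simp: a_def less_le intro: integral_nonneg_AE)
    define l where "l = R powr (- (1 / r))"
    have l: "0 < l" using R by (simp add: l_def)
    define f where "f = (\<lambda>x. l * w x)"
    have f: "f \<in> Lp_space 1 \<inter> Linf_space" unfolding f_def using L1_Linf_lincomb[OF w w, of l 0] by simp
    note f2 = L1_Linf_imp_L2[OF f]
    have fb: "dissipation h f f / h \<le> l\<^sup>2 * m" if "0 < h" for h
    proof -
      have "dissipation h f f / h = l\<^sup>2 * (dissipation h w w / h)"
        unfolding f_def using that w2 by (simp add: dissipation_scale_self)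
      also have "\<dots> \<le> l\<^sup>2 * m" by (intro mult_left_mono bound that) simp
      finally show ?thesis .
    qed
    have fr: "Lp_norm r f = 1"
    proof -
      have "(LINT x|lebesgue. \<bar>f x\<bar> powr r) = l powr r * R"
        using l by (simp add: f_def R_def abs_mult powr_mult)
      also have "l powr r = R powr (- 1)" using r by (simp add: l_def powr_powr)
      also have "R powr (- 1) * R = 1" using R by (simp add: powr_minus)
      finally show ?thesis by (simp add: Lp_norm_def)
    qed
    have f_norm: "Lp_norm 2 f = l * sqrt b"
      using l by (simp add: f_def L2_norm_scale b_def Lp_norm_2)
    have "C1 * (Lp_norm 2 f)\<^sup>2 * min 1 (Lp_norm 2 f powr (2 / d)) \<le> form D A f f"
      using f f2 by (intro Nash fr) (auto intro: form_domain_if_bounded_dissipation[OF f2 fb])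
    also have "\<dots> \<le> l\<^sup>2 * m" by (rule form_le_if_bounded_dissipation[OF f2 fb])
    finally have "l\<^sup>2 * (C1 * b * min 1 ((l * sqrt b) powr (2 / d))) \<le> l\<^sup>2 * m"
      using b by (simp add: f_norm power_mult_distrib mult_ac)
    then have main: "C1 * b * min 1 ((l * sqrt b) powr (2 / d)) \<le> m" using l by simp
    \<comment> \<open>\<open>k\<close> is the factor \<open>2\<close> of the interpolation raised to
      \<open>- 2 / (r d)\<close>. Since \<open>k <= 1\<close>, it can be taken out of the
      minimum.\<close>
    define k where "k = 2 powr (- (2 / (r * d)))"
    define X where "X = (b / a\<^sup>2) powr ((2 - r) / (r * d))"
    have k: "0 < k" "k \<le> 1" using r d by (auto simp: k_def powr_minus intro!: inverse_le_1_iff[THEN iffD2] ge_one_powr_ge_zero)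
    have "k * X \<le> (l * sqrt b) powr (2 / d)"
    proof -
      have Rle: "R \<le> 2 * a powr (2 - r) * b powr (r - 1)"
        using integral_powr_interpolation[OF w r(1), of 2] r a b by (simp add: R_def a_def b_eq)
      have "k * X = (2 * a powr (2 - r) * b powr (r - 1)) powr (- (2 / (r * d))) * b powr (1 / d)"
      proof -
        have "X = b powr ((2 - r) / (r * d)) * a powr (- (2 * ((2 - r) / (r * d))))"
        proof -
          have "(b / a\<^sup>2) powr e = b powr e * a powr (- (2 * e))" for e
          proof -
            have "(b / a\<^sup>2) powr e = b powr e / (a powr 2) powr e"
              using a b by (simp add: powr_divide powr_numeral)
            then show ?thesis by (simp add: powr_powr powr_minus divide_inverse)
          qed
          then show ?thesis by (simp only: X_def)
        qed
        \<comment> \<open>The power \<open>r - 1\<close> of \<open>b\<close> comes from the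
          interpolated norm, the power \<open>1 / d\<close> from the L^2 norm;
          \<open>1 / d - 2 (r - 1) / (r d) = (2 - r) / (r d)\<close>.\<close>
        also have "b powr ((2 - r) / (r * d)) = b powr ((r - 1) * (- (2 / (r * d))) + 1 / d)"
          using r d by (intro arg_cong[where f = "\<lambda>e. b powr e"]) (simp add: field_simps)
        also have "\<dots> = b powr ((r - 1) * (- (2 / (r * d)))) * b powr (1 / d)" by (rule powr_add)
        also have "a powr (- (2 * ((2 - r) / (r * d)))) = a powr ((2 - r) * (- (2 / (r * d))))"
          using r d by (intro arg_cong[where f = "\<lambda>e. a powr e"]) (simp add: field_simps)
        finally show ?thesis using a b by (simp add: k_def powr_mult powr_powr)
      qed
      also have "\<dots> \<le> R powr (- (2 / (r * d))) * b powr (1 / d)"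
        using r d R Rle by (intro mult_right_mono powr_mono2') auto
      also have "\<dots> = (l * sqrt b) powr (2 / d)"
        using b R by (simp add: l_def powr_mult powr_powr flip: powr_half_sqrt)
      finally show ?thesis .
    qed
    moreover have "k * min 1 X \<le> k * 1" "k * min 1 X \<le> k * X"
      by (intro mult_left_mono; use k in simp)+
    ultimately have "k * min 1 X \<le> min 1 ((l * sqrt b) powr (2 / d))"
      unfolding min.bounded_iff using k by linarith
    then have "C1 * b * (k * min 1 X) \<le> C1 * b * min 1 ((l * sqrt b) powr (2 / d))"
      using C1 b by (intro mult_left_mono) auto
    with main show ?thesis by (simp add: k_def X_def a_def b_def mult_ac)
  qed
qed

section \<open>Power functions\<close>

text \<open>The function \<open>(\<theta> + x) powr p / p\<close> minus its tangent at
  \<open>0\<close>, hence an antiderivative of \<open>powr_F\<close>. The shift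
  \<open>\<theta>\<close> will be \<open>0\<close> for \<open>p >= 2\<close> and \<open>1\<close>
  for \<open>p < 2\<close>.\<close>

definition powr_\<Phi> :: "real \<Rightarrow> real \<Rightarrow> real \<Rightarrow> real" where
  "powr_\<Phi> \<theta> p x = ((\<theta> + x) powr p - \<theta> powr p - p * \<theta> powr (p - 1) * x) / p"

definition powr_F :: "real \<Rightarrow> real \<Rightarrow> real \<Rightarrow> real" where
  "powr_F \<theta> p x = (\<theta> + x) powr (p - 1) - \<theta> powr (p - 1)"

definition powr_\<psi> :: "real \<Rightarrow> real \<Rightarrow> real \<Rightarrow> real" where
  "powr_\<psi> \<theta> p x = (\<theta> + x) powr (p / 2) - \<theta> powr (p / 2)"

text \<open>It plays the part of the classical constant \<open>4 (p - 1) / p^2\<close>. The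
  numerator bounds increments of \<open>powr_F\<close> from below, the denominator squared
  increments of \<open>powr_\<psi>\<close> from above.\<close>

definition powr_c :: "real \<Rightarrow> real" where
  "powr_c p = min 1 (p - 1) / (max 1 (p / 2))\<^sup>2"

text \<open>For \<open>e < 1\<close> the derivative blows up at \<open>0\<close>, and
  \<open>\<theta> >= 1\<close> keeps the argument away from it. The constant \<open>k\<close>
  cancels; it makes the statement fit \<open>powr_F\<close> and \<open>powr_\<psi>\<close>.\<close>

lemma shifted_powr_Lipschitz:
  fixes \<theta> e M :: real
  assumes "0 \<le> \<theta>" "0 < e" "1 \<le> e \<or> 1 \<le> \<theta>" "0 \<le> M"
  shows "\<exists>L\<ge>0. \<forall>a\<in>{0..M}. \<forall>b\<in>{0..M}. \<bar>((\<theta> + a) powr e - k) - ((\<theta> + b) powr e - k)\<bar> \<le> L * \<bar>a - b\<bar>"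
proof -
  define K where "K = max 1 ((\<theta> + M) powr (e - 1))"
  have K: "(\<theta> + a) powr (e - 1) \<le> K" if "a \<in> {0..M}" for a
  proof (cases "1 \<le> e")
    case True
    then have "(\<theta> + a) powr (e - 1) \<le> (\<theta> + M) powr (e - 1)" using that assms by (intro powr_mono2) auto
    then show ?thesis by (simp add: K_def)
  next
    case False
    then have "(\<theta> + a) powr (e - 1) \<le> 1 powr (e - 1)" using that assms by (intro powr_mono2') auto
    then show ?thesis by (simp add: K_def)
  qed
  have *: "\<bar>(\<theta> + a) powr e - (\<theta> + b) powr e\<bar> \<le> max 1 e * K * \<bar>a - b\<bar>" if ab: "a \<in> {0..M}" "b \<le> a" "0 \<le> b" for a b
  proof -
    have "(\<theta> + b) powr e \<le> (\<theta> + a) powr e" using ab assms by (intro powr_mono2) auto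
    moreover have "(\<theta> + a) powr e - (\<theta> + b) powr e \<le> max 1 e * (\<theta> + a) powr (e - 1) * ((\<theta> + a) - (\<theta> + b))"
      by (rule powr_diff_le) (use ab assms in auto)
    moreover have "max 1 e * (\<theta> + a) powr (e - 1) * ((\<theta> + a) - (\<theta> + b)) \<le> max 1 e * K * ((\<theta> + a) - (\<theta> + b))"
      using K[OF ab(1)] ab by (intro mult_right_mono mult_left_mono) auto
    ultimately show ?thesis using ab by simp
  qed
  have "\<bar>((\<theta> + a) powr e - k) - ((\<theta> + b) powr e - k)\<bar> \<le> max 1 e * K * \<bar>a - b\<bar>" if "a \<in> {0..M}" "b \<in> {0..M}" for a b
    using *[of a b] *[of b a] that by (cases "b \<le> a") (auto simp: abs_minus_commute)
  moreover have "0 \<le> max 1 e * K" by (simp add: K_def)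
  ultimately show ?thesis by blast
qed

text \<open>Everything is compared with \<open>A powr (p - 2) * (A - B)^2\<close>, by
  \<open>powr_diff_le\<close> with exponents \<open>p - 1\<close> and \<open>p / 2\<close>. The
  factor \<open>4\<close> is the inverse square of \<open>1 / 2\<close>, a lower bound of
  \<open>min 1 (p / 2)\<close>.\<close>

lemma powr_comparison:
  fixes A B p :: real
  assumes "0 \<le> B" "B \<le> A" "1 < p"
  shows "powr_c p * (A powr (p / 2) - B powr (p / 2))\<^sup>2 \<le> (A - B) * (A powr (p - 1) - B powr (p - 1))"
    and "(A - B) * (A powr (p - 1) - B powr (p - 1)) \<le> max 1 (p - 1) * A powr (p - 2) * (A - B)\<^sup>2"
    and "(A - B) * (A powr (p - 1) - B powr (p - 1)) \<le> 4 * max 1 (p - 1) * (A powr (p / 2) - B powr (p / 2))\<^sup>2"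
proof -
  have sq: "(A powr (p / 2 - 1))\<^sup>2 = A powr (p - 2)" by (simp add: power2_eq_square flip: powr_add)
  note F = powr_diff_le[of B A "p - 1"] and \<psi> = powr_diff_le[of B A "p / 2"]
  have F1: "min 1 (p - 1) * A powr (p - 2) * (A - B) \<le> A powr (p - 1) - B powr (p - 1)"
    and F2: "A powr (p - 1) - B powr (p - 1) \<le> max 1 (p - 1) * A powr (p - 2) * (A - B)"
    using F assms by (simp_all add: diff_diff_eq)
  have \<psi>1: "A powr (p / 2) - B powr (p / 2) \<le> max 1 (p / 2) * A powr (p / 2 - 1) * (A - B)"
    and \<psi>2: "min 1 (p / 2) * A powr (p / 2 - 1) * (A - B) \<le> A powr (p / 2) - B powr (p / 2)"
    using \<psi> assms by auto
  have \<psi>0: "0 \<le> A powr (p / 2) - B powr (p / 2)" using assms by (simp add: powr_mono2)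
  have "(A powr (p / 2) - B powr (p / 2))\<^sup>2 \<le> (max 1 (p / 2) * A powr (p / 2 - 1) * (A - B))\<^sup>2"
    by (rule power_mono[OF \<psi>1 \<psi>0])
  also have "\<dots> = (max 1 (p / 2))\<^sup>2 * (A powr (p - 2) * (A - B)\<^sup>2)"
    by (simp only: power_mult_distrib sq mult.assoc)
  finally have "powr_c p * (A powr (p / 2) - B powr (p / 2))\<^sup>2
      \<le> powr_c p * ((max 1 (p / 2))\<^sup>2 * (A powr (p - 2) * (A - B)\<^sup>2))"
    using assms by (intro mult_left_mono) (auto simp: powr_c_def)
  also have "\<dots> = (powr_c p * (max 1 (p / 2))\<^sup>2) * (A powr (p - 2) * (A - B)\<^sup>2)" by (simp only: mult.assoc)
  also have "powr_c p * (max 1 (p / 2))\<^sup>2 = min 1 (p - 1)" by (simp add: powr_c_def)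
  also have "min 1 (p - 1) * (A powr (p - 2) * (A - B)\<^sup>2) = (A - B) * (min 1 (p - 1) * A powr (p - 2) * (A - B))"
    by (simp add: power2_eq_square mult_ac)
  also have "\<dots> \<le> (A - B) * (A powr (p - 1) - B powr (p - 1))"
    using F1 assms by (intro mult_left_mono) auto
  finally show "powr_c p * (A powr (p / 2) - B powr (p / 2))\<^sup>2 \<le> (A - B) * (A powr (p - 1) - B powr (p - 1))" .
  have "(A - B) * (A powr (p - 1) - B powr (p - 1)) \<le> (A - B) * (max 1 (p - 1) * A powr (p - 2) * (A - B))"
    using F2 assms by (intro mult_left_mono) auto
  also have "\<dots> = max 1 (p - 1) * A powr (p - 2) * (A - B)\<^sup>2" by (simp add: power2_eq_square mult_ac)
  finally show 2: "(A - B) * (A powr (p - 1) - B powr (p - 1)) \<le> max 1 (p - 1) * A powr (p - 2) * (A - B)\<^sup>2" .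
  have "(1 / 2) * (A powr (p / 2 - 1) * (A - B)) \<le> min 1 (p / 2) * (A powr (p / 2 - 1) * (A - B))"
    using assms by (intro mult_right_mono) auto
  also have "\<dots> \<le> A powr (p / 2) - B powr (p / 2)" using \<psi>2 by (simp only: mult.assoc)
  finally have "((1 / 2) * (A powr (p / 2 - 1) * (A - B)))\<^sup>2 \<le> (A powr (p / 2) - B powr (p / 2))\<^sup>2"
    using assms by (intro power_mono) auto
  then have "A powr (p - 2) * (A - B)\<^sup>2 \<le> 4 * (A powr (p / 2) - B powr (p / 2))\<^sup>2"
    by (simp add: power_mult_distrib sq power_divide)
  then have "max 1 (p - 1) * (A powr (p - 2) * (A - B)\<^sup>2) \<le> max 1 (p - 1) * (4 * (A powr (p / 2) - B powr (p / 2))\<^sup>2)"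
    by (intro mult_left_mono) auto
  with 2 show "(A - B) * (A powr (p - 1) - B powr (p - 1)) \<le> 4 * max 1 (p - 1) * (A powr (p / 2) - B powr (p / 2))\<^sup>2"
    by (simp add: mult_ac)
qed

text \<open>The condition \<open>shift\<close> secures the Lipschitz properties: the exponents
  \<open>p - 1\<close> and \<open>p / 2\<close> are at least \<open>1\<close> exactly when
  \<open>p >= 2\<close>.\<close>

lemma energy_functions_powr:
  fixes p \<theta> :: real
  assumes p: "1 < p" and \<theta>: "0 \<le> \<theta>" and shift: "2 \<le> p \<or> 1 \<le> \<theta>"
  shows "energy_functions (powr_\<Phi> \<theta> p) (powr_F \<theta> p) (powr_\<psi> \<theta> p) (powr_c p)"
proof
  show "powr_\<Phi> \<theta> p a + powr_F \<theta> p a * (b - a) \<le> powr_\<Phi> \<theta> p b" if "0 \<le> a" "0 \<le> b" for a b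
  proof -
    have "(\<theta> + a) powr p + p * (\<theta> + a) powr (p - 1) * ((\<theta> + b) - (\<theta> + a)) \<le> (\<theta> + b) powr p"
      by (rule powr_tangent_line) (use that \<theta> p in auto)
    then have "((\<theta> + a) powr p + p * (\<theta> + a) powr (p - 1) * (b - a) - \<theta> powr p - p * \<theta> powr (p - 1) * b) / p
      \<le> powr_\<Phi> \<theta> p b" unfolding powr_\<Phi>_def using p by (intro divide_right_mono) auto
    moreover have "powr_\<Phi> \<theta> p a + powr_F \<theta> p a * (b - a)
      = ((\<theta> + a) powr p + p * (\<theta> + a) powr (p - 1) * (b - a) - \<theta> powr p - p * \<theta> powr (p - 1) * b) / p"
      unfolding powr_\<Phi>_def powr_F_def using p by (simp add: field_simps)
    ultimately show ?thesis by simp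
  qed
  show "\<exists>L\<ge>0. \<forall>a\<in>{0..M}. \<forall>b\<in>{0..M}. \<bar>powr_F \<theta> p a - powr_F \<theta> p b\<bar> \<le> L * \<bar>a - b\<bar>" if "0 \<le> M" for M
    unfolding powr_F_def by (rule shifted_powr_Lipschitz) (use that p \<theta> shift in auto)
  show "\<exists>L\<ge>0. \<forall>a\<in>{0..M}. \<forall>b\<in>{0..M}. \<bar>powr_\<psi> \<theta> p a - powr_\<psi> \<theta> p b\<bar> \<le> L * \<bar>a - b\<bar>" if "0 \<le> M" for M
    unfolding powr_\<psi>_def by (rule shifted_powr_Lipschitz) (use that p \<theta> shift in auto)
  have *: "powr_c p * (powr_\<psi> \<theta> p a - powr_\<psi> \<theta> p b)\<^sup>2 \<le> (a - b) * (powr_F \<theta> p a - powr_F \<theta> p b)"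
    if "b \<le> a" "0 \<le> b" for a b
    using powr_comparison(1)[of "\<theta> + b" "\<theta> + a" p] that \<theta> p by (simp add: powr_\<psi>_def powr_F_def)
  show "powr_c p * (powr_\<psi> \<theta> p a - powr_\<psi> \<theta> p b)\<^sup>2 \<le> (a - b) * (powr_F \<theta> p a - powr_F \<theta> p b)"
    if "0 \<le> a" "0 \<le> b" for a b
  proof (cases "b \<le> a")
    case False
    have "powr_c p * (powr_\<psi> \<theta> p b - powr_\<psi> \<theta> p a)\<^sup>2 \<le> (b - a) * (powr_F \<theta> p b - powr_F \<theta> p a)"
      by (rule *) (use False that in auto)
    also have "\<dots> = (a - b) * (powr_F \<theta> p a - powr_F \<theta> p b)" by (simp add: algebra_simps)
    finally show ?thesis by (simp add: power2_commute)
  qed (use * that in auto)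
  show "powr_\<Phi> \<theta> p \<in> borel_measurable borel" "powr_F \<theta> p \<in> borel_measurable borel" "powr_\<psi> \<theta> p \<in> borel_measurable borel"
    unfolding powr_\<Phi>_def[abs_def] powr_F_def[abs_def] powr_\<psi>_def[abs_def] by measurable
qed (use p in \<open>auto simp: powr_\<Phi>_def powr_F_def powr_\<psi>_def powr_c_def\<close>)

text \<open>The tangent at \<open>x\<close>, evaluated at \<open>0\<close>, gives
  \<open>\<Phi> x <= x F x\<close>, and this product is estimated by \<open>powr_comparison\<close>
  with \<open>B = \<theta>\<close>.\<close>

lemma powr_\<Phi>_le_\<psi>:
  assumes p: "1 < p" and \<theta>: "0 \<le> \<theta>" and shift: "2 \<le> p \<or> 1 \<le> \<theta>" and x: "0 \<le> x"
  shows "powr_\<Phi> \<theta> p x \<le> 4 * max 1 (p - 1) * (powr_\<psi> \<theta> p x)\<^sup>2"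
    and "powr_\<Phi> \<theta> p x \<le> max 1 (p - 1) * (\<theta> + x) powr (p - 2) * x\<^sup>2"
proof -
  interpret energy_functions "powr_\<Phi> \<theta> p" "powr_F \<theta> p" "powr_\<psi> \<theta> p" "powr_c p"
    by (rule energy_functions_powr[OF p \<theta> shift])
  have "powr_\<Phi> \<theta> p x \<le> x * powr_F \<theta> p x" using tangent[OF x, of 0] zero by (simp add: mult.commute)
  also have "x * powr_F \<theta> p x = ((\<theta> + x) - \<theta>) * ((\<theta> + x) powr (p - 1) - \<theta> powr (p - 1))"
    by (simp add: powr_F_def)
  finally have *: "powr_\<Phi> \<theta> p x \<le> ((\<theta> + x) - \<theta>) * ((\<theta> + x) powr (p - 1) - \<theta> powr (p - 1))" .
  show "powr_\<Phi> \<theta> p x \<le> 4 * max 1 (p - 1) * (powr_\<psi> \<theta> p x)\<^sup>2"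
    using order_trans[OF * powr_comparison(3)[of \<theta> "\<theta> + x" p]] \<theta> x p by (simp add: powr_\<psi>_def)
  show "powr_\<Phi> \<theta> p x \<le> max 1 (p - 1) * (\<theta> + x) powr (p - 2) * x\<^sup>2"
    using order_trans[OF * powr_comparison(2)[of \<theta> "\<theta> + x" p]] \<theta> x p by simp
qed

text \<open>For \<open>p < 2\<close> the shifted energy controls \<open>x powr p\<close> for large and \<open>x\<^sup>2\<close> for small \<open>x\<close>; the choice
  \<open>l = t powr - (1 / \<beta>)\<close> balances the two terms.\<close>

lemma powr_le_shifted_energy:
  assumes p: "1 < p" "p < 2" and l: "0 < l" "l \<le> 1" and x: "0 \<le> x"
  shows "x powr p \<le> l powr (p - 1) * x + l powr (p - 2) * (8 / (p - 1) * powr_\<Phi> 1 p x)"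
proof -
  interpret energy_functions "powr_\<Phi> 1 p" "powr_F 1 p" "powr_\<psi> 1 p" "powr_c p"
    by (rule energy_functions_powr) (use p in auto)
  have \<Phi>0: "0 \<le> powr_\<Phi> 1 p x" by (rule \<Phi>_nonneg[OF x])
  show ?thesis
  proof (cases "x \<le> l")
    case True
    have "x powr p = x powr (p - 1) * x" using x by (cases "x = 0") (auto simp: powr_diff)
    also have "\<dots> \<le> l powr (p - 1) * x" using True x p by (intro mult_right_mono powr_mono2) auto
    finally show ?thesis using \<Phi>0 p by (simp add: add_increasing2)
  next
    case False
    then have x0: "0 < x" using l by simp
    have lp1: "1 \<le> l powr (p - 2)"
      using powr_mono2'[of "p - 2" l 1] l p by simp
    have half: "min 1 (p - 1) * (1 + x / 2) powr (p - 1 - 1) * ((1 + x / 2) - 1) \<le> (1 + x / 2) powr (p - 1) - 1 powr (p - 1)"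
      by (rule powr_diff_le) (use x p in auto)
    \<comment> \<open>A lower bound for \<open>\<Phi> x\<close> of order \<open>x^2\<close> comes
      from the tangent at the midpoint \<open>x / 2\<close>, where the slope is already of order
      \<open>x\<close>.\<close>
    have "powr_\<Phi> 1 p (x / 2) + powr_F 1 p (x / 2) * (x - x / 2) \<le> powr_\<Phi> 1 p x"
      by (rule tangent) (use x in auto)
    then have \<Phi>1: "powr_F 1 p (x / 2) * (x / 2) \<le> powr_\<Phi> 1 p x" using \<Phi>_nonneg[of "x / 2"] x by simp
    have "(p - 1) * (1 + x / 2) powr (p - 2) * (x / 2) \<le> powr_F 1 p (x / 2)"
      using half p by (simp add: powr_F_def)
    then have "(p - 1) * (1 + x / 2) powr (p - 2) * (x / 2) * (x / 2) \<le> powr_F 1 p (x / 2) * (x / 2)"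
      using x by (intro mult_right_mono) auto
    moreover have "(p - 1) * (1 + x / 2) powr (p - 2) * (x / 2) * (x / 2) = (p - 1) * (1 + x / 2) powr (p - 2) * (x\<^sup>2 / 4)"
      by (simp add: power2_eq_square)
    ultimately have low: "(p - 1) * (1 + x / 2) powr (p - 2) * (x\<^sup>2 / 4) \<le> powr_\<Phi> 1 p x"
      using \<Phi>1 by linarith
    \<comment> \<open>\<open>X\<close> treats small and large \<open>x\<close> together:
      \<open>1 + x / 2 <= 2 X\<close>, and \<open>2 powr (p - 2) >= 1 / 2\<close>. With the
      \<open>1 / 4\<close> from the midpoint this produces the constant
      \<open>8 / (p - 1)\<close>.\<close>
    define X where "X = max 1 x"
    have X: "1 \<le> X" "x \<le> X" by (auto simp: X_def)
    have "(1 / 2) * X powr (p - 2) \<le> (2 * X) powr (p - 2)"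
    proof -
      have "2 powr (- 1) \<le> (2::real) powr (p - 2)" by (rule powr_mono) (use p in auto)
      then have "(1 / 2) * X powr (p - 2) \<le> 2 powr (p - 2) * X powr (p - 2)"
        by (intro mult_right_mono) (auto simp: powr_minus)
      then show ?thesis using X by (simp add: powr_mult)
    qed
    also have "\<dots> \<le> (1 + x / 2) powr (p - 2)"
      by (rule powr_mono2') (use X x p in auto)
    finally have "(p - 1) * ((1 / 2) * X powr (p - 2)) * (x\<^sup>2 / 4) \<le> (p - 1) * (1 + x / 2) powr (p - 2) * (x\<^sup>2 / 4)"
      using p by (intro mult_right_mono mult_left_mono) auto
    with low have "(p - 1) / 8 * (X powr (p - 2) * x\<^sup>2) \<le> powr_\<Phi> 1 p x" by (simp add: mult_ac)
    then have main: "X powr (p - 2) * x\<^sup>2 \<le> 8 / (p - 1) * powr_\<Phi> 1 p x" using p by (simp add: field_simps)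
    have xp: "x powr p = x powr (p - 2) * x\<^sup>2" using x0 by (simp add: powr_diff powr_numeral)
    have "x powr (p - 2) \<le> l powr (p - 2) * X powr (p - 2)"
    proof (cases "x \<le> 1")
      case True
      then have "X = 1" by (simp add: X_def)
      then show ?thesis using powr_mono2'[of "p - 2" l x] l False p by simp
    next
      case False
      then have "X = x" by (simp add: X_def)
      then show ?thesis using mult_right_mono[OF lp1, of "x powr (p - 2)"] by simp
    qed
    then have "x powr p \<le> l powr (p - 2) * X powr (p - 2) * x\<^sup>2"
      unfolding xp by (intro mult_right_mono) auto
    also have "\<dots> \<le> l powr (p - 2) * (8 / (p - 1) * powr_\<Phi> 1 p x)"
      unfolding mult.assoc by (rule mult_left_mono[OF main]) simp
    finally show ?thesis using x l by (simp add: add_increasing)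
  qed
qed

text \<open>The value \<open>1\<close> in the minimum is absorbed by the a priori bound
  \<open>y <= Y\<close>, as \<open>(y / Y) powr (\<gamma> * \<beta>) <= 1\<close>. Here the constant
  begins to depend on the size of the initial data.\<close>

lemma min_powr_lower_bound:
  fixes y Y b s :: real
  assumes y: "0 < y" "y \<le> Y" and c': "0 < c'" "c' * y \<le> b" and k0: "0 < k0" "k0 * y powr \<gamma> \<le> s"
    and pos: "0 < \<beta>" "0 < \<gamma>"
  shows "c' * min (Y powr (- (\<gamma> * \<beta>))) (k0 powr \<beta>) * y powr (1 + \<gamma> * \<beta>) \<le> b * min 1 (s powr \<beta>)"
proof -
  have "min (Y powr (- (\<gamma> * \<beta>))) (k0 powr \<beta>) * y powr (\<gamma> * \<beta>) \<le> min 1 (s powr \<beta>)"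
  proof (rule min.boundedI)
    have "min (Y powr (- (\<gamma> * \<beta>))) (k0 powr \<beta>) * y powr (\<gamma> * \<beta>) \<le> y powr (- (\<gamma> * \<beta>)) * y powr (\<gamma> * \<beta>)"
      using y pos by (intro mult_right_mono min.coboundedI1 powr_mono2') auto
    also have "\<dots> = 1" using y by (simp flip: powr_add)
    finally show "min (Y powr (- (\<gamma> * \<beta>))) (k0 powr \<beta>) * y powr (\<gamma> * \<beta>) \<le> 1" .
    have "min (Y powr (- (\<gamma> * \<beta>))) (k0 powr \<beta>) * y powr (\<gamma> * \<beta>) \<le> k0 powr \<beta> * y powr (\<gamma> * \<beta>)"
      by (intro mult_right_mono) auto
    also have "\<dots> = (k0 * y powr \<gamma>) powr \<beta>" using k0 y by (simp add: powr_mult powr_powr)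
    also have "\<dots> \<le> s powr \<beta>" using k0 y pos by (intro powr_mono2) auto
    finally show "min (Y powr (- (\<gamma> * \<beta>))) (k0 powr \<beta>) * y powr (\<gamma> * \<beta>) \<le> s powr \<beta>" .
  qed
  moreover have "0 \<le> b" using c' y by (meson less_imp_le mult_pos_pos order_trans)
  ultimately have "(c' * y) * (min (Y powr (- (\<gamma> * \<beta>))) (k0 powr \<beta>) * y powr (\<gamma> * \<beta>)) \<le> b * min 1 (s powr \<beta>)"
    using c' y by (intro mult_mono) auto
  moreover have "y powr (1 + \<gamma> * \<beta>) = y * y powr (\<gamma> * \<beta>)" using y by (simp add: powr_add)
  ultimately show ?thesis by (simp add: mult_ac)
qed

section \<open>Polynomial decay for bounded integrable data\<close>

locale Nash_heat_flow = heat_flow T D A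
  for T :: "real \<Rightarrow> ('a::euclidean_space \<Rightarrow> real) \<Rightarrow> 'a \<Rightarrow> real" and D A +
  fixes r d C1 :: real
  assumes r: "1 \<le> r" "r < 2" and d: "0 < d" and C1: "0 < C1"
    and Nash: "\<And>f. f \<in> form_domain D A \<inter> Lp_space 1 \<inter> Lp_space 2 \<Longrightarrow> Lp_norm r f = 1 \<Longrightarrow>
           C1 * (Lp_norm 2 f)\<^sup>2 * min 1 (Lp_norm 2 f powr (2 / d)) \<le> form D A f f"
begin

text \<open>\<open>1 / \<beta>\<close> is the factor \<open>d r / (2 - r)\<close> of
  \<open>rho\<close>.\<close>

definition "\<beta> = (2 - r) / (r * d)"
definition "K1 = C1 * 2 powr (- (2 / (r * d)))"

lemma \<beta>_pos: "0 < \<beta>" and K1_pos: "0 < K1"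
  using r d C1 by (auto simp: \<beta>_def K1_def)

text \<open>The two ranges of \<open>p\<close> differ in the premise \<open>mass\<close>, which
  bounds \<open>b / a^2\<close> below by a power of the energy:
  \<open>\<gamma> = 1 / (p - 1)\<close> for \<open>p >= 2\<close> and \<open>\<gamma> = 1\<close>
  for \<open>p < 2\<close>.\<close>

lemma energy_decay_from_Nash:
  assumes "energy_functions \<Phi> F \<psi> c"
    and v: "v \<in> Lp_space 1 \<inter> Linf_space" "AE x in lebesgue. 0 \<le> v x"
    and c': "0 < c'" "\<And>a. 0 \<le> a \<Longrightarrow> c' * \<Phi> a \<le> (\<psi> a)\<^sup>2"
    and Y: "0 < Y" "(LINT x|lebesgue. \<Phi> (v x)) \<le> Y"
    and k0: "0 < k0" "0 < \<gamma>"
    and mass: "\<And>t w. 0 < t \<Longrightarrow> w = (\<lambda>x. \<psi> (T t v x)) \<Longrightarrow> w \<in> Lp_space 1 \<inter> Linf_space \<Longrightarrow>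
      0 < (LINT x|lebesgue. \<Phi> (T t v x)) \<Longrightarrow>
      c' * (LINT x|lebesgue. \<Phi> (T t v x)) \<le> L2_inner w w \<Longrightarrow>
      0 < (LINT x|lebesgue. \<bar>w x\<bar>) \<Longrightarrow>
      k0 * (LINT x|lebesgue. \<Phi> (T t v x)) powr \<gamma> \<le> L2_inner w w / (LINT x|lebesgue. \<bar>w x\<bar>)\<^sup>2"
    and t: "0 < t"
  shows "(LINT x|lebesgue. \<Phi> (T t v x)) \<le>
    (\<gamma> * \<beta> * (c * (K1 * (c' * min (Y powr (- (\<gamma> * \<beta>))) (k0 powr \<beta>)))) * (t / 2)) powr (- (1 / (\<gamma> * \<beta>)))"
proof -
  interpret energy_functions \<Phi> F \<psi> c by fact
  interpret markov_energy T \<Phi> F \<psi> c ..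
  show ?thesis
    unfolding energy_def[OF v, symmetric]
  proof (rule energy_decay[OF v _ _ _ t])
    show "0 < \<gamma> * \<beta>" using k0 \<beta>_pos by simp
    show "0 < K1 * (c' * min (Y powr (- (\<gamma> * \<beta>))) (k0 powr \<beta>))" using K1_pos c' Y k0 by simp
    fix t m
    assume t: "0 < t" and pos: "0 < energy v t"
      and m: "\<And>h. 0 < h \<Longrightarrow> dissipation h (\<lambda>x. \<psi> (T t v x)) (\<lambda>x. \<psi> (T t v x)) / h \<le> m"
    have t0: "0 \<le> t" using t by simp
    define w where "w = (\<lambda>x. \<psi> (T t v x))"
    have w: "w \<in> Lp_space 1 \<inter> Linf_space"
      unfolding w_def by (intro \<psi>_comp flow_L1_Linf[OF v] flow_nonneg[OF v] t0)
    note w2 = L1_Linf_imp_L2[OF w]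
    have b: "c' * energy v t \<le> L2_inner w w"
    proof -
      have "(LINT x|lebesgue. c' * \<Phi> (T t v x)) \<le> L2_inner w w"
        unfolding L2_inner_def
      proof (rule integral_mono_AE)
        show "integrable lebesgue (\<lambda>x. c' * \<Phi> (T t v x))"
          using L1_Linf_integrable[OF flow_\<Phi>[OF v t0]] by simp
        show "integrable lebesgue (\<lambda>x. w x * w x)" by (intro L2_integrable_mult w2)
        show "AE x in lebesgue. c' * \<Phi> (T t v x) \<le> w x * w x"
          using flow_nonneg[OF v t0] by eventually_elim (use c'(2) in \<open>simp add: w_def power2_eq_square\<close>)
      qed
      then show ?thesis by (simp add: energy_def[OF v])
    qed
    then have bpos: "0 < L2_inner w w" using mult_pos_pos[OF c'(1) pos] by linarith
    have a: "0 < (LINT x|lebesgue. \<bar>w x\<bar>)"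
    proof -
      have "(LINT x|lebesgue. \<bar>w x\<bar>) \<noteq> 0"
      proof
        assume "(LINT x|lebesgue. \<bar>w x\<bar>) = 0"
        then have "AE x in lebesgue. w x = 0" using integral_powr_eq_0[OF w, of 1] by simp
        then have "L2_inner w w = L2_inner (\<lambda>x. 0) w" by (intro L2_inner_cong_AE w2 L2_zero)
        then show False using bpos by (simp add: L2_inner_def)
      qed
      moreover have "0 \<le> (LINT x|lebesgue. \<bar>w x\<bar>)" by (intro integral_nonneg_AE) simp
      ultimately show ?thesis by linarith
    qed
    have "c' * min (Y powr (- (\<gamma> * \<beta>))) (k0 powr \<beta>) * energy v t powr (1 + \<gamma> * \<beta>)
        \<le> L2_inner w w * min 1 ((L2_inner w w / (LINT x|lebesgue. \<bar>w x\<bar>)\<^sup>2) powr \<beta>)"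
    proof (rule min_powr_lower_bound[OF pos _ c'(1) b k0(1) _ \<beta>_pos k0(2)])
      show "energy v t \<le> Y" using energy_le_initial[OF v t0] Y by simp
      show "k0 * energy v t powr \<gamma> \<le> L2_inner w w / (LINT x|lebesgue. \<bar>w x\<bar>)\<^sup>2"
        using mass[OF t w_def w _ _ a] pos b by (simp add: energy_def[OF v])
    qed
    then have "K1 * (c' * min (Y powr (- (\<gamma> * \<beta>))) (k0 powr \<beta>) * energy v t powr (1 + \<gamma> * \<beta>))
        \<le> K1 * (L2_inner w w * min 1 ((L2_inner w w / (LINT x|lebesgue. \<bar>w x\<bar>)\<^sup>2) powr \<beta>))"
      using K1_pos by (intro mult_left_mono) auto
    also have "\<dots> \<le> m"
      using Nash_inequality[OF r d C1 Nash w m[folded w_def]] by (simp add: K1_def \<beta>_def mult_ac)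
    finally show "K1 * (c' * min (Y powr (- (\<gamma> * \<beta>))) (k0 powr \<beta>)) * energy v t powr (1 + \<gamma> * \<beta>) \<le> m"
      by (simp add: mult_ac)
  qed
qed

end

context Nash_heat_flow
begin

text \<open>Here \<open>w = u powr (p / 2)\<close>, so \<open>a\<close> is the integral of
  \<open>u powr (p / 2)\<close> and \<open>b\<close> that of \<open>u powr p\<close>. Interpolating
  the former between the mass, at most \<open>m\<close>, and \<open>b\<close> bounds
  \<open>b / a^2\<close> by a power of \<open>b\<close>. The constant is chosen before
  \<open>v\<close>, so that it serves all truncations of one function.\<close>

lemma flow_decay_ge_2:
  assumes p: "2 \<le> p" and m: "0 < m"
  shows "\<exists>K\<ge>0. \<forall>v\<in>Lp_space 1 \<inter> Linf_space. (AE x in lebesgue. 0 \<le> v x) \<longrightarrow>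
    (LINT x|lebesgue. \<bar>v x\<bar>) \<le> m \<longrightarrow> (LINT x|lebesgue. \<bar>v x\<bar> powr p) \<le> m \<longrightarrow>
    (\<forall>t>0. (LINT x|lebesgue. \<bar>T t v x\<bar> powr p) \<le> K * t powr (- ((p - 1) / \<beta>)))"
proof -
  let ?\<Phi> = "powr_\<Phi> 0 p" and ?\<psi> = "powr_\<psi> 0 p"
  have p1: "1 < p" using p by simp
  have ef: "energy_functions ?\<Phi> (powr_F 0 p) ?\<psi> (powr_c p)"
    by (rule energy_functions_powr) (use p in auto)
  define c' where "c' = 1 / (4 * max 1 (p - 1))"
  have c': "0 < c'" by (simp add: c'_def)
  have c'\<Phi>: "c' * ?\<Phi> a \<le> (?\<psi> a)\<^sup>2" if "0 \<le> a" for a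
    using powr_\<Phi>_le_\<psi>(1)[of p 0 a] that p by (simp add: c'_def field_simps)
  \<comment> \<open>\<open>e1\<close> and \<open>e2\<close> are the exponents of
    \<open>integral_powr_interpolation\<close> for the power \<open>p / 2\<close>, which must be at
    least \<open>1\<close>. The factor \<open>1 / 4\<close> in \<open>k0\<close> is the inverse
    square of the \<open>2\<close> there.\<close>
  define e1 where "e1 = (p - p / 2) / (p - 1)"
  define e2 where "e2 = (p / 2 - 1) / (p - 1)"
  define \<gamma> where "\<gamma> = 1 / (p - 1)"
  have e: "0 \<le> e1" "1 - 2 * e2 = \<gamma>" "0 < \<gamma>" using p by (auto simp: e1_def e2_def \<gamma>_def field_simps)
  define k0 where "k0 = (1 / 4) * m powr (- (2 * e1)) * c' powr \<gamma>"
  have k0: "0 < k0" using m c' by (simp add: k0_def)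
  define Q where "Q = \<gamma> * \<beta> * (powr_c p * (K1 * (c' * min (m powr (- (\<gamma> * \<beta>))) (k0 powr \<beta>)))) / 2"
  have Q: "0 < Q" using e \<beta>_pos K1_pos c' m k0 p by (simp add: Q_def powr_c_def)
  have \<Phi>_eq: "?\<Phi> x = \<bar>x\<bar> powr p / p" if "0 \<le> x" for x using that by (simp add: powr_\<Phi>_def)
  show ?thesis
  proof (intro exI[of _ "p * Q powr (- ((p - 1) / \<beta>))"] conjI ballI impI allI)
    show "0 \<le> p * Q powr (- ((p - 1) / \<beta>))" using p by simp
    fix v :: "'a \<Rightarrow> real" and t :: real
    assume v: "v \<in> Lp_space 1 \<inter> Linf_space" "AE x in lebesgue. 0 \<le> v x"
      and m1: "(LINT x|lebesgue. \<bar>v x\<bar>) \<le> m" and mp: "(LINT x|lebesgue. \<bar>v x\<bar> powr p) \<le> m" and t: "0 < t"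
    have \<Phi>_int: "(LINT x|lebesgue. ?\<Phi> (u x)) = (LINT x|lebesgue. \<bar>u x\<bar> powr p) / p"
      if u: "u \<in> Lp_space 1 \<inter> Linf_space" "AE x in lebesgue. 0 \<le> u x" for u :: "'a \<Rightarrow> real"
    proof -
      have [measurable]: "u \<in> borel_measurable lebesgue" by (rule L1_Linf_measurable[OF u(1)])
      have "(LINT x|lebesgue. ?\<Phi> (u x)) = (LINT x|lebesgue. \<bar>u x\<bar> powr p / p)"
      proof (rule integral_cong_AE)
        show "(\<lambda>x. ?\<Phi> (u x)) \<in> borel_measurable lebesgue" unfolding powr_\<Phi>_def by measurable
        show "AE x in lebesgue. ?\<Phi> (u x) = \<bar>u x\<bar> powr p / p"
          using u(2) by eventually_elim (rule \<Phi>_eq)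
      qed measurable
      then show ?thesis by simp
    qed
    have uX: "T s v \<in> Lp_space 1 \<inter> Linf_space" "AE x in lebesgue. 0 \<le> T s v x" if "0 < s" for s
      using T_L1_Linf[of s v] T_nonneg[of s v] v that by auto
    have "(LINT x|lebesgue. ?\<Phi> (T t v x)) \<le>
      (\<gamma> * \<beta> * (powr_c p * (K1 * (c' * min (m powr (- (\<gamma> * \<beta>))) (k0 powr \<beta>)))) * (t / 2)) powr (- (1 / (\<gamma> * \<beta>)))"
    proof (rule energy_decay_from_Nash[OF ef v c' c'\<Phi> m _ k0 e(3) _ t])
      have "(LINT x|lebesgue. ?\<Phi> (v x)) \<le> (LINT x|lebesgue. \<bar>v x\<bar> powr p) / 1"
        unfolding \<Phi>_int[OF v] using p by (intro divide_left_mono integral_nonneg_AE) auto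
      then show "(LINT x|lebesgue. ?\<Phi> (v x)) \<le> m" using mp by simp
      fix s w
      assume s: "0 < s" and w_def: "w = (\<lambda>x. ?\<psi> (T s v x))" and w: "w \<in> Lp_space 1 \<inter> Linf_space"
        and y: "0 < (LINT x|lebesgue. ?\<Phi> (T s v x))"
        and b: "c' * (LINT x|lebesgue. ?\<Phi> (T s v x)) \<le> L2_inner w w"
        and a: "0 < (LINT x|lebesgue. \<bar>w x\<bar>)"
      let ?u = "T s v" and ?y = "LINT x|lebesgue. ?\<Phi> (T s v x)"
      note u = uX[OF s]
      have [measurable]: "?u \<in> borel_measurable lebesgue" by (rule L1_Linf_measurable[OF u(1)])
      define a' where "a' = (LINT x|lebesgue. \<bar>w x\<bar>)"
      define b' where "b' = L2_inner w w"
      have a'_eq: "a' = (LINT x|lebesgue. \<bar>?u x\<bar> powr (p / 2))"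
        unfolding a'_def
      proof (rule integral_cong_AE)
        show "AE x in lebesgue. \<bar>w x\<bar> = \<bar>?u x\<bar> powr (p / 2)"
          using u(2) by eventually_elim (simp add: w_def powr_\<psi>_def)
      qed (use L1_Linf_measurable[OF w] in measurable)
      have b'_eq: "b' = (LINT x|lebesgue. \<bar>?u x\<bar> powr p)"
        unfolding b'_def L2_inner_def
      proof (rule integral_cong_AE)
        show "AE x in lebesgue. w x * w x = \<bar>?u x\<bar> powr p"
          using u(2) by eventually_elim (simp add: w_def powr_\<psi>_def flip: powr_add)
      qed (use L1_Linf_measurable[OF w] in measurable)
      have b'pos: "0 < b'" using b mult_pos_pos[OF c' y] by (simp add: b'_def)
      define m' where "m' = (LINT x|lebesgue. \<bar>?u x\<bar>)"
      have m'0: "0 < m'"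
      proof -
        have "m' \<noteq> 0"
        proof
          assume "m' = 0"
          then have "AE x in lebesgue. ?u x = 0"
            using integral_powr_eq_0[OF u(1), of 1] by (simp add: m'_def)
          then have "b' = (LINT x|(lebesgue :: 'a measure). 0)"
            unfolding b'_eq by (intro integral_cong_AE) (auto elim: eventually_mono)
          then show False using b'pos by simp
        qed
        moreover have "0 \<le> m'" unfolding m'_def by (intro integral_nonneg_AE) simp
        ultimately show ?thesis by linarith
      qed
      have "m' \<le> m"
      proof -
        have "m' = (LINT x|lebesgue. ?u x)" unfolding m'_def
          using u(2) by (intro integral_cong_AE) (auto elim: eventually_mono)
        also have "\<dots> \<le> (LINT x|lebesgue. v x)" using T_integral_le(2)[of s v] v s by simp
        also have "\<dots> \<le> (LINT x|lebesgue. \<bar>v x\<bar>)"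
          using L1_Linf_integrable[OF v(1)] by (intro integral_mono) auto
        finally show ?thesis using m1 by simp
      qed
      then have m'e: "m' powr e1 \<le> m powr e1" using m'0 e by (intro powr_mono2) auto
      have "a' \<le> 2 * m' powr e1 * b' powr e2"
        unfolding a'_eq b'_eq m'_def e1_def e2_def
        by (rule integral_powr_interpolation[OF u(1)]) (use p m'0 b'pos in \<open>auto simp: m'_def b'_eq\<close>)
      also have "\<dots> \<le> 2 * m powr e1 * b' powr e2" using m'e by (intro mult_right_mono mult_left_mono) auto
      finally have "a'\<^sup>2 \<le> (2 * m powr e1 * b' powr e2)\<^sup>2"
        using a by (intro power_mono) (auto simp: a'_def)
      also have "\<dots> = 4 * m powr (2 * e1) * b' powr (2 * e2)"
      proof -
        have "(x powr e)\<^sup>2 = x powr (2 * e)" for x e :: real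
          by (simp add: power2_eq_square flip: powr_add)
        then show ?thesis by (simp add: power_mult_distrib)
      qed
      finally have a2: "a'\<^sup>2 \<le> 4 * m powr (2 * e1) * b' powr (2 * e2)" .
      have "k0 * ?y powr \<gamma> = (1 / 4) * m powr (- (2 * e1)) * (c' * ?y) powr \<gamma>"
        using c' y by (simp add: k0_def powr_mult)
      also have "\<dots> \<le> (1 / 4) * m powr (- (2 * e1)) * b' powr \<gamma>"
        using b c' y e by (intro mult_left_mono powr_mono2) (auto simp: b'_def)
      also have "\<dots> = b' / (4 * m powr (2 * e1) * b' powr (2 * e2))"
        unfolding e(2)[symmetric] using b'pos m by (simp add: powr_diff powr_minus field_simps)
      also have "\<dots> \<le> b' / a'\<^sup>2"
        using a2 b'pos a by (intro divide_left_mono) (auto simp: a'_def intro!: mult_pos_pos m)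
      finally show "k0 * ?y powr \<gamma> \<le> L2_inner w w / (LINT x|lebesgue. \<bar>w x\<bar>)\<^sup>2"
        by (simp add: a'_def b'_def)
    qed
    also have "\<dots> = (Q * t) powr (- ((p - 1) / \<beta>))" by (simp add: Q_def \<gamma>_def)
    also have "\<dots> = Q powr (- ((p - 1) / \<beta>)) * t powr (- ((p - 1) / \<beta>))" using Q t by (simp add: powr_mult)
    finally show "(LINT x|lebesgue. \<bar>T t v x\<bar> powr p) \<le> p * Q powr (- ((p - 1) / \<beta>)) * t powr (- ((p - 1) / \<beta>))"
      unfolding \<Phi>_int[OF uX[OF t]] using p by (simp add: field_simps)
  qed
qed

text \<open>The shifted \<open>\<psi>\<close> satisfies \<open>\<psi> x <= x\<close>, so
  \<open>||w||_1 <= m\<close> at once and the energy decays like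
  \<open>l = t powr - (1 / \<beta>)\<close>. Returning to \<open>u powr p\<close> turns this into
  \<open>l powr (p - 1)\<close>. The time is at least \<open>1\<close> because
  \<open>powr_le_shifted_energy\<close> needs \<open>l <= 1\<close>.\<close>

lemma flow_decay_less_2:
  assumes p: "1 < p" "p < 2" and m: "0 < m"
  shows "\<exists>K\<ge>0. \<forall>v\<in>Lp_space 1 \<inter> Linf_space. (AE x in lebesgue. 0 \<le> v x) \<longrightarrow>
    (LINT x|lebesgue. \<bar>v x\<bar>) \<le> m \<longrightarrow> (LINT x|lebesgue. \<bar>v x\<bar> powr p) \<le> m \<longrightarrow>
    (\<forall>t\<ge>1. (LINT x|lebesgue. \<bar>T t v x\<bar> powr p) \<le> K * t powr (- ((p - 1) / \<beta>)))"
proof -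
  let ?\<Phi> = "powr_\<Phi> 1 p" and ?\<psi> = "powr_\<psi> 1 p"
  have ef: "energy_functions ?\<Phi> (powr_F 1 p) ?\<psi> (powr_c p)"
    by (rule energy_functions_powr) (use p in auto)
  interpret energy_functions ?\<Phi> "powr_F 1 p" ?\<psi> "powr_c p" by (rule ef)
  have c'\<Phi>: "1 / 4 * ?\<Phi> a \<le> (?\<psi> a)\<^sup>2" if "0 \<le> a" for a
    using powr_\<Phi>_le_\<psi>(1)[of p 1 a] that p by simp
  define k0 where "k0 = 1 / 4 / m\<^sup>2"
  have k0: "0 < k0" using m by (simp add: k0_def)
  define Q where "Q = 1 * \<beta> * (powr_c p * (K1 * (1 / 4 * min (m powr (- (1 * \<beta>))) (k0 powr \<beta>)))) / 2"
  have Q: "0 < Q" using \<beta>_pos K1_pos m k0 p by (simp add: Q_def powr_c_def)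
  define K where "K = m + 8 / (p - 1) * Q powr (- (1 / \<beta>))"
  show ?thesis
  proof (intro exI[of _ K] conjI ballI impI allI)
    show "0 \<le> K" using m p by (simp add: K_def)
    fix v :: "'a \<Rightarrow> real" and t :: real
    assume v: "v \<in> Lp_space 1 \<inter> Linf_space" "AE x in lebesgue. 0 \<le> v x"
      and m1: "(LINT x|lebesgue. \<bar>v x\<bar>) \<le> m" and mp: "(LINT x|lebesgue. \<bar>v x\<bar> powr p) \<le> m" and t: "1 \<le> t"
    have uX: "T s v \<in> Lp_space 1 \<inter> Linf_space" "AE x in lebesgue. 0 \<le> T s v x" if "0 < s" for s
      using T_L1_Linf[of s v] T_nonneg[of s v] v that by auto
    have umass: "(LINT x|lebesgue. T s v x) \<le> m" if "0 < s" for s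
    proof -
      have "(LINT x|lebesgue. T s v x) \<le> (LINT x|lebesgue. v x)" using T_integral_le(2)[of s v] v that by simp
      also have "\<dots> \<le> (LINT x|lebesgue. \<bar>v x\<bar>)"
        using L1_Linf_integrable[OF v(1)] by (intro integral_mono) auto
      finally show ?thesis using m1 by simp
    qed
    have t0: "0 < t" using t by simp
    have "(LINT x|lebesgue. ?\<Phi> (T t v x)) \<le>
      (1 * \<beta> * (powr_c p * (K1 * (1 / 4 * min (m powr (- (1 * \<beta>))) (k0 powr \<beta>)))) * (t / 2)) powr (- (1 / (1 * \<beta>)))"
    proof (rule energy_decay_from_Nash[OF ef v _ c'\<Phi> m _ k0 _ _ t0])
      have "(LINT x|lebesgue. ?\<Phi> (v x)) \<le> (LINT x|lebesgue. \<bar>v x\<bar> powr p)"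
      proof (rule integral_mono_AE)
        show "AE x in lebesgue. ?\<Phi> (v x) \<le> \<bar>v x\<bar> powr p"
          using v(2)
        proof eventually_elim
          case (elim x)
          show ?case
          proof (cases "v x = 0")
            case False
            with elim have x: "0 < v x" by simp
            have "?\<Phi> (v x) \<le> (1 + v x) powr (p - 2) * (v x)\<^sup>2"
              using powr_\<Phi>_le_\<psi>(2)[of p 1 "v x"] elim p by simp
            also have "\<dots> \<le> v x powr (p - 2) * (v x)\<^sup>2"
              using x p by (intro mult_right_mono powr_mono2') auto
            also have "\<dots> = v x powr p" using x by (simp add: powr_diff powr_numeral)
            finally show ?thesis using x by simp
          qed (simp add: zero)
        qed
        show "integrable lebesgue (\<lambda>x. ?\<Phi> (v x))" by (intro L1_Linf_integrable \<Phi>_comp v)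
        show "integrable lebesgue (\<lambda>x. \<bar>v x\<bar> powr p)"
          using p by (intro L1_Linf_integrable L1_Linf_powr v) auto
      qed
      then show "(LINT x|lebesgue. ?\<Phi> (v x)) \<le> m" using mp by simp
      fix s w
      assume s: "0 < s" and w_def: "w = (\<lambda>x. ?\<psi> (T s v x))" and w: "w \<in> Lp_space 1 \<inter> Linf_space"
        and y: "0 < (LINT x|lebesgue. ?\<Phi> (T s v x))"
        and b: "1 / 4 * (LINT x|lebesgue. ?\<Phi> (T s v x)) \<le> L2_inner w w"
        and a: "0 < (LINT x|lebesgue. \<bar>w x\<bar>)"
      have "(LINT x|lebesgue. \<bar>w x\<bar>) \<le> (LINT x|lebesgue. T s v x)"
      proof (rule integral_mono_AE)
        show "AE x in lebesgue. \<bar>w x\<bar> \<le> T s v x"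
          using uX(2)[OF s]
        proof eventually_elim
          case (elim x)
          have "(1 + T s v x) powr (p / 2) - 1 powr (p / 2) \<le> max 1 (p / 2) * (1 + T s v x) powr (p / 2 - 1) * ((1 + T s v x) - 1)"
            by (rule powr_diff_le) (use elim p in auto)
          also have "\<dots> \<le> 1 * 1 * T s v x"
            using elim p powr_mono2'[of "p / 2 - 1" 1 "1 + T s v x"] by (intro mult_mono) auto
          finally have "?\<psi> (T s v x) \<le> T s v x" by (simp add: powr_\<psi>_def)
          moreover have "0 \<le> ?\<psi> (T s v x)"
            using elim p ge_one_powr_ge_zero[of "1 + T s v x" "p / 2"] by (simp add: powr_\<psi>_def)
          ultimately show ?case by (simp add: w_def)
        qed
      qed (use L1_Linf_integrable[OF uX(1)[OF s]] L1_Linf_integrable[OF w] in auto)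
      then have "(LINT x|lebesgue. \<bar>w x\<bar>) \<le> m" using umass[OF s] by simp
      then have "(LINT x|lebesgue. \<bar>w x\<bar>)\<^sup>2 \<le> m\<^sup>2" using a by (intro power_mono) auto
      then have "(1 / 4 * (LINT x|lebesgue. ?\<Phi> (T s v x))) / m\<^sup>2 \<le> L2_inner w w / (LINT x|lebesgue. \<bar>w x\<bar>)\<^sup>2"
        using b a y by (intro frac_le) auto
      then show "k0 * (LINT x|lebesgue. ?\<Phi> (T s v x)) powr 1 \<le> L2_inner w w / (LINT x|lebesgue. \<bar>w x\<bar>)\<^sup>2"
        using y by (simp add: k0_def)
    qed auto
    also have "\<dots> = (Q * t) powr (- (1 / \<beta>))" by (simp add: Q_def)
    also have "\<dots> = Q powr (- (1 / \<beta>)) * t powr (- (1 / \<beta>))" using Q t by (simp add: powr_mult)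
    finally have E: "(LINT x|lebesgue. ?\<Phi> (T t v x)) \<le> Q powr (- (1 / \<beta>)) * t powr (- (1 / \<beta>))" .
    define l where "l = t powr (- (1 / \<beta>))"
    have l: "0 < l" "l \<le> 1" using t \<beta>_pos powr_mono2'[of "- (1 / \<beta>)" 1 t] by (auto simp: l_def)
    note u = uX[OF t0]
    have int: "integrable lebesgue (\<lambda>x. ?\<Phi> (T t v x))" "integrable lebesgue (T t v)"
      using L1_Linf_integrable[OF \<Phi>_comp[OF u]] L1_Linf_integrable[OF u(1)] by simp_all
    have "(LINT x|lebesgue. \<bar>T t v x\<bar> powr p)
      \<le> (LINT x|lebesgue. l powr (p - 1) * T t v x + l powr (p - 2) * (8 / (p - 1) * ?\<Phi> (T t v x)))"
    proof (rule integral_mono_AE)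
      show "integrable lebesgue (\<lambda>x. \<bar>T t v x\<bar> powr p)" using p by (intro L1_Linf_integrable L1_Linf_powr u) auto
      show "AE x in lebesgue. \<bar>T t v x\<bar> powr p \<le> l powr (p - 1) * T t v x + l powr (p - 2) * (8 / (p - 1) * ?\<Phi> (T t v x))"
        using u(2)
      proof eventually_elim
        case (elim x)
        then show ?case using powr_le_shifted_energy[OF p l elim] by simp
      qed
    qed (use int in auto)
    also have "\<dots> = l powr (p - 1) * (LINT x|lebesgue. T t v x) + l powr (p - 2) * (8 / (p - 1) * (LINT x|lebesgue. ?\<Phi> (T t v x)))"
      using int by simp
    also have "\<dots> \<le> l powr (p - 1) * m + l powr (p - 2) * (8 / (p - 1) * (Q powr (- (1 / \<beta>)) * l))"
      using umass[OF t0] E p by (intro add_mono mult_left_mono) (auto simp: l_def)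
    also have "\<dots> = l powr (p - 1) * m + (l powr (p - 2) * l powr 1) * (8 / (p - 1) * Q powr (- (1 / \<beta>)))"
      using l by simp
    also have "l powr (p - 2) * l powr 1 = l powr (p - 1)" unfolding powr_add[symmetric] by simp
    also have "l powr (p - 1) * m + l powr (p - 1) * (8 / (p - 1) * Q powr (- (1 / \<beta>))) = K * l powr (p - 1)"
      by (simp add: K_def algebra_simps)
    also have "l powr (p - 1) = t powr (- ((p - 1) / \<beta>))" by (simp add: l_def powr_powr)
    finally show "(LINT x|lebesgue. \<bar>T t v x\<bar> powr p) \<le> K * t powr (- ((p - 1) / \<beta>))" .
  qed
qed

lemma flow_decay:
  assumes p: "1 < p" and m: "0 < m"
  obtains K where "0 \<le> K" "\<And>v t. v \<in> Lp_space 1 \<inter> Linf_space \<Longrightarrow> (LINT x|lebesgue. \<bar>v x\<bar>) \<le> m \<Longrightarrow>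
    (LINT x|lebesgue. \<bar>v x\<bar> powr p) \<le> m \<Longrightarrow> 1 \<le> t \<Longrightarrow>
    (LINT x|lebesgue. \<bar>T t v x\<bar> powr p) \<le> K * t powr (- ((p - 1) / \<beta>))"
proof -
  have "\<exists>K\<ge>0. \<forall>v\<in>Lp_space 1 \<inter> Linf_space. (AE x in lebesgue. 0 \<le> v x) \<longrightarrow>
    (LINT x|lebesgue. \<bar>v x\<bar>) \<le> m \<longrightarrow> (LINT x|lebesgue. \<bar>v x\<bar> powr p) \<le> m \<longrightarrow>
    (\<forall>t\<ge>1. (LINT x|lebesgue. \<bar>T t v x\<bar> powr p) \<le> K * t powr (- ((p - 1) / \<beta>)))"
  proof (cases "p < 2")
    case False
    then show ?thesis using flow_decay_ge_2[of p m] m by fastforce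
  qed (use flow_decay_less_2 p m in blast)
  then obtain K where K: "K \<ge> 0" "\<And>v t. v \<in> Lp_space 1 \<inter> Linf_space \<Longrightarrow> AE x in lebesgue. 0 \<le> v x \<Longrightarrow>
    (LINT x|lebesgue. \<bar>v x\<bar>) \<le> m \<Longrightarrow> (LINT x|lebesgue. \<bar>v x\<bar> powr p) \<le> m \<Longrightarrow> 1 \<le> t \<Longrightarrow>
    (LINT x|lebesgue. \<bar>T t v x\<bar> powr p) \<le> K * t powr (- ((p - 1) / \<beta>))"
    by blast
  show ?thesis
  proof (rule that[OF K(1)])
    fix v :: "'a \<Rightarrow> real" and t :: real
    assume v: "v \<in> Lp_space 1 \<inter> Linf_space" and m: "(LINT x|lebesgue. \<bar>v x\<bar>) \<le> m"
      "(LINT x|lebesgue. \<bar>v x\<bar> powr p) \<le> m" and t: "1 \<le> t"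
    have t0: "0 \<le> t" using t by simp
    let ?a = "\<lambda>x. \<bar>v x\<bar>"
    have a: "?a \<in> Lp_space 1 \<inter> Linf_space" by (rule L1_Linf_abs[OF v])
    have "(LINT x|lebesgue. \<bar>T t v x\<bar> powr p) \<le> (LINT x|lebesgue. \<bar>T t ?a x\<bar> powr p)"
    proof (rule integral_mono_AE)
      show "AE x in lebesgue. \<bar>T t v x\<bar> powr p \<le> \<bar>T t ?a x\<bar> powr p"
        using T_abs_le[OF t0 v] by eventually_elim (use p in \<open>auto intro!: powr_mono2\<close>)
    qed (use p in \<open>auto intro!: L1_Linf_integrable L1_Linf_powr T_L1_Linf t0 a v simp del: Int_iff\<close>)
    also have "\<dots> \<le> K * t powr (- ((p - 1) / \<beta>))"
      by (rule K(2)[OF a]) (use m t in auto)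
    finally show "(LINT x|lebesgue. \<bar>T t v x\<bar> powr p) \<le> K * t powr (- ((p - 1) / \<beta>))" .
  qed
qed

end

section \<open>Extension to integrable functions\<close>

text \<open>A triangle inequality up to a constant suffices, because any factor is absorbed in the
  final constant.\<close>

lemma powr_add_le:
  fixes a b p :: real
  assumes "0 \<le> p"
  shows "\<bar>a + b\<bar> powr p \<le> 2 powr p * (\<bar>a\<bar> powr p + \<bar>b\<bar> powr p)"
proof -
  have "\<bar>a + b\<bar> powr p \<le> (2 * max \<bar>a\<bar> \<bar>b\<bar>) powr p" using assms by (intro powr_mono2) auto
  also have "\<dots> = 2 powr p * (max \<bar>a\<bar> \<bar>b\<bar>) powr p" by (simp add: powr_mult)
  also have "\<dots> \<le> 2 powr p * (\<bar>a\<bar> powr p + \<bar>b\<bar> powr p)"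
    by (intro mult_left_mono) (auto simp: max_def)
  finally show ?thesis .
qed

lemma Lp_add:
  assumes p: "0 \<le> p" and f: "f \<in> Lp_space p" and g: "g \<in> Lp_space p"
  shows "(\<lambda>x. f x + g x) \<in> Lp_space p"
    and "(LINT x|lebesgue. \<bar>f x + g x\<bar> powr p) \<le>
      2 powr p * ((LINT x|lebesgue. \<bar>f x\<bar> powr p) + (LINT x|lebesgue. \<bar>g x\<bar> powr p))"
proof -
  have [measurable]: "f \<in> borel_measurable lebesgue" "g \<in> borel_measurable lebesgue"
    using f g by (auto simp: Lp_space_def)
  have int: "integrable lebesgue (\<lambda>x. \<bar>f x\<bar> powr p)" "integrable lebesgue (\<lambda>x. \<bar>g x\<bar> powr p)"
    using f g by (auto simp: Lp_space_def)
  have int': "integrable lebesgue (\<lambda>x. \<bar>f x + g x\<bar> powr p)"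
    by (rule Bochner_Integration.integrable_bound[where f = "\<lambda>x. 2 powr p * (\<bar>f x\<bar> powr p + \<bar>g x\<bar> powr p)"])
      (use int powr_add_le[OF p] in auto)
  then show "(\<lambda>x. f x + g x) \<in> Lp_space p" by (simp add: Lp_space_def)
  have "(LINT x|lebesgue. \<bar>f x + g x\<bar> powr p) \<le> (LINT x|lebesgue. 2 powr p * (\<bar>f x\<bar> powr p + \<bar>g x\<bar> powr p))"
    using int int' powr_add_le[OF p] by (intro integral_mono) auto
  then show "(LINT x|lebesgue. \<bar>f x + g x\<bar> powr p) \<le>
      2 powr p * ((LINT x|lebesgue. \<bar>f x\<bar> powr p) + (LINT x|lebesgue. \<bar>g x\<bar> powr p))"
    using int by simp
qed

lemma Lp_minus: "f \<in> Lp_space p \<Longrightarrow> (\<lambda>x. - f x) \<in> Lp_space p"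
  by (simp add: Lp_space_def)

lemma Lp_diff:
  assumes p: "0 \<le> p" and f: "f \<in> Lp_space p" and g: "g \<in> Lp_space p"
  shows "(\<lambda>x. f x - g x) \<in> Lp_space p"
    and "(LINT x|lebesgue. \<bar>f x - g x\<bar> powr p) \<le>
      2 powr p * ((LINT x|lebesgue. \<bar>f x\<bar> powr p) + (LINT x|lebesgue. \<bar>g x\<bar> powr p))"
  using Lp_add[OF p f Lp_minus[OF g]] by auto

lemma Lp_norm_tendsto_0_iff:
  assumes p: "0 < p"
  shows "((\<lambda>n. Lp_norm p (F n)) \<longlonglongrightarrow> 0) \<longleftrightarrow> ((\<lambda>n::nat. LINT x|lebesgue. \<bar>F n x\<bar> powr p) \<longlonglongrightarrow> 0)"
proof
  have nn: "0 \<le> (LINT x|lebesgue. \<bar>F n x\<bar> powr p)" for n by (rule integral_nonneg_AE) simp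
  {
    assume "(\<lambda>n. Lp_norm p (F n)) \<longlonglongrightarrow> 0"
    then have "(\<lambda>n. Lp_norm p (F n) powr p) \<longlonglongrightarrow> 0"
      using p by (intro tendsto_zero_powrI[where b = p]) auto
    then show "(\<lambda>n. LINT x|lebesgue. \<bar>F n x\<bar> powr p) \<longlonglongrightarrow> 0"
      using p nn by (simp add: Lp_norm_def powr_powr)
  next
    assume "(\<lambda>n. LINT x|lebesgue. \<bar>F n x\<bar> powr p) \<longlonglongrightarrow> 0"
    then have "(\<lambda>n. (LINT x|lebesgue. \<bar>F n x\<bar> powr p) powr (1 / p)) \<longlonglongrightarrow> 0"
      using p nn by (intro tendsto_zero_powrI[where b = "1 / p"]) auto
    then show "(\<lambda>n. Lp_norm p (F n)) \<longlonglongrightarrow> 0" by (simp add: Lp_norm_def)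
  }
qed

definition truncation :: "nat \<Rightarrow> ('a \<Rightarrow> real) \<Rightarrow> 'a \<Rightarrow> real" where
  "truncation n f x = (if \<bar>f x\<bar> \<le> real n then f x else 0)"

lemma truncation_L1_Linf:
  assumes f: "f \<in> Lp_space 1"
  shows "truncation n f \<in> Lp_space 1 \<inter> Linf_space"
  unfolding L1_Linf_iff
proof
  have [measurable]: "f \<in> borel_measurable lebesgue" using f by (simp add: Lp_space_def)
  have "integrable lebesgue (\<lambda>x. \<bar>f x\<bar> powr 1)" using f by (simp add: Lp_space_def)
  then have "integrable lebesgue (\<lambda>x. \<bar>f x\<bar>)" by simp
  then show "integrable lebesgue (truncation n f)"
    by (rule Bochner_Integration.integrable_bound) (auto simp: truncation_def[abs_def])
  show "\<exists>M. AE x in lebesgue. \<bar>truncation n f x\<bar> \<le> M"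
    by (rule exI[of _ "real n"]) (simp add: truncation_def)
qed

lemma truncation_abs_le: "\<bar>truncation n f x\<bar> \<le> \<bar>f x\<bar>"
  by (simp add: truncation_def)

lemma truncation_eventually: "\<forall>\<^sub>F n in sequentially. truncation n f x = f x"
  using eventually_ge_at_top[of "nat \<lceil>\<bar>f x\<bar>\<rceil>"] by eventually_elim (auto simp: truncation_def; linarith)

lemma truncation_integral_le:
  assumes p: "0 \<le> p" and f: "f \<in> Lp_space 1" "f \<in> Lp_space p"
  shows "(LINT x|lebesgue. \<bar>truncation n f x\<bar> powr p) \<le> (LINT x|lebesgue. \<bar>f x\<bar> powr p)"
proof -
  have int: "integrable lebesgue (\<lambda>x. \<bar>f x\<bar> powr p)" using f by (simp add: Lp_space_def)
  have le: "\<bar>truncation n f x\<bar> powr p \<le> \<bar>f x\<bar> powr p" for x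
    using p by (intro powr_mono2 truncation_abs_le) auto
  have [measurable]: "truncation n f \<in> borel_measurable lebesgue"
    by (rule L1_Linf_measurable[OF truncation_L1_Linf[OF f(1)]])
  have "integrable lebesgue (\<lambda>x. \<bar>truncation n f x\<bar> powr p)"
    by (rule Bochner_Integration.integrable_bound[OF int]) (use le in auto)
  then show ?thesis using int le by (intro integral_mono) auto
qed

lemma truncation_tendsto:
  fixes f :: "'a::euclidean_space \<Rightarrow> real"
  assumes p: "0 < p" and f: "f \<in> Lp_space 1" "f \<in> Lp_space p"
  shows "(\<lambda>n. LINT x|lebesgue. \<bar>truncation n f x - f x\<bar> powr p) \<longlonglongrightarrow> 0"
proof -
  have [measurable]: "f \<in> borel_measurable lebesgue" using f by (simp add: Lp_space_def)
  have [measurable]: "truncation n f \<in> borel_measurable lebesgue" for n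
    by (rule L1_Linf_measurable[OF truncation_L1_Linf[OF f(1)]])
  have "(\<lambda>n. LINT x|lebesgue. \<bar>truncation n f x - f x\<bar> powr p) \<longlonglongrightarrow> (LINT x|(lebesgue :: 'a measure). 0)"
  proof (rule integral_dominated_convergence)
    show "integrable lebesgue (\<lambda>x. \<bar>f x\<bar> powr p)" using f by (simp add: Lp_space_def)
    have "\<forall>\<^sub>F n in sequentially. \<bar>truncation n f x - f x\<bar> powr p = 0" for x
      using truncation_eventually[of f x] by eventually_elim (use p in simp)
    then show "AE x in lebesgue. (\<lambda>n. \<bar>truncation n f x - f x\<bar> powr p) \<longlonglongrightarrow> 0"
      by (intro AE_I2 tendsto_eventually)
    show "AE x in lebesgue. norm (\<bar>truncation n f x - f x\<bar> powr p) \<le> \<bar>f x\<bar> powr p" for n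
      by (auto simp: truncation_def)
  qed measurable
  then show ?thesis by simp
qed

context symmetric_markov_semigroup
begin

lemma T_Lp_diff_le:
  assumes t: "0 \<le> t" and p: "1 < p" and f: "f \<in> Lp_space 1 \<inter> Linf_space" and g: "g \<in> Lp_space 1 \<inter> Linf_space"
  shows "(LINT x|lebesgue. \<bar>T t f x - T t g x\<bar> powr p) \<le> (LINT x|lebesgue. \<bar>f x - g x\<bar> powr p)"
proof -
  have fg: "(\<lambda>x. f x - g x) \<in> Lp_space 1 \<inter> Linf_space" using L1_Linf_lincomb[OF f g, of 1 "-1"] by simp
  have [measurable]: "T t f \<in> borel_measurable lebesgue" "T t g \<in> borel_measurable lebesgue"
    "T t (\<lambda>x. f x - g x) \<in> borel_measurable lebesgue"
    by (intro L1_Linf_measurable T_L1_Linf t f g fg)+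
  have "AE x in lebesgue. \<bar>T t f x - T t g x\<bar> powr p = \<bar>T t (\<lambda>x. f x - g x) x\<bar> powr p"
    using T_diff[OF t L1_Linf_imp_L2[OF f] L1_Linf_imp_L2[OF g]] by eventually_elim simp
  then have "(LINT x|lebesgue. \<bar>T t f x - T t g x\<bar> powr p) = (LINT x|lebesgue. \<bar>T t (\<lambda>x. f x - g x) x\<bar> powr p)"
    by (intro integral_cong_AE) measurable
  also have "\<dots> \<le> (LINT x|lebesgue. \<bar>f x - g x\<bar> powr p)" by (rule T_Lp_contraction[OF t fg p])
  finally show ?thesis .
qed

text \<open>For nonnegative \<open>f\<close> the images of the truncations increase, so that no completeness of
  \<open>L\<^sup>p\<close> is needed to find their limit.\<close>

lemma T_truncation_converges_nonneg:
  assumes t: "0 \<le> t" and p: "1 < p" and f: "f \<in> Lp_space 1" "f \<in> Lp_space p" and nonneg: "\<And>x. 0 \<le> f x"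
  shows "\<exists>u\<in>Lp_space p. (\<lambda>n. LINT x|lebesgue. \<bar>T t (truncation n f) x - u x\<bar> powr p) \<longlonglongrightarrow> 0"
proof -
  let ?G = "\<lambda>n. truncation n f"
  have GX: "?G n \<in> Lp_space 1 \<inter> Linf_space" for n by (rule truncation_L1_Linf[OF f(1)])
  have Gnn: "AE x in lebesgue. 0 \<le> ?G n x" for n using nonneg by (simp add: truncation_def)
  have [measurable]: "T t (?G n) \<in> borel_measurable lebesgue" for n
    by (intro L1_Linf_measurable T_L1_Linf t GX)
  have pos: "AE x in lebesgue. \<forall>n. 0 \<le> T t (?G n) x"
    unfolding AE_all_countable by (intro allI T_nonneg t GX Gnn)
  have mono: "AE x in lebesgue. \<forall>n. T t (?G n) x \<le> T t (?G (Suc n)) x"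
    unfolding AE_all_countable
    by (intro allI T_mono t GX) (use nonneg in \<open>auto simp: truncation_def\<close>)
  have f_int: "integrable lebesgue (\<lambda>x. \<bar>f x\<bar> powr 1)" using f(1) by (simp add: Lp_space_def)
  have fp_int: "integrable lebesgue (\<lambda>x. \<bar>f x\<bar> powr p)" using f(2) by (simp add: Lp_space_def)
  \<comment> \<open>The uniform L^1 bound makes the increasing limit finite almost
    everywhere.\<close>
  have "(\<integral>\<^sup>+x. (SUP n. ennreal (T t (?G n) x)) \<partial>lebesgue) = (SUP n. \<integral>\<^sup>+x. ennreal (T t (?G n) x) \<partial>lebesgue)"
  proof (rule nn_integral_monotone_convergence_SUP_AE)
    show "AE x in lebesgue. ennreal (T t (?G n) x) \<le> ennreal (T t (?G (Suc n)) x)" for n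
      using mono by eventually_elim (auto intro: ennreal_leI)
  qed measurable
  also have "\<dots> \<le> ennreal (LINT x|lebesgue. \<bar>f x\<bar> powr 1)"
  proof (rule SUP_least)
    fix n
    have "(\<integral>\<^sup>+x. ennreal (T t (?G n) x) \<partial>lebesgue) = ennreal (LINT x|lebesgue. T t (?G n) x)"
      by (intro nn_integral_eq_integral T_integral_le(1) T_nonneg t GX Gnn)
    also have "(LINT x|lebesgue. T t (?G n) x) \<le> (LINT x|lebesgue. ?G n x)"
      by (intro T_integral_le(2) t GX Gnn)
    also have "\<dots> \<le> (LINT x|lebesgue. \<bar>?G n x\<bar> powr 1)"
      using L1_Linf_integrable[OF GX[of n]] by (intro integral_mono) auto
    also have "\<dots> \<le> (LINT x|lebesgue. \<bar>f x\<bar> powr 1)" by (intro truncation_integral_le f) simp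
    finally show "(\<integral>\<^sup>+x. ennreal (T t (?G n) x) \<partial>lebesgue) \<le> ennreal (LINT x|lebesgue. \<bar>f x\<bar> powr 1)"
      by (simp add: ennreal_leI)
  qed
  finally have "(\<integral>\<^sup>+x. (SUP n. ennreal (T t (?G n) x)) \<partial>lebesgue) \<noteq> \<infinity>"
    by (auto simp: top_unique)
  then have fin: "AE x in lebesgue. (SUP n. ennreal (T t (?G n) x)) \<noteq> \<infinity>"
    by (intro nn_integral_PInf_AE) measurable
  define u where "u x = lim (\<lambda>n. T t (?G n) x)" for x
  have [measurable]: "u \<in> borel_measurable lebesgue" unfolding u_def by measurable
  have conv: "AE x in lebesgue. (\<lambda>n. T t (?G n) x) \<longlonglongrightarrow> u x \<and> (\<forall>n. 0 \<le> T t (?G n) x \<and> T t (?G n) x \<le> u x)"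
    using pos mono fin
  proof eventually_elim
    case (elim x)
    have inc: "incseq (\<lambda>n. T t (?G n) x)" using elim by (intro incseq_SucI) auto
    obtain B where B: "(SUP n. ennreal (T t (?G n) x)) = ennreal B" "0 \<le> B"
      using elim by (metis ennreal_cases infinity_ennreal_def)
    have "T t (?G n) x \<le> B" for n
    proof -
      have "ennreal (T t (?G n) x) \<le> ennreal B" unfolding B(1)[symmetric] by (rule SUP_upper) simp
      then show ?thesis using B(2) by simp
    qed
    then obtain L where L: "(\<lambda>n. T t (?G n) x) \<longlonglongrightarrow> L" "\<forall>n. T t (?G n) x \<le> L"
      using incseq_convergent[OF inc, of B] by blast
    then have "u x = L" unfolding u_def by (intro limI)
    then show ?case using L elim by auto
  qed
  \<comment> \<open>Fatou's lemma and the L^p contraction put the limit in L^p.\<close>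
  have "(\<integral>\<^sup>+x. ennreal (\<bar>u x\<bar> powr p) \<partial>lebesgue) \<le> ennreal (LINT x|lebesgue. \<bar>f x\<bar> powr p)"
  proof -
    have "(\<integral>\<^sup>+x. ennreal (\<bar>u x\<bar> powr p) \<partial>lebesgue) = (\<integral>\<^sup>+x. liminf (\<lambda>n. ennreal (\<bar>T t (?G n) x\<bar> powr p)) \<partial>lebesgue)"
    proof (rule nn_integral_cong_AE)
      show "AE x in lebesgue. ennreal (\<bar>u x\<bar> powr p) = liminf (\<lambda>n. ennreal (\<bar>T t (?G n) x\<bar> powr p))"
        using conv
      proof eventually_elim
        case (elim x)
        have "(\<lambda>n. ennreal (\<bar>T t (?G n) x\<bar> powr p)) \<longlonglongrightarrow> ennreal (\<bar>u x\<bar> powr p)"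
          using elim p by (intro tendsto_ennrealI tendsto_powr' tendsto_rabs tendsto_const) auto
        then show ?case by (intro lim_imp_Liminf[symmetric]) auto
      qed
    qed
    also have "\<dots> \<le> liminf (\<lambda>n. \<integral>\<^sup>+x. ennreal (\<bar>T t (?G n) x\<bar> powr p) \<partial>lebesgue)"
      by (rule nn_integral_liminf) measurable
    also have "\<dots> \<le> liminf (\<lambda>n::nat. ennreal (LINT x|lebesgue. \<bar>f x\<bar> powr p))"
    proof (intro Liminf_mono always_eventually allI)
      fix n
      have "(\<integral>\<^sup>+x. ennreal (\<bar>T t (?G n) x\<bar> powr p) \<partial>lebesgue) = ennreal (LINT x|lebesgue. \<bar>T t (?G n) x\<bar> powr p)"
        using p by (intro nn_integral_eq_integral L1_Linf_integrable L1_Linf_powr T_L1_Linf t GX) auto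
      also have "\<dots> \<le> ennreal (LINT x|lebesgue. \<bar>f x\<bar> powr p)"
        using p by (intro ennreal_leI order_trans[OF T_Lp_contraction[OF t GX p] truncation_integral_le] f) auto
      finally show "(\<integral>\<^sup>+x. ennreal (\<bar>T t (?G n) x\<bar> powr p) \<partial>lebesgue) \<le> ennreal (LINT x|lebesgue. \<bar>f x\<bar> powr p)" .
    qed
    finally show ?thesis by (simp add: Liminf_const)
  qed
  then have u_int: "integrable lebesgue (\<lambda>x. \<bar>u x\<bar> powr p)"
    by (intro integrableI_nonneg) (auto simp: less_top[symmetric] top_unique)
  \<comment> \<open>The images lie between \<open>0\<close> and \<open>u\<close>, so
    \<open>u\<close> itself dominates the differences.\<close>
  have "(\<lambda>n. LINT x|lebesgue. \<bar>T t (?G n) x - u x\<bar> powr p) \<longlonglongrightarrow> (LINT x|(lebesgue :: 'a measure). 0)"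
  proof (rule integral_dominated_convergence[OF _ _ u_int])
    show "AE x in lebesgue. (\<lambda>n. \<bar>T t (?G n) x - u x\<bar> powr p) \<longlonglongrightarrow> 0"
      using conv
    proof eventually_elim
      case (elim x)
      then have "(\<lambda>n. T t (?G n) x - u x) \<longlonglongrightarrow> 0" by (simp add: LIM_zero)
      then show ?case
        using p by (intro tendsto_zero_powrI[where b = p] tendsto_const tendsto_rabs_zero) auto
    qed
    show "AE x in lebesgue. norm (\<bar>T t (?G n) x - u x\<bar> powr p) \<le> \<bar>u x\<bar> powr p" for n
      using conv
    proof eventually_elim
      case (elim x)
      then have "0 \<le> T t (?G n) x" "T t (?G n) x \<le> u x" by auto
      then have "\<bar>T t (?G n) x - u x\<bar> powr p \<le> \<bar>u x\<bar> powr p" using p by (intro powr_mono2) auto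
      then show ?case by simp
    qed
  qed measurable
  then show ?thesis using u_int by (intro bexI[of _ u]) (auto simp: Lp_space_def)
qed

lemma T_truncation_converges:
  assumes t: "0 \<le> t" and p: "1 < p" and v: "v \<in> Lp_space 1" "v \<in> Lp_space p"
  shows "\<exists>u\<in>Lp_space p. (\<lambda>n. LINT x|lebesgue. \<bar>T t (truncation n v) x - u x\<bar> powr p) \<longlonglongrightarrow> 0"
proof -
  let ?f = "\<lambda>x. max (v x) 0" and ?g = "\<lambda>x. max (- v x) 0"
  have [measurable]: "v \<in> borel_measurable lebesgue" using v by (simp add: Lp_space_def)
  have part: "w \<in> Lp_space s" if "\<And>x. \<bar>w x\<bar> \<le> \<bar>v x\<bar>" "w \<in> borel_measurable lebesgue" "v \<in> Lp_space s" "0 \<le> s" for w s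
  proof -
    have "integrable lebesgue (\<lambda>x. \<bar>w x\<bar> powr s)"
      by (rule Bochner_Integration.integrable_bound[where f = "\<lambda>x. \<bar>v x\<bar> powr s"])
        (use that in \<open>auto simp: Lp_space_def intro!: powr_mono2\<close>)
    then show ?thesis using that by (simp add: Lp_space_def)
  qed
  have fL: "?f \<in> Lp_space 1" "?f \<in> Lp_space p" and gL: "?g \<in> Lp_space 1" "?g \<in> Lp_space p"
    using p v by (auto intro!: part)
  obtain a where a: "a \<in> Lp_space p" "(\<lambda>n. LINT x|lebesgue. \<bar>T t (truncation n ?f) x - a x\<bar> powr p) \<longlonglongrightarrow> 0"
    using T_truncation_converges_nonneg[OF t p fL] by auto
  obtain b where b: "b \<in> Lp_space p" "(\<lambda>n. LINT x|lebesgue. \<bar>T t (truncation n ?g) x - b x\<bar> powr p) \<longlonglongrightarrow> 0"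
    using T_truncation_converges_nonneg[OF t p gL] by auto
  have fX: "truncation n ?f \<in> Lp_space 1 \<inter> Linf_space" and gX: "truncation n ?g \<in> Lp_space 1 \<inter> Linf_space" for n
    by (intro truncation_L1_Linf fL gL)+
  have p0: "0 \<le> p" using p by simp
  have TfL: "T t (truncation n ?f) \<in> Lp_space p" and TgL: "T t (truncation n ?g) \<in> Lp_space p" for n
    using p by (intro L1_Linf_imp_Lp T_L1_Linf t fX gX; simp)+
  have le: "(LINT x|lebesgue. \<bar>T t (truncation n v) x - (a x - b x)\<bar> powr p) \<le>
    2 powr p * ((LINT x|lebesgue. \<bar>T t (truncation n ?f) x - a x\<bar> powr p) + (LINT x|lebesgue. \<bar>T t (truncation n ?g) x - b x\<bar> powr p))" for n
  proof -
    \<comment> \<open>Truncation commutes with the splitting into positive and negative parts, which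
      reduces the claim to nonnegative functions.\<close>
    have tr: "truncation n v = (\<lambda>x. truncation n ?f x - truncation n ?g x)"
      by (auto simp: truncation_def fun_eq_iff max_def)
    have [measurable]: "T t (truncation n v) \<in> borel_measurable lebesgue"
      by (intro L1_Linf_measurable T_L1_Linf t truncation_L1_Linf v)
    have [measurable]: "a \<in> borel_measurable lebesgue" "b \<in> borel_measurable lebesgue"
      "T t (truncation n ?f) \<in> borel_measurable lebesgue" "T t (truncation n ?g) \<in> borel_measurable lebesgue"
      using a b TfL[of n] TgL[of n] by (simp_all add: Lp_space_def)
    have "(LINT x|lebesgue. \<bar>T t (truncation n v) x - (a x - b x)\<bar> powr p) =
      (LINT x|lebesgue. \<bar>(T t (truncation n ?f) x - a x) - (T t (truncation n ?g) x - b x)\<bar> powr p)"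
    proof (rule integral_cong_AE)
      show "AE x in lebesgue. \<bar>T t (truncation n v) x - (a x - b x)\<bar> powr p =
          \<bar>(T t (truncation n ?f) x - a x) - (T t (truncation n ?g) x - b x)\<bar> powr p"
        unfolding tr using T_diff[OF t L1_Linf_imp_L2[OF fX[of n]] L1_Linf_imp_L2[OF gX[of n]]]
      proof eventually_elim
        case (elim x)
        have "T t (truncation n ?f) x - T t (truncation n ?g) x - (a x - b x) =
          (T t (truncation n ?f) x - a x) - (T t (truncation n ?g) x - b x)" by simp
        with elim show ?case by (simp only:)
      qed
    qed measurable
    also have "\<dots> \<le> 2 powr p * ((LINT x|lebesgue. \<bar>T t (truncation n ?f) x - a x\<bar> powr p) + (LINT x|lebesgue. \<bar>T t (truncation n ?g) x - b x\<bar> powr p))"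
      by (intro Lp_diff p0 TfL TgL a b)
    finally show ?thesis .
  qed
  have "(\<lambda>n. 2 powr p * ((LINT x|lebesgue. \<bar>T t (truncation n ?f) x - a x\<bar> powr p) + (LINT x|lebesgue. \<bar>T t (truncation n ?g) x - b x\<bar> powr p)))
      \<longlonglongrightarrow> 2 powr p * (0 + 0)" by (intro tendsto_intros a b)
  then have lim0: "(\<lambda>n. 2 powr p * ((LINT x|lebesgue. \<bar>T t (truncation n ?f) x - a x\<bar> powr p) + (LINT x|lebesgue. \<bar>T t (truncation n ?g) x - b x\<bar> powr p)))
      \<longlonglongrightarrow> 0" by simp
  have "(\<lambda>n. LINT x|lebesgue. \<bar>T t (truncation n v) x - (a x - b x)\<bar> powr p) \<longlonglongrightarrow> 0"
    by (rule tendsto_sandwich[OF _ _ tendsto_const lim0]; rule always_eventually)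
      (use le in \<open>simp_all add: integral_nonneg_AE\<close>)
  then show ?thesis using Lp_diff(1)[OF p0 a(1) b(1)] by (intro bexI[of _ "\<lambda>x. a x - b x"])
qed

text \<open>The choice operator returns a limit along some unknown sequence \<open>F\<close>. Both
  \<open>F\<close> and the truncations tend to \<open>v\<close> in L^p, so by contraction their
  images differ by a vanishing amount and the bound passes to the chosen limit, up to
  \<open>2 powr p\<close>.\<close>

lemma Lp_extension_integral_le:
  assumes t: "0 \<le> t" and p: "1 < p" and v: "v \<in> Lp_space 1" "v \<in> Lp_space p"
    and B: "\<And>n. (LINT x|lebesgue. \<bar>T t (truncation n v) x\<bar> powr p) \<le> B"
  shows "(LINT x|lebesgue. \<bar>Lp_extension p (T t) v x\<bar> powr p) \<le> 2 powr p * B"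
proof -
  have p0: "0 < p" "0 \<le> p" using p by auto
  let ?P = "\<lambda>u. u \<in> Lp_space p \<and> (\<exists>F. (\<forall>n. F n \<in> Lp_space 1 \<inter> Linf_space) \<and>
      (\<lambda>n. Lp_norm p (\<lambda>x. F n x - v x)) \<longlonglongrightarrow> 0 \<and> (\<lambda>n. Lp_norm p (\<lambda>x. T t (F n) x - u x)) \<longlonglongrightarrow> 0)"
  define G where "G n = truncation n v" for n
  have GX: "G n \<in> Lp_space 1 \<inter> Linf_space" for n unfolding G_def by (rule truncation_L1_Linf[OF v(1)])
  have Glim: "(\<lambda>n. LINT x|lebesgue. \<bar>G n x - v x\<bar> powr p) \<longlonglongrightarrow> 0"
    unfolding G_def by (rule truncation_tendsto[OF p0(1) v])
  obtain u0 where "u0 \<in> Lp_space p" "(\<lambda>n. LINT x|lebesgue. \<bar>T t (G n) x - u0 x\<bar> powr p) \<longlonglongrightarrow> 0"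
    using T_truncation_converges[OF t p v] by (auto simp: G_def)
  then have "?P u0"
    using GX Glim by (intro conjI exI[of _ G]) (simp_all add: Lp_norm_tendsto_0_iff[OF p0(1)])
  \<comment> \<open>\<open>SOME\<close> is meaningful because the truncations provide a
    witness.\<close>
  then have "?P (Lp_extension p (T t) v)" unfolding Lp_extension_def by (rule someI[where P = ?P])
  then obtain F where u: "Lp_extension p (T t) v \<in> Lp_space p"
    and FX: "\<And>n. F n \<in> Lp_space 1 \<inter> Linf_space"
    and Flim: "(\<lambda>n. LINT x|lebesgue. \<bar>F n x - v x\<bar> powr p) \<longlonglongrightarrow> 0"
    and TFlim: "(\<lambda>n. LINT x|lebesgue. \<bar>T t (F n) x - Lp_extension p (T t) v x\<bar> powr p) \<longlonglongrightarrow> 0"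
    by (auto simp: Lp_norm_tendsto_0_iff[OF p0(1)])
  define u where "u = Lp_extension p (T t) v"
  have uL: "u \<in> Lp_space p" using u by (simp add: u_def)
  let ?I = "\<lambda>f :: 'a \<Rightarrow> real. LINT x|lebesgue. \<bar>f x\<bar> powr p"
  have Lp: "F n \<in> Lp_space p" "G n \<in> Lp_space p" "T t (F n) \<in> Lp_space p" "T t (G n) \<in> Lp_space p" for n
    using p by (intro L1_Linf_imp_Lp T_L1_Linf t FX GX; simp)+
  have le: "?I u \<le> 2 powr p * B + 2 powr p * (2 powr p * (?I (\<lambda>x. T t (F n) x - u x)
      + 2 powr p * (?I (\<lambda>x. F n x - v x) + ?I (\<lambda>x. G n x - v x))))" for n
  proof -
    have "?I u = ?I (\<lambda>x. T t (G n) x + (u x - T t (G n) x))" by simp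
    also have "\<dots> \<le> 2 powr p * (?I (T t (G n)) + ?I (\<lambda>x. u x - T t (G n) x))"
      by (intro Lp_add Lp_diff p0 Lp uL)
    also have "?I (T t (G n)) \<le> B" using B by (simp add: G_def)
    also have "?I (\<lambda>x. u x - T t (G n) x) = ?I (\<lambda>x. (T t (F n) x - T t (G n) x) - (T t (F n) x - u x))"
      by simp
    also have "\<dots> \<le> 2 powr p * (?I (\<lambda>x. T t (F n) x - T t (G n) x) + ?I (\<lambda>x. T t (F n) x - u x))"
      by (intro Lp_diff p0 Lp uL)
    also have "?I (\<lambda>x. T t (F n) x - T t (G n) x) \<le> ?I (\<lambda>x. F n x - G n x)"
      by (rule T_Lp_diff_le[OF t p FX GX])
    also have "?I (\<lambda>x. F n x - G n x) = ?I (\<lambda>x. (F n x - v x) - (G n x - v x))" by simp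
    also have "\<dots> \<le> 2 powr p * (?I (\<lambda>x. F n x - v x) + ?I (\<lambda>x. G n x - v x))"
      by (intro Lp_diff p0 Lp v)
    finally show ?thesis by (simp add: algebra_simps)
  qed
  have "(\<lambda>n. 2 powr p * B + 2 powr p * (2 powr p * (?I (\<lambda>x. T t (F n) x - u x)
      + 2 powr p * (?I (\<lambda>x. F n x - v x) + ?I (\<lambda>x. G n x - v x)))))
      \<longlonglongrightarrow> 2 powr p * B + 2 powr p * (2 powr p * (0 + 2 powr p * (0 + 0)))"
    by (intro tendsto_intros TFlim[folded u_def] Flim Glim)
  then have "?I u \<le> 2 powr p * B + 2 powr p * (2 powr p * (0 + 2 powr p * (0 + 0)))"
    by (rule LIMSEQ_le_const) (use le in blast)
  then show ?thesis by (simp add: u_def)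
qed

end

section \<open>The decay estimate for general initial data\<close>

theorem theorem3p2:
  fixes D :: "(real ^ 'n \<Rightarrow> real) set"
    and A :: "(real ^ 'n \<Rightarrow> real) \<Rightarrow> real ^ 'n \<Rightarrow> real"
    and T :: "real \<Rightarrow> (real ^ 'n \<Rightarrow> real) \<Rightarrow> real ^ 'n \<Rightarrow> real"
    and r d C1 p q :: real
    and v :: "real ^ 'n \<Rightarrow> real"
  assumes "self_adjoint D A"
    and "positive_operator D A"
    and "heat_semigroup D A T"
    and "symmetric_semigroup T"
    and "submarkovian T"
    and "1 \<le> r" and "r < 2" and "d > 0" and "C1 > 0"
    and "\<And>f. f \<in> form_domain D A \<inter> Lp_space 1 \<inter> Lp_space 2 \<Longrightarrow> Lp_norm r f = 1 \<Longrightarrow>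
           form D A f f \<ge> C1 * (Lp_norm 2 f)\<^sup>2 * min 1 (Lp_norm 2 f powr (2 / d))"
    and "1 \<le> q" and "q < p"
    and "v \<in> Lp_space 1 \<inter> Lp_space p"
  shows "\<exists>C2>0. \<exists>t0>0. \<forall>t>t0.
           Lp_norm p (Lp_extension p (T t) v) \<le> C2 * t powr (- rho d r q p) * Lp_norm q v"
proof -
  interpret Nash_heat_flow T D A r d C1
  proof unfold_locales
    show "C0_semigroup T" using assms(3) by (simp add: heat_semigroup_def)
  qed (fact assms)+
  have p: "1 < p" and q: "1 \<le> q" "q < p" using assms by auto
  have v: "v \<in> Lp_space 1" "v \<in> Lp_space p" using assms by auto
  have [measurable]: "v \<in> borel_measurable lebesgue" using v by (simp add: Lp_space_def)
  let ?I = "\<lambda>s (f :: real ^ 'n \<Rightarrow> real). LINT x|lebesgue. \<bar>f x\<bar> powr s"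
  have I_nonneg: "0 \<le> ?I s f" for s f by (rule integral_nonneg_AE) simp
  define m where "m = max (?I 1 v) (?I p v) + 1"
  have m: "0 < m" using I_nonneg[of v 1] max.cobounded1[of "?I 1 v" "?I p v"]
    unfolding m_def by linarith
  obtain K where K: "0 \<le> K" "\<And>w t. w \<in> Lp_space 1 \<inter> Linf_space \<Longrightarrow> (LINT x|lebesgue. \<bar>w x\<bar>) \<le> m \<Longrightarrow>
    ?I p w \<le> m \<Longrightarrow> 1 \<le> t \<Longrightarrow> ?I p (T t w) \<le> K * t powr (- ((p - 1) / \<beta>))"
    by (rule flow_decay[OF p m]) blast
  \<comment> \<open>The integral of a nonintegrable function is \<open>0\<close> by convention, so
    without this \<open>Lp_norm q v = 0\<close> would not imply that \<open>v\<close>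
    vanishes.\<close>
  have vq: "integrable lebesgue (\<lambda>x. \<bar>v x\<bar> powr q)"
  proof (rule Bochner_Integration.integrable_bound)
    show "integrable lebesgue (\<lambda>x. \<bar>v x\<bar> powr 1 + \<bar>v x\<bar> powr p)"
      using v by (simp add: Lp_space_def)
    have "\<bar>v x\<bar> powr q \<le> \<bar>v x\<bar> powr 1 + \<bar>v x\<bar> powr p" for x
      using powr_interpolation[of "\<bar>v x\<bar>" 1 q p] q by simp
    then show "AE x in lebesgue. norm (\<bar>v x\<bar> powr q) \<le> norm (\<bar>v x\<bar> powr 1 + \<bar>v x\<bar> powr p)" by simp
  qed measurable
  show ?thesis
  \<comment> \<open>The constant will be divided by \<open>Lp_norm q v\<close>, so a vanishing
    \<open>v\<close> is treated apart.\<close>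
  proof (cases "Lp_norm q v = 0")
    case True
    then have "?I q v = 0" by (simp add: Lp_norm_def)
    then have "AE x in lebesgue. \<bar>v x\<bar> powr q = 0"
      using integral_nonneg_eq_0_iff_AE[OF vq] by simp
    then have v0: "AE x in lebesgue. v x = 0" by eventually_elim simp
    have "Lp_norm p (Lp_extension p (T t) v) \<le> 1 * t powr (- rho d r q p) * Lp_norm q v" if t: "0 < t" for t
    proof -
      have "?I p (T t (truncation n v)) \<le> 0" for n
      proof -
        have t0: "0 \<le> t" using t by simp
        note X = truncation_L1_Linf[OF v(1), of n]
        have "AE x in lebesgue. truncation n v x = 0" using v0 by eventually_elim (simp add: truncation_def)
        then have "AE x in lebesgue. T t (truncation n v) x = 0" by (rule T_eq_0[OF t0 L1_Linf_imp_L2[OF X]])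
        then have "?I p (T t (truncation n v)) = (LINT x|(lebesgue :: (real ^ 'n) measure). 0)"
          using L1_Linf_measurable[OF T_L1_Linf[OF t0 X]]
          by (intro integral_cong_AE) (auto elim: eventually_mono)
        then show ?thesis by simp
      qed
      then have "?I p (Lp_extension p (T t) v) \<le> 2 powr p * 0"
        using t by (intro Lp_extension_integral_le p v) auto
      then have "?I p (Lp_extension p (T t) v) = 0" using I_nonneg[of "Lp_extension p (T t) v" p] by linarith
      then show ?thesis by (simp add: Lp_norm_def)
    qed
    then show ?thesis by (intro exI[of _ 1] conjI allI impI) auto
  next
    case False
    then have vpos: "0 < Lp_norm q v" using Lp_norm_nonneg[of q v] by linarith
    \<comment> \<open>The summand \<open>1\<close> keeps the constant positive even if
      \<open>K = 0\<close>. Since \<open>C2\<close> may depend on \<open>v\<close>, it is taken as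
      \<open>C / Lp_norm q v\<close>, which cancels the norm on the right.\<close>
    define C where "C = (2 powr p * K) powr (1 / p) + 1"
    have C: "0 < C" by (simp add: C_def add_nonneg_pos)
    have "Lp_norm p (Lp_extension p (T t) v) \<le> C / Lp_norm q v * t powr (- rho d r q p) * Lp_norm q v" if t: "1 < t" for t
    proof -
      have "?I p (T t (truncation n v)) \<le> K * t powr (- ((p - 1) / \<beta>))" for n
      proof (rule K(2)[OF truncation_L1_Linf[OF v(1)]])
        show "(LINT x|lebesgue. \<bar>truncation n v x\<bar>) \<le> m"
          using truncation_integral_le[of 1 v n] v by (simp add: m_def)
        show "?I p (truncation n v) \<le> m"
          using truncation_integral_le[of p v n] v p by (simp add: m_def)
      qed (use t in simp)
      then have "?I p (Lp_extension p (T t) v) \<le> 2 powr p * (K * t powr (- ((p - 1) / \<beta>)))"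
        using t by (intro Lp_extension_integral_le p v) auto
      then have "Lp_norm p (Lp_extension p (T t) v) \<le> (2 powr p * (K * t powr (- ((p - 1) / \<beta>)))) powr (1 / p)"
        unfolding Lp_norm_def using p I_nonneg by (intro powr_mono2) auto
      also have "\<dots> = (2 powr p * K) powr (1 / p) * t powr (- ((p - 1) / \<beta>) * (1 / p))"
        using K(1) t by (simp add: powr_mult powr_powr mult.assoc)
      also have "- ((p - 1) / \<beta>) * (1 / p) = - rho d r 1 p"
        using assms(6-8) p by (simp add: rho_def \<beta>_def field_simps)
      also have "(2 powr p * K) powr (1 / p) * t powr (- rho d r 1 p) \<le> C * t powr (- rho d r q p)"
      proof (rule mult_mono)
        \<comment> \<open>The rate obtained is that of \<open>q = 1\<close>; it is the fastest, and
          for times beyond \<open>1\<close> it implies the claimed one.\<close>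
        have "rho d r q p \<le> rho d r 1 p"
          unfolding rho_def using assms(6-8) q by (intro mult_left_mono) (auto simp: field_simps)
        then show "t powr (- rho d r 1 p) \<le> t powr (- rho d r q p)" using t by (intro powr_mono) auto
      qed (use C in \<open>auto simp: C_def\<close>)
      finally show ?thesis using vpos by simp
    qed
    then show ?thesis using C vpos by (intro exI[of _ "C / Lp_norm q v"] exI[of _ 1] conjI allI impI) auto
  qed
qed

end
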